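(* Let $d$ be an even positive integer, let $k,l$ be positive integers, and let $V$ be a finite-dimensional complex vector space with $\dim V\ge k+l$. Let $(a_1,\dots,a_p)$ and $(b_1,\dots,b_q)$ be partitions with $a_p\ge b_1$ such that $S_{(a_1,\dots,a_p)}V$ occurs in $S^k(S^dV)$ (with positive multiplicity) and $S_{(b_1,\dots,b_q)}V$ occurs in $S^l(S^dV)$ (with positive multiplicity). Then $S_{(a_1,\dots,a_p,b_1,\dots,b_q)}V$ occurs in $S^{k+l}(S^dV)$ with positive multiplicity.
   Context: For a partition $\lambda$, $S_\lambda V$ is the irreducible polynomial $GL(V)$-module of highest weight $\lambda$. A partition $(\lambda_1,\dots,\lambda_s)$ satisfies $\lambda_1\ge\cdots\ge\lambda_s>0$. $S^k(S^dV)$ carries the induced $GL(V)$-action. *)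

theory Defs
  imports Complex_Main "HOL-Library.Function_Algebras"
begin

text \<open>
  A complex vector space is a type \<open>'v\<close> with a scalar multiplication
  \<open>s :: complex \<Rightarrow> 'v \<Rightarrow> 'v\<close> satisfying the library locale \<open>vector_space\<close>.
  Complex-valued functions carry the pointwise structure.
\<close>

definition fscale :: "complex \<Rightarrow> ('a \<Rightarrow> complex) \<Rightarrow> 'a \<Rightarrow> complex" where
  "fscale c f = (\<lambda>x. c * f x)"

lemma vector_space_fscale: "vector_space fscale"
  by unfold_locales (auto simp: fscale_def fun_eq_iff algebra_simps)

definition dual_space :: "(complex \<Rightarrow> 'v::ab_group_add \<Rightarrow> 'v) \<Rightarrow> ('v \<Rightarrow> complex) set" where
  "dual_space s = {\<eta>. Vector_Spaces.linear s (*) \<eta>}"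

definition GL :: "(complex \<Rightarrow> 'v::ab_group_add \<Rightarrow> 'v) \<Rightarrow> ('v \<Rightarrow> 'v) set" where
  "GL s = {g. Vector_Spaces.linear s s g \<and> bij g}"


text \<open>
  Symmetric powers are realised as homogeneous polynomial functions on the dual space.
  A vector \<open>u\<close> is the linear function \<open>\<eta> \<mapsto> \<eta> u\<close> on the dual, and the product
  \<open>u\<^sub>1 \<cdots> u\<^sub>k\<close> is \<open>\<eta> \<mapsto> \<eta> u\<^sub>1 \<cdots> \<eta> u\<^sub>k\<close>, extended by \<open>0\<close> to functions
  \<open>\<eta>\<close> that are not linear.  The \<open>k\<close>-th symmetric power of a subspace \<open>U\<close> is the span of
  all \<open>k\<close>-fold products of elements of \<open>U\<close>.  As the scalar field is infinite, this is
  canonically the quotient of the \<open>k\<close>-th tensor power of \<open>U\<close> by permutations of the factors.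
  Functionals on the ambient space may be used instead of functionals on \<open>U\<close>, because
  every functional on \<open>U\<close> extends.
\<close>

definition sym_prod ::
  "(complex \<Rightarrow> 'v::ab_group_add \<Rightarrow> 'v) \<Rightarrow> 'v list \<Rightarrow> ('v \<Rightarrow> complex) \<Rightarrow> complex" where
  "sym_prod s us = (\<lambda>\<eta>. if \<eta> \<in> dual_space s then prod_list (map \<eta> us) else 0)"

definition sym_power ::
  "(complex \<Rightarrow> 'v::ab_group_add \<Rightarrow> 'v) \<Rightarrow> nat \<Rightarrow> 'v set \<Rightarrow> (('v \<Rightarrow> complex) \<Rightarrow> complex) set" where
  "sym_power s k U = module.span fscale {sym_prod s us | us. length us = k \<and> set us \<subseteq> U}"

text \<open>
  The action induced by \<open>g\<close> on symmetric powers; the lemma \<open>sym_act_sym_prod\<close> below states that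
  \<open>g\<close> sends \<open>u\<^sub>1 \<cdots> u\<^sub>k\<close> to \<open>g u\<^sub>1 \<cdots> g u\<^sub>k\<close>.
\<close>

definition sym_act ::
  "('v \<Rightarrow> 'v) \<Rightarrow> (('v \<Rightarrow> complex) \<Rightarrow> complex) \<Rightarrow> ('v \<Rightarrow> complex) \<Rightarrow> complex" where
  "sym_act g F = (\<lambda>\<eta>. F (\<eta> \<circ> g))"

lemma dual_space_comp_iff:
  assumes "g \<in> GL s"
  shows "\<eta> \<circ> g \<in> dual_space s \<longleftrightarrow> \<eta> \<in> dual_space s"
proof
  have lin: "Vector_Spaces.linear s s g" and bij: "bij g"
    using assms by (auto simp: GL_def)
  show "\<eta> \<circ> g \<in> dual_space s" if "\<eta> \<in> dual_space s"
    using Vector_Spaces.linear_compose[OF lin] that by (simp add: dual_space_def)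
  show "\<eta> \<in> dual_space s" if "\<eta> \<circ> g \<in> dual_space s"
  proof -
    interpret g: Vector_Spaces.linear s s g by (fact lin)
    interpret h: Vector_Spaces.linear s "(*)" "\<eta> \<circ> g"
      using that by (simp add: dual_space_def)
    have inv: "g (inv g x) = x" for x
      using bij by (simp add: bij_is_surj surj_f_inv_f)
    have "\<eta> (x + y) = \<eta> x + \<eta> y" for x y
      using h.add[of "inv g x" "inv g y"] by (simp add: g.add inv)
    moreover have "\<eta> (s c x) = c * \<eta> x" for c x
      using h.scale[of c "inv g x"] by (simp add: g.scale inv)
    moreover have "vector_space s" "vector_space ((*) :: complex \<Rightarrow> complex \<Rightarrow> complex)"
      using that by (auto simp: dual_space_def Vector_Spaces.linear_iff)
    ultimately show ?thesis
      by (simp add: dual_space_def Vector_Spaces.linear_iff)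
  qed
qed

lemma sym_act_sym_prod:
  assumes "g \<in> GL s"
  shows "sym_act g (sym_prod s us) = sym_prod s (map g us)"
  by (auto simp: sym_act_def sym_prod_def dual_space_comp_iff[OF assms] fun_eq_iff)

lemma sym_act_GL:
  assumes "g \<in> GL s"
  shows "sym_act g \<in> GL fscale"
proof -
  have bij: "bij g" using assms by (simp add: GL_def)
  have "sym_act g (sym_act (inv g) F) = F" "sym_act (inv g) (sym_act g F) = F" for F
    using bij by (auto simp: sym_act_def comp_assoc bij_is_inj bij_is_surj surj_iff[symmetric]
        fun_eq_iff surj_f_inv_f comp_def)
  then have "bij (sym_act g)"
    by (intro o_bij[of "sym_act (inv g)"]) (auto simp: fun_eq_iff)
  moreover have "Vector_Spaces.linear fscale fscale (sym_act g)"
    by (simp add: Vector_Spaces.linear_iff vector_space_fscale sym_act_def fscale_def fun_eq_iff)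
  ultimately show ?thesis by (simp add: GL_def)
qed

text \<open>The module \<open>S\<^sup>k(S\<^sup>d V)\<close>, where \<open>V\<close> is the whole type \<open>'v\<close>, and its action.\<close>

definition plethysm ::
  "(complex \<Rightarrow> 'v::ab_group_add \<Rightarrow> 'v) \<Rightarrow> nat \<Rightarrow> nat
    \<Rightarrow> (((('v \<Rightarrow> complex) \<Rightarrow> complex) \<Rightarrow> complex) \<Rightarrow> complex) set" where
  "plethysm s k d = sym_power fscale k (sym_power s d UNIV)"

definition plethysm_act ::
  "('v \<Rightarrow> 'v) \<Rightarrow> (((('v \<Rightarrow> complex) \<Rightarrow> complex) \<Rightarrow> complex) \<Rightarrow> complex)
    \<Rightarrow> ((('v \<Rightarrow> complex) \<Rightarrow> complex) \<Rightarrow> complex) \<Rightarrow> complex" where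
  "plethysm_act g = sym_act (sym_act g)"


text \<open>
  Below, \<open>s\<close> is the scalar multiplication of \<open>V\<close>, while \<open>t\<close> is that of the space containing the
  module \<open>W\<close>, on which \<open>g \<in> GL s\<close> acts by \<open>act g\<close>.
\<close>

definition GL_submodule ::
  "(complex \<Rightarrow> 'v::ab_group_add \<Rightarrow> 'v) \<Rightarrow> (complex \<Rightarrow> 'm::ab_group_add \<Rightarrow> 'm)
    \<Rightarrow> (('v \<Rightarrow> 'v) \<Rightarrow> 'm \<Rightarrow> 'm) \<Rightarrow> 'm set \<Rightarrow> bool" where
  "GL_submodule s t act W \<longleftrightarrow> module.subspace t W \<and> (\<forall>g\<in>GL s. act g ` W \<subseteq> W)"

definition irreducible_module ::
  "(complex \<Rightarrow> 'v::ab_group_add \<Rightarrow> 'v) \<Rightarrow> (complex \<Rightarrow> 'm::ab_group_add \<Rightarrow> 'm)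
    \<Rightarrow> (('v \<Rightarrow> 'v) \<Rightarrow> 'm \<Rightarrow> 'm) \<Rightarrow> 'm set \<Rightarrow> bool" where
  "irreducible_module s t act W \<longleftrightarrow>
     GL_submodule s t act W \<and> W \<noteq> {0} \<and>
     (\<forall>W'. GL_submodule s t act W' \<and> W' \<subseteq> W \<longrightarrow> W' = {0} \<or> W' = W)"

text \<open>Polynomial functions in the matrix entries of an endomorphism of \<open>V\<close>.\<close>

inductive_set poly_funs ::
  "(complex \<Rightarrow> 'v::ab_group_add \<Rightarrow> 'v) \<Rightarrow> (('v \<Rightarrow> 'v) \<Rightarrow> complex) set"
  for s :: "complex \<Rightarrow> 'v::ab_group_add \<Rightarrow> 'v" where
  const: "(\<lambda>_. c) \<in> poly_funs s"
| entry: "\<xi> \<in> dual_space s \<Longrightarrow> (\<lambda>g. \<xi> (g v)) \<in> poly_funs s"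
| add: "p \<in> poly_funs s \<Longrightarrow> q \<in> poly_funs s \<Longrightarrow> (\<lambda>g. p g + q g) \<in> poly_funs s"
| mult: "p \<in> poly_funs s \<Longrightarrow> q \<in> poly_funs s \<Longrightarrow> (\<lambda>g. p g * q g) \<in> poly_funs s"

definition polynomial_module ::
  "(complex \<Rightarrow> 'v::ab_group_add \<Rightarrow> 'v) \<Rightarrow> (complex \<Rightarrow> 'm::ab_group_add \<Rightarrow> 'm)
    \<Rightarrow> (('v \<Rightarrow> 'v) \<Rightarrow> 'm \<Rightarrow> 'm) \<Rightarrow> 'm set \<Rightarrow> bool" where
  "polynomial_module s t act W \<longleftrightarrow>
     (\<forall>w\<in>W. \<forall>\<phi>\<in>dual_space t. \<exists>p\<in>poly_funs s. \<forall>g\<in>GL s. \<phi> (act g w) = p g)"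

text \<open>
  Weights are taken with respect to an ordered basis \<open>e\<close> of \<open>V\<close>: the torus consists of the
  maps that are diagonal in \<open>e\<close>, and the Borel subgroup of those that are upper triangular.
  The list \<open>\<lambda>\<close> stands for the weight obtained by padding it with zeros, which
  makes sense only if \<open>\<lambda>\<close> has at most \<open>dim V\<close> entries.
\<close>

definition upper_unitriangular ::
  "(complex \<Rightarrow> 'v::ab_group_add \<Rightarrow> 'v) \<Rightarrow> 'v list \<Rightarrow> ('v \<Rightarrow> 'v) set" where
  "upper_unitriangular s e =
     {u \<in> GL s. \<forall>j<length e. u (e ! j) - e ! j \<in> module.span s (set (take j e))}"

definition weight_vector ::
  "(complex \<Rightarrow> 'v::ab_group_add \<Rightarrow> 'v) \<Rightarrow> 'v list \<Rightarrow> (complex \<Rightarrow> 'm::ab_group_add \<Rightarrow> 'm)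
    \<Rightarrow> (('v \<Rightarrow> 'v) \<Rightarrow> 'm \<Rightarrow> 'm) \<Rightarrow> nat list \<Rightarrow> 'm \<Rightarrow> bool" where
  "weight_vector s e t act lam w \<longleftrightarrow>
     length lam \<le> length e \<and> w \<noteq> 0 \<and>
     (\<forall>g\<in>GL s. \<forall>z. (\<forall>i<length e. g (e ! i) = s (z i) (e ! i)) \<longrightarrow>
        act g w = t (\<Prod>i<length lam. z i ^ (lam ! i)) w)"

definition has_highest_weight ::
  "(complex \<Rightarrow> 'v::ab_group_add \<Rightarrow> 'v) \<Rightarrow> 'v list \<Rightarrow> (complex \<Rightarrow> 'm::ab_group_add \<Rightarrow> 'm)
    \<Rightarrow> (('v \<Rightarrow> 'v) \<Rightarrow> 'm \<Rightarrow> 'm) \<Rightarrow> nat list \<Rightarrow> 'm set \<Rightarrow> bool" where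
  "has_highest_weight s e t act lam W \<longleftrightarrow>
     (\<exists>w\<in>W. weight_vector s e t act lam w \<and> (\<forall>u\<in>upper_unitriangular s e. act u w = w))"

definition is_Schur_module ::
  "(complex \<Rightarrow> 'v::ab_group_add \<Rightarrow> 'v) \<Rightarrow> 'v list \<Rightarrow> (complex \<Rightarrow> 'm::ab_group_add \<Rightarrow> 'm)
    \<Rightarrow> (('v \<Rightarrow> 'v) \<Rightarrow> 'm \<Rightarrow> 'm) \<Rightarrow> nat list \<Rightarrow> 'm set \<Rightarrow> bool" where
  "is_Schur_module s e t act lam W \<longleftrightarrow>
     irreducible_module s t act W \<and> polynomial_module s t act W \<and>
     has_highest_weight s e t act lam W"

text \<open>
  \<open>S\<^sub>\<lambda> V\<close> is determined up to isomorphism by being irreducible and polynomial of highest weight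
  \<open>\<lambda>\<close>; it has positive multiplicity in a module if it is isomorphic to one of its submodules.
\<close>

definition occurs_in_plethysm ::
  "(complex \<Rightarrow> 'v::ab_group_add \<Rightarrow> 'v) \<Rightarrow> 'v list \<Rightarrow> nat list \<Rightarrow> nat \<Rightarrow> nat \<Rightarrow> bool" where
  "occurs_in_plethysm s e lam k d \<longleftrightarrow>
     (\<exists>W \<subseteq> plethysm s k d. is_Schur_module s e fscale plethysm_act lam W)"

definition is_partition :: "nat list \<Rightarrow> bool" where
  "is_partition lam \<longleftrightarrow> sorted_wrt (\<ge>) lam \<and> (\<forall>x\<in>set lam. 0 < x)"

end

theory Submission
  imports Defs "HOL-Library.Multiset" "HOL-Computational_Algebra.Polynomial"
begin

text \<open>
  For even \<open>d\<close>, exchanging symmetric and exterior powers turns \<open>S\<^sub>\<lambda>\<close> in \<open>S\<^sup>k(S\<^sup>d V)\<close> into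
  \<open>S\<^sub>\<lambda>\<^sub>'\<close> in \<open>S\<^sup>k(\<And>\<^sup>d W)\<close>. Stacking two partitions adds their conjugates, and highest weight vectors of
  the polynomial ring \<open>\<Oplus>\<^sub>k S\<^sup>k(\<And>\<^sup>d W)\<close> have a nonzero product. The exchange is made explicit by the
  Lie superalgebra \<open>gl(V|W)\<close> acting on tensors: applying one odd operator \<open>x\<^sub>i \<mapsto> f\<^sub>c\<close> for every box
  \<open>(i, c)\<close> of the diagram takes a highest weight tensor \<open>F\<close> over \<open>V\<close> to a tensor \<open>\<omega> F\<close> over \<open>W\<close>, which is
  nonzero (odd reflections), alternating inside the blocks and symmetric under exchanging them.
  For an alternating form \<open>M\<close>, \<open>P\<^sub>F(M) = \<langle>\<omega> F, M \<otimes> \<dots> \<otimes> M\<rangle>\<close> is a nonzero polynomial in \<open>M\<close>, and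
  \<open>P\<^sub>F P\<^sub>G\<close> is the polynomial of \<open>F\<close> followed by \<open>G\<close> shifted to the next rows. The transposed operators
  applied to \<open>M \<otimes> \<dots> \<otimes> M\<close> give a highest weight vector of the stacked weight that pairs with this
  tensor to \<open>P\<^sub>F(M) P\<^sub>G(M)\<close>, hence is nonzero for suitable \<open>M\<close>.
\<close>

subsection \<open>Tensors as functions on words\<close>

text \<open>Products of highest weight vectors add partitions, whereas here they are to be stacked,
  and \<open>F\<close> followed by the shifted \<open>G\<close> is not a highest weight tensor: a
  raising operator may turn a letter of \<open>G\<close> into one of \<open>F\<close>. Hence the
  passage to conjugate partitions, where only the nonvanishing of a product is at stake. Evenness of
  \<open>d\<close> makes two blocks of \<open>d\<close> odd letters commute, so that ordinary
  polynomials arise. The inequality between the last part of \<open>a\<close> and the first part of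
  \<open>b\<close> makes \<open>a @ b\<close> a diagram, which gives invariance under unitriangular
  matrices; dim V >= k + l provides room for its rows, as \<open>a\<close> has at most
  \<open>k\<close> rows and \<open>b\<close> at most \<open>l\<close>. The translation between
  submodules of the plethysm and tensors rests on the standard Hermitian form. The adjoint of a
  matrix acts by its conjugate transpose, so orthogonal complements of invariant subspaces are
  invariant. This lifts highest weight vectors from the quotient S^k(S^d V) to tensors and shows
  that highest weight tensors generate irreducible modules.\<close>

primrec tsum :: "'a set \<Rightarrow> nat \<Rightarrow> ('a list \<Rightarrow> complex) \<Rightarrow> complex" where
  "tsum X 0 f = f []"
| "tsum X (Suc n) f = (\<Sum>x\<in>X. tsum X n (\<lambda>w. f (x # w)))"

definition words :: "'a set \<Rightarrow> nat \<Rightarrow> 'a list set" where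
  "words X n = {w. set w \<subseteq> X \<and> length w = n}"

lemma words_0 [simp]: "words X 0 = {[]}"
  by (auto simp: words_def)

lemma Cons_in_words [simp]: "x # w \<in> words X (Suc n) \<longleftrightarrow> x \<in> X \<and> w \<in> words X n"
  by (auto simp: words_def)

lemma append_in_words: "u \<in> words X m \<Longrightarrow> v \<in> words X n \<Longrightarrow> u @ v \<in> words X (m + n)"
  by (auto simp: words_def)

lemma words_Suc: "words X (Suc n) = (\<lambda>(x, w). x # w) ` (X \<times> words X n)"
  by (auto simp: words_def length_Suc_conv image_iff)

lemma finite_words: "finite X \<Longrightarrow> finite (words X n)"
  unfolding words_def by (rule finite_lists_length_eq)

lemma length_words: "w \<in> words X n \<Longrightarrow> length w = n"
  by (simp add: words_def)

lemma concat_in_words: "bs \<in> words (words X d) k \<Longrightarrow> concat bs \<in> words X (k * d)"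
proof (induction k arbitrary: bs)
  case (Suc k)
  then obtain b bs' where "bs = b # bs'" "b \<in> words X d" "bs' \<in> words (words X d) k"
    by (auto simp: words_Suc)
  then show ?case using Suc.IH append_in_words[of b X d "concat bs'" "k * d"] by simp
qed simp

lemma words_concat:
  "w \<in> words X (k * d) \<Longrightarrow> \<exists>bs\<in>words (words X d) k. w = concat bs"
proof (induction k arbitrary: w)
  case (Suc k)
  have "drop d w \<in> words X (k * d)" and t: "take d w \<in> words X d"
    using Suc.prems by (auto simp: words_def dest: in_set_dropD in_set_takeD)
  then obtain bs where bs: "bs \<in> words (words X d) k" "drop d w = concat bs"
    using Suc.IH by blast
  have "w = concat (take d w # bs)"
    by (metis append_take_drop_id bs(2) concat.simps(2))
  with bs t show ?case
    by (intro bexI[of _ "take d w # bs"]) auto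
qed simp

lemma tsum_cong:
  "(\<And>w. w \<in> words X n \<Longrightarrow> f w = g w) \<Longrightarrow> tsum X n f = tsum X n g"
proof (induction n arbitrary: f g)
  case (Suc n)
  have "tsum X n (\<lambda>w. f (x # w)) = tsum X n (\<lambda>w. g (x # w))" if "x \<in> X" for x
    using that Suc.prems by (intro Suc.IH) simp
  then show ?case by (simp cong: sum.cong)
qed simp

lemma tsum_eq_sum: "tsum X n f = (\<Sum>w\<in>words X n. f w)" if "finite X"
proof (induction n arbitrary: f)
  case (Suc n)
  have "inj_on (\<lambda>(x, w). x # w) (X \<times> words X n)" by (auto simp: inj_on_def)
  then have "(\<Sum>w\<in>words X (Suc n). f w) = (\<Sum>(x, w)\<in>X \<times> words X n. f (x # w))"
    unfolding words_Suc by (subst sum.reindex) (auto simp: case_prod_unfold)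
  then show ?case using Suc by (simp add: sum.cartesian_product)
qed simp

lemma tsum_zero [simp]: "tsum X n (\<lambda>w. 0) = 0"
  by (induction n) auto

lemma tsum_add: "tsum X n (\<lambda>w. f w + g w) = tsum X n f + tsum X n g"
  by (induction n arbitrary: f g) (auto simp: sum.distrib)

lemma tsum_cmult: "tsum X n (\<lambda>w. c * f w) = c * tsum X n f"
  by (induction n arbitrary: f) (auto simp: sum_distrib_left)

lemma tsum_cmult_right: "tsum X n (\<lambda>w. f w * c) = tsum X n f * c"
  using tsum_cmult[of X n c f] by (simp add: mult.commute)

lemma tsum_uminus: "tsum X n (\<lambda>w. - f w) = - tsum X n f"
  using tsum_cmult[of X n "-1" f] by simp

lemma tsum_diff: "tsum X n (\<lambda>w. f w - g w) = tsum X n f - tsum X n g"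
  using tsum_add[of X n f "\<lambda>w. - g w"] by (simp add: tsum_uminus)

lemma tsum_sum: "tsum X n (\<lambda>w. \<Sum>i\<in>I. f i w) = (\<Sum>i\<in>I. tsum X n (f i))"
proof (induction n arbitrary: f)
  case (Suc n)
  then show ?case by (simp add: sum.swap[of _ X I])
qed simp

lemma tsum_append: "tsum X (m + n) f = tsum X m (\<lambda>u. tsum X n (\<lambda>v. f (u @ v)))"
  by (induction m arbitrary: f) auto

lemma tsum_concat:
  "finite X \<Longrightarrow> tsum X (k * d) f = tsum (words X d) k (\<lambda>bs. f (concat bs))"
proof (induction k arbitrary: f)
  case (Suc k)
  then show ?case
    by (simp add: tsum_append tsum_eq_sum[of X d])
qed simp

lemma tsum_delta:
  assumes "finite X" "a \<in> words X n"
  shows "tsum X n (\<lambda>w. (if w = a then 1 else 0) * f w) = f a"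
proof -
  have "tsum X n (\<lambda>w. (if w = a then 1 else 0) * f w)
      = (\<Sum>w\<in>words X n. (if w = a then 1 else 0) * f w)"
    using assms(1) by (rule tsum_eq_sum)
  also have "\<dots> = f a"
    using assms finite_words[OF assms(1)] by (subst sum.remove[of _ a]) auto
  finally show ?thesis .
qed

section \<open>Matrices acting on tensors, and the standard Hermitian form\<close>

primrec act :: "nat \<Rightarrow> (nat \<Rightarrow> nat \<Rightarrow> complex) \<Rightarrow> (nat list \<Rightarrow> complex) \<Rightarrow> nat list \<Rightarrow> complex" where
  "act N g f [] = f []"
| "act N g f (x # w) = (\<Sum>y<N. g x y * act N g (\<lambda>w. f (y # w)) w)"

definition mmul :: "nat \<Rightarrow> (nat \<Rightarrow> nat \<Rightarrow> complex) \<Rightarrow> (nat \<Rightarrow> nat \<Rightarrow> complex) \<Rightarrow> nat \<Rightarrow> nat \<Rightarrow> complex" where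
  "mmul N g h = (\<lambda>x z. \<Sum>y<N. g x y * h y z)"

definition madj :: "(nat \<Rightarrow> nat \<Rightarrow> complex) \<Rightarrow> nat \<Rightarrow> nat \<Rightarrow> complex" where
  "madj g = (\<lambda>x y. cnj (g y x))"

primrec wprod :: "(nat \<Rightarrow> nat \<Rightarrow> complex) \<Rightarrow> nat list \<Rightarrow> nat list \<Rightarrow> complex" where
  "wprod g [] w = 1"
| "wprod g (x # u) w = g x (hd w) * wprod g u (tl w)"

text \<open>Identifies \<open>act N g\<close> with the tensor power of \<open>g\<close> on
  coefficient functions, in every degree at once.\<close>

lemma act_eq_tsum: "act N g f w = tsum {..<N} (length w) (\<lambda>u. wprod g w u * f u)"
proof (induction w arbitrary: f)
  case (Cons x w)
  show ?case by (simp add: Cons tsum_cmult[symmetric] mult.assoc)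
qed simp

lemma act_add: "act N g (\<lambda>w. f w + h w) w = act N g f w + act N g h w"
  by (induction w arbitrary: f h) (auto simp: algebra_simps sum.distrib)

lemma act_cmult: "act N g (\<lambda>w. c * f w) w = c * act N g f w"
  by (induction w arbitrary: f) (auto simp: algebra_simps sum_distrib_left)

lemma act_sum: "act N g (\<lambda>w. \<Sum>i\<in>I. f i w) w = (\<Sum>i\<in>I. act N g (f i) w)"
proof (induction w arbitrary: f)
  case (Cons x w)
  show ?case by (simp add: Cons sum_distrib_left sum.swap[of _ I "{..<N}"])
qed simp

lemma act_cong:
  "(\<And>u. u \<in> words {..<N} (length w) \<Longrightarrow> f u = h u) \<Longrightarrow> act N g f w = act N g h w"
  unfolding act_eq_tsum by (rule tsum_cong) auto

lemma act_act: "act N g (act N h f) w = act N (mmul N g h) f w"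
proof (induction w arbitrary: f)
  case (Cons x w)
  have "act N g (act N h f) (x # w)
      = (\<Sum>y<N. g x y * act N g (\<lambda>w. \<Sum>z<N. h y z * act N h (\<lambda>w. f (z # w)) w) w)"
    by (simp only: act.simps)
  also have "\<dots> = (\<Sum>y<N. \<Sum>z<N. g x y * h y z * act N (mmul N g h) (\<lambda>w. f (z # w)) w)"
    unfolding act_sum act_cmult Cons sum_distrib_left mult.assoc ..
  also have "\<dots> = (\<Sum>z<N. \<Sum>y<N. g x y * h y z * act N (mmul N g h) (\<lambda>w. f (z # w)) w)"
    by (rule sum.swap)
  also have "\<dots> = act N (mmul N g h) f (x # w)"
    by (simp add: mmul_def sum_distrib_right)
  finally show ?case .
qed simp

lemma act_append: "act N g f (u @ v) = act N g (\<lambda>u'. act N g (\<lambda>v'. f (u' @ v')) v) u"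
  by (induction u arbitrary: f) auto

lemma act_transpose:
  "tsum {..<N} n (\<lambda>w. act N g f w * h w) = tsum {..<N} n (\<lambda>w. f w * act N (\<lambda>x y. g y x) h w)"
proof (induction n arbitrary: f h)
  case (Suc n)
  have "tsum {..<N} (Suc n) (\<lambda>w. act N g f w * h w)
     = (\<Sum>x<N. \<Sum>y<N. g x y * tsum {..<N} n (\<lambda>w. act N g (\<lambda>w. f (y # w)) w * h (x # w)))"
    by (simp add: sum_distrib_right tsum_sum mult.assoc tsum_cmult)
  also have "\<dots> = (\<Sum>y<N. \<Sum>x<N. g x y * tsum {..<N} n (\<lambda>w. f (y # w) * act N (\<lambda>x y. g y x) (\<lambda>w. h (x # w)) w))"
    by (subst sum.swap) (simp add: Suc)
  also have "\<dots> = tsum {..<N} (Suc n) (\<lambda>w. f w * act N (\<lambda>x y. g y x) h w)"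
    by (simp add: sum_distrib_left tsum_sum mult.left_commute tsum_cmult)
  finally show ?case .
qed simp

lemma cnj_act: "cnj (act N g f w) = act N (\<lambda>x y. cnj (g x y)) (\<lambda>w. cnj (f w)) w"
  by (induction w arbitrary: f) auto

definition herm :: "nat \<Rightarrow> nat \<Rightarrow> (nat list \<Rightarrow> complex) \<Rightarrow> (nat list \<Rightarrow> complex) \<Rightarrow> complex" where
  "herm N n f h = tsum {..<N} n (\<lambda>w. f w * cnj (h w))"

text \<open>The adjoint of a matrix is again the action of a matrix. All later orthogonality
  arguments use this: the complement of a subspace stable under conjugate transposes is
  stable.\<close>

lemma herm_adj: "herm N n (act N g f) h = herm N n f (act N (madj g) h)"
  unfolding herm_def madj_def by (simp add: act_transpose cnj_act)

text \<open>Being zero off the words of length \<open>n\<close> makes the function unique for its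
  tensor, so that vanishing and equality of tensors are those of functions.\<close>

definition tens :: "nat \<Rightarrow> nat \<Rightarrow> (nat list \<Rightarrow> complex) set" where
  "tens N n = {f. \<forall>w. f w \<noteq> 0 \<longrightarrow> w \<in> words {..<N} n}"

definition mat :: "nat \<Rightarrow> (nat \<Rightarrow> nat \<Rightarrow> complex) set" where
  "mat N = {g. \<forall>x y. g x y \<noteq> 0 \<longrightarrow> x < N \<and> y < N}"

definition mone :: "nat \<Rightarrow> nat \<Rightarrow> nat \<Rightarrow> complex" where
  "mone N = (\<lambda>x y. if x = y \<and> x < N then 1 else 0)"

lemma act_mone: "set w \<subseteq> {..<N} \<Longrightarrow> act N (mone N) f w = f w"
proof (induction w arbitrary: f)
  case (Cons x w)
  have "act N (mone N) f (x # w) = (\<Sum>y<N. (if y = x then f (x # w) else 0))"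
    unfolding act.simps by (rule sum.cong) (use Cons in \<open>auto simp: mone_def\<close>)
  then show ?case using Cons.prems by simp
qed simp

lemma act_nonzero:
  assumes "g \<in> mat N" "act N g f w \<noteq> 0"
  shows "set w \<subseteq> {..<N} \<and> (\<exists>u\<in>words {..<N} (length w). f u \<noteq> 0)"
  using assms(2)
proof (induction w arbitrary: f)
  case (Cons x w)
  then obtain y where y: "y < N" "g x y * act N g (\<lambda>w. f (y # w)) w \<noteq> 0"
    by (auto elim: sum.not_neutral_contains_not_neutral)
  then show ?case using Cons.IH[of "\<lambda>w. f (y # w)"] assms(1)
    by (force simp: mat_def)
qed simp

lemma act_tens: "g \<in> mat N \<Longrightarrow> f \<in> tens N n \<Longrightarrow> act N g f \<in> tens N n"
  using act_nonzero[of g N f] unfolding tens_def words_def by fastforce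

lemma act_mone_tens:
  assumes "f \<in> tens N n" shows "act N (mone N) f = f"
proof
  fix w
  have "mone N \<in> mat N" by (auto simp: mone_def mat_def split: if_splits)
  then have *: "act N (mone N) f \<in> tens N n" using assms by (rule act_tens)
  show "act N (mone N) f w = f w"
  proof (cases "w \<in> words {..<N} n")
    case True
    then show ?thesis by (simp add: act_mone words_def)
  next
    case False
    then have "f w = 0" "act N (mone N) f w = 0"
      using assms * unfolding tens_def by blast+
    then show ?thesis by simp
  qed
qed

lemma mat_mmul: "g \<in> mat N \<Longrightarrow> h \<in> mat N \<Longrightarrow> mmul N g h \<in> mat N"
  unfolding mat_def mmul_def
  by (auto elim!: sum.not_neutral_contains_not_neutral)

lemma herm_self_zero:
  assumes "f \<in> tens N n" "herm N n f f = 0"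
  shows "f = (\<lambda>w. 0)"
proof
  fix w
  have eq: "herm N n f f = of_real (\<Sum>w\<in>words {..<N} n. (cmod (f w))\<^sup>2)"
    unfolding herm_def of_real_sum complex_norm_square by (simp add: tsum_eq_sum)
  have "(\<Sum>w\<in>words {..<N} n. (cmod (f w))\<^sup>2) = 0"
    using assms(2) unfolding eq by (simp only: of_real_eq_0_iff)
  then have "\<forall>w\<in>words {..<N} n. (cmod (f w))\<^sup>2 = 0"
    by (subst (asm) sum_nonneg_eq_0_iff) (auto simp: finite_words)
  then show "f w = 0"
    using assms(1) by (auto simp: tens_def)
qed

lemma herm_cnj: "herm N n f h = cnj (herm N n h f)"
  by (simp add: herm_def tsum_eq_sum mult.commute)

lemma herm_add_left: "herm N n (\<lambda>w. f w + f' w) h = herm N n f h + herm N n f' h"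
  by (simp add: herm_def tsum_add distrib_right)

lemma herm_cmult_left: "herm N n (\<lambda>w. c * f w) h = c * herm N n f h"
  by (simp add: herm_def tsum_cmult mult.assoc)

lemma herm_diff_left: "herm N n (\<lambda>w. f w - f' w) h = herm N n f h - herm N n f' h"
  by (simp add: herm_def tsum_diff left_diff_distrib)

lemma herm_diff_right: "herm N n h (\<lambda>w. f w - f' w) = herm N n h f - herm N n h f'"
  by (simp add: herm_def tsum_diff right_diff_distrib)

lemma herm_cmult_right: "herm N n h (\<lambda>w. c * f w) = cnj c * herm N n h f"
  by (simp add: herm_def tsum_cmult[symmetric] mult_ac)

subsection \<open>The action of the general linear Lie superalgebra\<close>

text \<open>
  Letters below \<open>N\<close> stand for the basis of \<open>V\<close>, a letter \<open>N + c\<close> for an odd vector \<open>f\<^sub>c\<close>. The matrix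
  unit \<open>sop N \<alpha> \<beta>\<close> maps the tensor \<open>\<beta>\<close> to \<open>\<alpha>\<close>; on coefficient functions it therefore reads \<open>\<beta>\<close> where
  the word has \<open>\<alpha>\<close>, with the Koszul sign of the odd letters to the left.
\<close>

abbreviation opar :: "nat \<Rightarrow> nat \<Rightarrow> nat \<Rightarrow> bool" where
  "opar N \<alpha> \<beta> \<equiv> (N \<le> \<alpha>) \<noteq> (N \<le> \<beta>)"

fun sop :: "nat \<Rightarrow> nat \<Rightarrow> nat \<Rightarrow> (nat list \<Rightarrow> complex) \<Rightarrow> nat list \<Rightarrow> complex" where
  "sop N \<alpha> \<beta> f [] = 0"
| "sop N \<alpha> \<beta> f (x # w) = (if x = \<alpha> then f (\<beta> # w) else 0)
     + (if N \<le> x \<and> opar N \<alpha> \<beta> then - 1 else 1) * sop N \<alpha> \<beta> (\<lambda>w. f (x # w)) w"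

definition nodd :: "nat \<Rightarrow> nat list \<Rightarrow> nat" where
  "nodd N w = length (filter (\<lambda>x. N \<le> x) w)"

lemma nodd_simps [simp]: "nodd N [] = 0" "nodd N (x # w) = (if N \<le> x then Suc (nodd N w) else nodd N w)"
  "nodd N (u @ v) = nodd N u + nodd N v"
  by (auto simp: nodd_def)

lemma sop_add: "sop N \<alpha> \<beta> (\<lambda>w. f w + g w) w = sop N \<alpha> \<beta> f w + sop N \<alpha> \<beta> g w"
  by (induction w arbitrary: f g) (auto simp: algebra_simps)

lemma sop_cmult: "sop N \<alpha> \<beta> (\<lambda>w. c * f w) w = c * sop N \<alpha> \<beta> f w"
  by (induction w arbitrary: f) (auto simp: algebra_simps)

lemma sop_zero [simp]: "sop N \<alpha> \<beta> (\<lambda>w. 0) w = 0"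
  using sop_cmult[of N \<alpha> \<beta> 0 "\<lambda>w. 0" w] by simp

lemma sop_cong:
  "(\<And>u. length u = length w \<Longrightarrow> f u = g u) \<Longrightarrow> sop N \<alpha> \<beta> f w = sop N \<alpha> \<beta> g w"
proof (induction w arbitrary: f g)
  case (Cons x w)
  have "sop N \<alpha> \<beta> (\<lambda>w. f (x # w)) w = sop N \<alpha> \<beta> (\<lambda>w. g (x # w)) w"
    using Cons.prems by (intro Cons.IH) simp
  then show ?case using Cons.prems[of "\<beta> # w"] by simp
qed simp

text \<open>The supercommutator of two matrix units; \<open>\<sigma>\<close> is -1 exactly if both
  are odd.\<close>

lemma sop_commute:
  fixes N \<alpha> \<beta> \<gamma> \<delta> :: nat
  defines "\<sigma> \<equiv> (if opar N \<alpha> \<beta> \<and> opar N \<gamma> \<delta> then - 1 else 1 :: complex)"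
  shows "sop N \<alpha> \<beta> (sop N \<gamma> \<delta> f) w = \<sigma> * sop N \<gamma> \<delta> (sop N \<alpha> \<beta> f) w
    + (if \<beta> = \<gamma> then sop N \<alpha> \<delta> f w else 0) - \<sigma> * (if \<alpha> = \<delta> then sop N \<gamma> \<beta> f w else 0)"
proof (induction w arbitrary: f)
  case (Cons x w)
  define sg :: "nat \<Rightarrow> nat \<Rightarrow> nat \<Rightarrow> complex"
    where "sg a b y = (if N \<le> y \<and> opar N a b then - 1 else 1)" for a b y
  have step: "sop N a b g (y # w) = of_bool (y = a) * g (b # w) + sg a b y * sop N a b (\<lambda>w. g (y # w)) w"
    for a b g y w
    by (simp add: sg_def)
  define p q r t :: complex where "p = of_bool (x = \<alpha>)" and "q = of_bool (x = \<gamma>)"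
    and "r = of_bool (\<beta> = \<gamma>)" and "t = of_bool (\<alpha> = \<delta>)"
  \<comment> \<open>Once the first letter is peeled off, each indicator fixes the letter at which a
    sign is read. These identities are all that \<open>algebra\<close> has to know about Koszul
    signs.\<close>
  have h: "p * sg \<gamma> \<delta> \<beta> = \<sigma> * sg \<gamma> \<delta> x * p" "q * sg \<alpha> \<beta> x = \<sigma> * q * sg \<alpha> \<beta> \<delta>"
    "r * sg \<alpha> \<delta> x = r * sg \<alpha> \<beta> x * sg \<gamma> \<delta> x" "t * sg \<gamma> \<beta> x = t * sg \<alpha> \<beta> x * sg \<gamma> \<delta> x"
    by (auto simp: sg_def \<sigma>_def p_def q_def r_def t_def)
  have t: "of_bool (\<delta> = \<alpha>) = t" by (auto simp: t_def)
  have IH: "sop N \<alpha> \<beta> (\<lambda>w. sop N \<gamma> \<delta> (\<lambda>w. f (x # w)) w) w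
    = \<sigma> * sop N \<gamma> \<delta> (\<lambda>w. sop N \<alpha> \<beta> (\<lambda>w. f (x # w)) w) w
    + of_bool (\<beta> = \<gamma>) * sop N \<alpha> \<delta> (\<lambda>w. f (x # w)) w
    - \<sigma> * of_bool (\<alpha> = \<delta>) * sop N \<gamma> \<beta> (\<lambda>w. f (x # w)) w"
    using Cons.IH[of "\<lambda>w. f (x # w)"] by simp
  have "sop N \<alpha> \<beta> (sop N \<gamma> \<delta> f) (x # w) = \<sigma> * sop N \<gamma> \<delta> (sop N \<alpha> \<beta> f) (x # w)
    + of_bool (\<beta> = \<gamma>) * sop N \<alpha> \<delta> f (x # w) - \<sigma> * of_bool (\<alpha> = \<delta>) * sop N \<gamma> \<beta> f (x # w)"
    unfolding step sop_add sop_cmult IH p_def[symmetric] q_def[symmetric] r_def[symmetric]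
      t_def[symmetric] t using h by algebra
  then show ?case by simp
qed simp

text \<open>There is no extra sign: the Koszul sign depends only on the letters to the left of the
  changed one, and these agree in both words. The bounds keep both exchanged letters in the range of
  summation.\<close>

lemma sop_transpose:
  assumes "\<alpha> < L" "\<beta> < L"
  shows "tsum {..<L} n (\<lambda>w. sop N \<alpha> \<beta> f w * h w) = tsum {..<L} n (\<lambda>w. f w * sop N \<beta> \<alpha> h w)"
proof (induction n arbitrary: f h)
  case (Suc n)
  define s :: "nat \<Rightarrow> complex" where "s x = (if N \<le> x \<and> opar N \<alpha> \<beta> then - 1 else 1)" for x
  have s': "(if N \<le> x \<and> opar N \<beta> \<alpha> then - 1 else 1) = s x" for x
    by (auto simp: s_def)
  have 1: "(\<Sum>x<L. if x = a then c else 0) = c" if "a < L" for a and c :: complex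
    using that by simp
  have "tsum {..<L} (Suc n) (\<lambda>w. sop N \<alpha> \<beta> f w * h w)
      = (\<Sum>x<L. (if x = \<alpha> then tsum {..<L} n (\<lambda>w. f (\<beta> # w) * h (\<alpha> # w)) else 0)
         + s x * tsum {..<L} n (\<lambda>w. sop N \<alpha> \<beta> (\<lambda>w. f (x # w)) w * h (x # w)))"
    by (auto simp: s_def tsum_add distrib_right tsum_cmult mult.assoc tsum_uminus intro!: sum.cong)
  also have "\<dots> = (\<Sum>x<L. (if x = \<beta> then tsum {..<L} n (\<lambda>w. f (\<beta> # w) * h (\<alpha> # w)) else 0)
         + s x * tsum {..<L} n (\<lambda>w. f (x # w) * sop N \<beta> \<alpha> (\<lambda>w. h (x # w)) w))"
    unfolding sum.distrib 1[OF assms(1)] 1[OF assms(2)] Suc ..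
  also have "\<dots> = tsum {..<L} (Suc n) (\<lambda>w. f w * sop N \<beta> \<alpha> h w)"
    by (auto simp: s_def tsum_add distrib_left tsum_cmult mult.assoc tsum_uminus intro!: sum.cong)
  finally show ?case .
qed simp

lemma sop_append:
  "sop N \<alpha> \<beta> f (u @ v) = sop N \<alpha> \<beta> (\<lambda>u. f (u @ v)) u
     + (if opar N \<alpha> \<beta> then (- 1) ^ nodd N u else 1) * sop N \<alpha> \<beta> (\<lambda>v. f (u @ v)) v"
proof (induction u arbitrary: f)
  case (Cons x u)
  show ?case using Cons[of "\<lambda>w. f (x # w)"] by (auto simp: algebra_simps)
qed simp

lemma sop_support:
  "sop N \<alpha> \<beta> f w \<noteq> 0 \<Longrightarrow> \<exists>u. f u \<noteq> 0 \<and> add_mset \<beta> (mset w) = add_mset \<alpha> (mset u)"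
proof (induction w arbitrary: f)
  case (Cons x w)
  show ?case
  proof (cases "x = \<alpha> \<and> f (\<beta> # w) \<noteq> 0")
    case True
    then show ?thesis by (intro exI[of _ "\<beta> # w"]) auto
  next
    case False
    then have "sop N \<alpha> \<beta> (\<lambda>w. f (x # w)) w \<noteq> 0"
      using Cons.prems by (auto split: if_splits)
    then obtain u where "f (x # u) \<noteq> 0" "add_mset \<beta> (mset w) = add_mset \<alpha> (mset u)"
      using Cons.IH by blast
    then show ?thesis by (intro exI[of _ "x # u"]) (auto simp: add_mset_commute)
  qed
qed simp

lemma sop_diag: "sop N \<alpha> \<alpha> f w = of_nat (count (mset w) \<alpha>) * f w"
  by (induction w arbitrary: f) (auto simp: algebra_simps)

text \<open>An odd operator changes the number of odd letters by one. With a power of -1 for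
  \<open>s\<close> this is the cost of carrying it past that many odd letters.\<close>

lemma sop_sign:
  assumes "s * s = (1 :: complex)"
  shows "sop N \<alpha> \<beta> (\<lambda>w. s ^ nodd N w * f w) w
    = (if opar N \<alpha> \<beta> then s else 1) * s ^ nodd N w * sop N \<alpha> \<beta> f w"
proof (induction w arbitrary: f)
  case (Cons x w)
  have s2: "s * (s * z) = z" for z
    using assms by (simp flip: mult.assoc)
  have "sop N \<alpha> \<beta> (\<lambda>w. s ^ nodd N (x # w) * f (x # w)) w
      = (if N \<le> x then s else 1) * ((if opar N \<alpha> \<beta> then s else 1) * s ^ nodd N w * sop N \<alpha> \<beta> (\<lambda>w. f (x # w)) w)"
    by (simp add: sop_cmult mult.assoc Cons.IH[unfolded mult.assoc])
  then show ?case
    by (auto simp: algebra_simps s2)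
qed simp

definition sswap :: "nat \<Rightarrow> nat \<Rightarrow> nat \<Rightarrow> (nat list \<Rightarrow> complex) \<Rightarrow> bool" where
  "sswap N m p f \<longleftrightarrow> (\<forall>u b c v. length u = m \<longrightarrow> length b = p \<longrightarrow> length c = p \<longrightarrow>
     f (u @ b @ c @ v) = (- 1) ^ (nodd N b * nodd N c) * f (u @ c @ b @ v))"

text \<open>The operators commute with signed place permutations, as in super Schur-Weyl duality.
  The operator is split over \<open>u\<close>, \<open>b\<close>, \<open>c\<close>, \<open>v\<close>;
  the Koszul sign for passing one of the blocks is matched, in the exchanged word, by the sign from
  \<open>sop_sign\<close>.\<close>

lemma sswap_sop:
  assumes "sswap N m p f"
  shows "sswap N m p (sop N \<alpha> \<beta> f)"
  unfolding sswap_def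
proof (intro allI impI)
  fix u b c v :: "nat list"
  assume len: "length u = m" "length b = p" "length c = p"
  define B C where "B = nodd N b" and "C = nodd N c"
  define o1 :: "nat \<Rightarrow> complex" where "o1 k = (if opar N \<alpha> \<beta> then (- 1) ^ k else 1)" for k
  have sw: "f (u @ b @ c @ v) = (- 1) ^ (nodd N b * nodd N c) * f (u @ c @ b @ v)"
    if "length u = m" "length b = p" "length c = p" for u b c v
    using assms that unfolding sswap_def by blast
  have sq: "(-1) ^ k * (-1) ^ k = (1::complex)" for k :: nat
    by (simp flip: power_mult_distrib)
  have 1: "sop N \<alpha> \<beta> (\<lambda>u. f (u @ b @ c @ v)) u = (- 1) ^ (B * C) * sop N \<alpha> \<beta> (\<lambda>u. f (u @ c @ b @ v)) u"
    unfolding sop_cmult[symmetric] by (rule sop_cong, subst sw) (simp_all add: len B_def C_def)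
  have 4: "sop N \<alpha> \<beta> (\<lambda>v. f (u @ b @ c @ v)) v = (- 1) ^ (B * C) * sop N \<alpha> \<beta> (\<lambda>v. f (u @ c @ b @ v)) v"
    unfolding sop_cmult[symmetric] by (rule sop_cong, subst sw) (simp_all add: len B_def C_def)
  have "sop N \<alpha> \<beta> (\<lambda>b. f (u @ b @ c @ v)) b
      = sop N \<alpha> \<beta> (\<lambda>b. ((- 1) ^ C) ^ nodd N b * f (u @ c @ b @ v)) b"
    by (rule sop_cong, subst sw) (simp_all add: len C_def mult.commute flip: power_mult)
  also have "\<dots> = o1 C * (- 1) ^ (B * C) * sop N \<alpha> \<beta> (\<lambda>b. f (u @ c @ b @ v)) b"
    by (subst sop_sign[OF sq]) (simp add: o1_def B_def mult.commute flip: power_mult)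
  finally have 2: "sop N \<alpha> \<beta> (\<lambda>b. f (u @ b @ c @ v)) b
      = o1 C * (- 1) ^ (B * C) * sop N \<alpha> \<beta> (\<lambda>b. f (u @ c @ b @ v)) b" .
  have "sop N \<alpha> \<beta> (\<lambda>c. f (u @ b @ c @ v)) c
      = sop N \<alpha> \<beta> (\<lambda>c. ((- 1) ^ B) ^ nodd N c * f (u @ c @ b @ v)) c"
    by (rule sop_cong, subst sw) (simp_all add: len B_def flip: power_mult)
  also have "\<dots> = o1 B * (- 1) ^ (B * C) * sop N \<alpha> \<beta> (\<lambda>c. f (u @ c @ b @ v)) c"
    by (subst sop_sign[OF sq]) (simp add: o1_def C_def flip: power_mult)
  finally have 3: "sop N \<alpha> \<beta> (\<lambda>c. f (u @ b @ c @ v)) c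
      = o1 B * (- 1) ^ (B * C) * sop N \<alpha> \<beta> (\<lambda>c. f (u @ c @ b @ v)) c" .
  have o1: "o1 (a + b) = o1 a * o1 b" "o1 a * o1 a = 1" "o1 a * (o1 a * z) = z" for a b z
    by (auto simp: o1_def power_add sq simp flip: mult.assoc)
  have L: "sop N \<alpha> \<beta> f (u @ b @ c @ v) = sop N \<alpha> \<beta> (\<lambda>u. f (u @ b @ c @ v)) u
     + o1 (nodd N u) * (sop N \<alpha> \<beta> (\<lambda>b. f (u @ b @ c @ v)) b
     + o1 B * (sop N \<alpha> \<beta> (\<lambda>c. f (u @ b @ c @ v)) c + o1 C * sop N \<alpha> \<beta> (\<lambda>v. f (u @ b @ c @ v)) v))"
    by (simp only: sop_append o1_def B_def C_def)
  have R: "sop N \<alpha> \<beta> f (u @ c @ b @ v) = sop N \<alpha> \<beta> (\<lambda>u. f (u @ c @ b @ v)) u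
     + o1 (nodd N u) * (sop N \<alpha> \<beta> (\<lambda>c. f (u @ c @ b @ v)) c
     + o1 C * (sop N \<alpha> \<beta> (\<lambda>b. f (u @ c @ b @ v)) b + o1 B * sop N \<alpha> \<beta> (\<lambda>v. f (u @ c @ b @ v)) v))"
    by (simp only: sop_append o1_def B_def C_def)
  define K :: complex where "K = (- 1) ^ (B * C)"
  show "sop N \<alpha> \<beta> f (u @ b @ c @ v) = (- 1) ^ (nodd N b * nodd N c) * sop N \<alpha> \<beta> f (u @ c @ b @ v)"
    unfolding L R 1 2 3 4 B_def[symmetric] C_def[symmetric] K_def[symmetric] using o1(2)[of B] o1(2)[of C] by algebra
qed

section \<open>Compositions of matrix units\<close>

primrec sops :: "nat \<Rightarrow> (nat \<times> nat) list \<Rightarrow> (nat list \<Rightarrow> complex) \<Rightarrow> nat list \<Rightarrow> complex" where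
  "sops N [] f = f"
| "sops N (p # ps) f = sop N (fst p) (snd p) (sops N ps f)"

lemma sops_append: "sops N (ps @ qs) f = sops N ps (sops N qs f)"
  by (induction ps) auto

lemma sops_zero [simp]: "sops N ps (\<lambda>w. 0) = (\<lambda>w. 0)"
  by (induction ps) auto

lemma sops_add: "sops N ps (\<lambda>w. f w + g w) = (\<lambda>w. sops N ps f w + sops N ps g w)"
  by (induction ps) (auto simp: sop_add)

lemma sops_cmult: "sops N ps (\<lambda>w. c * f w) = (\<lambda>w. c * sops N ps f w)"
  by (induction ps) (auto simp: sop_cmult)

lemma sswap_sops: "sswap N m p f \<Longrightarrow> sswap N m p (sops N ps f)"
  by (induction ps) (auto intro: sswap_sop)

text \<open>Letters consumed and letters produced stand on opposite sides, which avoids subtraction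
  of multisets.\<close>

lemma sops_support:
  "sops N ps f w \<noteq> 0 \<Longrightarrow>
     \<exists>u. f u \<noteq> 0 \<and> mset w + mset (map snd ps) = mset u + mset (map fst ps)"
proof (induction ps arbitrary: w)
  case (Cons p ps)
  then obtain u where u: "sops N ps f u \<noteq> 0" "add_mset (snd p) (mset w) = add_mset (fst p) (mset u)"
    using sop_support by fastforce
  then obtain u' where u': "f u' \<noteq> 0" "mset u + mset (map snd ps) = mset u' + mset (map fst ps)"
    using Cons.IH by blast
  have "mset w + mset (map snd (p # ps)) = add_mset (snd p) (mset w) + mset (map snd ps)"
    by simp
  also have "\<dots> = mset u' + mset (map fst (p # ps))"
    unfolding u(2) using u'(2) by simp
  finally show ?case using u'(1) by blast
qed auto

lemma sops_transpose:
  assumes "\<And>p. p \<in> set ps \<Longrightarrow> fst p < L \<and> snd p < L"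
  shows "tsum {..<L} n (\<lambda>w. sops N ps f w * h w)
    = tsum {..<L} n (\<lambda>w. f w * sops N (rev (map prod.swap ps)) h w)"
  using assms
proof (induction ps arbitrary: h)
  case (Cons p ps)
  have "tsum {..<L} n (\<lambda>w. sops N (p # ps) f w * h w)
      = tsum {..<L} n (\<lambda>w. sops N ps f w * sop N (snd p) (fst p) h w)"
    using Cons.prems[of p] by (simp add: sop_transpose)
  also have "\<dots> = tsum {..<L} n (\<lambda>w. f w * sops N (rev (map prod.swap ps)) (sop N (snd p) (fst p) h) w)"
    using Cons by simp
  finally show ?case by (simp add: sops_append)
qed simp

text \<open>Under these conditions all supercommutators inside \<open>P\<close> vanish: the
  operators anticommute and have square zero.\<close>

definition anti :: "nat \<Rightarrow> (nat \<times> nat) set \<Rightarrow> bool" where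
  "anti N P \<longleftrightarrow> (\<forall>p\<in>P. opar N (fst p) (snd p) \<and> (\<forall>q\<in>P. snd p \<noteq> fst q))"

lemma sops_mem:
  assumes "anti N P" "set ps \<subseteq> P" "p \<in> P" "p \<in> set ps"
  shows "sop N (fst p) (snd p) (sops N ps f) = (\<lambda>w. 0)"
  using assms(2,4)
proof (induction ps)
  case (Cons q ps)
  have *: "sop N (fst p) (snd p) (sop N (fst q) (snd q) g) w
     = - sop N (fst q) (snd q) (sop N (fst p) (snd p) g) w" for g w
  proof -
    have "opar N (fst p) (snd p)" "opar N (fst q) (snd q)" "snd p \<noteq> fst q" "fst p \<noteq> snd q"
      using assms(1,3) Cons.prems(1) unfolding anti_def by (auto, metis)
    then show ?thesis by (subst sop_commute) auto
  qed
  show ?case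
  proof (cases "p = q")
    case True
    \<comment> \<open>For \<open>p = q\<close> the anticommutation rule says that the square is its
      own negative.\<close>
    have "a = - a \<Longrightarrow> a = 0" for a :: complex by simp
    with * True show ?thesis by (auto simp: fun_eq_iff)
  next
    case False
    then have "sop N (fst p) (snd p) (sops N ps f) = (\<lambda>w. 0)" using Cons by simp
    then show ?thesis using *[of "sops N ps f"] by simp
  qed
qed simp

lemma sops_not_distinct:
  assumes "anti N (set ps)" "\<not> distinct ps"
  shows "sops N ps f = (\<lambda>w. 0)"
  using assms
proof (induction ps)
  case (Cons p ps)
  show ?case
  proof (cases "p \<in> set ps")
    case True
    then have "sop N (fst p) (snd p) (sops N ps f) = (\<lambda>w. 0)"
      by (intro sops_mem[OF Cons.prems(1)]) auto
    then show ?thesis by simp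
  next
    case False
    then have "sops N ps f = (\<lambda>w. 0)" using Cons by (auto simp: anti_def)
    then show ?thesis by simp
  qed
qed simp

text \<open>When the even operator moves inwards, each factor \<open>b\<close> contributes at most
  two supercommutator terms, in which one entry of \<open>b\<close> is replaced. The last two
  premises kill exactly these.\<close>

lemma sops_commute:
  assumes "\<not> opar N \<alpha> \<beta>"
    and "\<And>xs b ys. ps = xs @ b # ys \<Longrightarrow> fst b = \<beta> \<Longrightarrow> sops N (xs @ (\<alpha>, snd b) # ys) f = (\<lambda>w. 0)"
    and "\<And>xs b ys. ps = xs @ b # ys \<Longrightarrow> snd b = \<alpha> \<Longrightarrow> sops N (xs @ (fst b, \<beta>) # ys) f = (\<lambda>w. 0)"
  shows "sop N \<alpha> \<beta> (sops N ps f) = sops N ps (sop N \<alpha> \<beta> f)"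
proof -
  have "sops N xs (sop N \<alpha> \<beta> (sops N ys f)) = sops N (xs @ ys) (sop N \<alpha> \<beta> f)"
    if "ps = xs @ ys" for xs ys
    using that
  proof (induction ys arbitrary: xs)
    case (Cons b ys)
    define g where "g = sops N ys f"
    have "sop N \<alpha> \<beta> (sop N (fst b) (snd b) g) = (\<lambda>w. sop N (fst b) (snd b) (sop N \<alpha> \<beta> g) w
       + ((if \<beta> = fst b then 1 else 0) * sop N \<alpha> (snd b) g w
       + (if \<alpha> = snd b then - 1 else 0) * sop N (fst b) \<beta> g w))"
      using assms(1) by (intro ext, subst sop_commute) auto
    then have "sops N xs (sop N \<alpha> \<beta> (sops N (b # ys) f)) = (\<lambda>w. sops N (xs @ [b]) (sop N \<alpha> \<beta> g) w
       + ((if \<beta> = fst b then 1 else 0) * sops N (xs @ (\<alpha>, snd b) # ys) f w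
       + (if \<alpha> = snd b then - 1 else 0) * sops N (xs @ (fst b, \<beta>) # ys) f w))"
      by (simp add: g_def sops_add sops_cmult sops_append)
    also have "\<dots> = sops N (xs @ [b]) (sop N \<alpha> \<beta> g)"
      using assms(2)[of xs b ys] assms(3)[of xs b ys] Cons.prems by (auto simp: fun_eq_iff)
    also have "\<dots> = sops N (xs @ b # ys) (sop N \<alpha> \<beta> f)"
      using Cons.IH[of "xs @ [b]"] Cons.prems by (simp add: g_def)
    finally show ?case .
  qed (simp add: sops_append)
  from this[of "[]" ps] show ?thesis by simp
qed

subsection \<open>From rows to columns\<close>

text \<open>
  The operators \<open>x\<^sub>i \<mapsto> f\<^sub>c\<close> of the boxes, in the order of the composition: the bottom row acts first,
  and in each row the first column acts first. The non-vanishing below depends on this order.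
\<close>

primrec boxes :: "nat \<Rightarrow> nat \<Rightarrow> nat list \<Rightarrow> (nat \<times> nat) list" where
  "boxes N r [] = []"
| "boxes N r (l # ls) = map (\<lambda>c. (N + c, r)) (rev [0..<l]) @ boxes N (Suc r) ls"

lemma boxes_append: "boxes N r (a @ b) = boxes N r a @ boxes N (r + length a) b"
  by (induction a arbitrary: r) auto

lemma set_boxes: "set (boxes N r a) = {(N + c, r + i) | c i. i < length a \<and> c < a ! i}"
proof (induction a arbitrary: r)
  case (Cons l ls)
  have "{(N + c, r + i) | c i. i < length (l # ls) \<and> c < (l # ls) ! i}
    = {(N + c, r) | c. c < l} \<union> {(N + c, Suc r + i) | c i. i < length ls \<and> c < ls ! i}"
    (is "?A = ?B \<union> ?C")
  proof (intro set_eqI iffI)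
    fix p assume "p \<in> ?A"
    then obtain c i where p: "p = (N + c, r + i)" "i < length (l # ls)" "c < (l # ls) ! i" by blast
    then show "p \<in> ?B \<union> ?C" by (cases i) auto
  next
    fix p assume "p \<in> ?B \<union> ?C"
    then consider c where "p = (N + c, r)" "c < l"
      | c i where "p = (N + c, Suc r + i)" "i < length ls" "c < ls ! i" by blast
    then show "p \<in> ?A"
    proof cases
      case 1
      then have "p = (N + c, r + 0) \<and> 0 < length (l # ls) \<and> c < (l # ls) ! 0" by simp
      then show ?thesis by blast
    next
      case 2
      then have "p = (N + c, r + Suc i) \<and> Suc i < length (l # ls) \<and> c < (l # ls) ! Suc i" by simp
      then show ?thesis by blast
    qed
  qed
  with Cons show ?case by auto
qed simp

lemma sorted_snd_boxes: "sorted (map snd (boxes N r a))"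
  by (induction a arbitrary: r) (auto simp: sorted_append set_boxes comp_def map_replicate_const)

lemma length_boxes [simp]: "length (boxes N r a) = sum_list a"
  by (induction a arbitrary: r) auto

lemma count_snd_boxes:
  "count (mset (map snd (boxes N r a))) x
    = (if r \<le> x \<and> x < r + length a then a ! (x - r) else 0)"
proof (induction a arbitrary: r)
  case (Cons l ls)
  have "mset (map snd (map (\<lambda>c. (N + c, r)) (rev [0..<l]))) = replicate_mset l r"
    by (simp add: comp_def map_replicate_const)
  then have "count (mset (map snd (boxes N r (l # ls)))) x
     = (if x = r then l else 0) + count (mset (map snd (boxes N (Suc r) ls))) x"
    by simp
  then show ?case
    unfolding Cons.IH by (auto simp: nth_Cons')
qed simp

definition odd_even :: "nat \<Rightarrow> (nat \<times> nat) set" where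
  "odd_even N = {(x, y). N \<le> x \<and> y < N}"

lemma boxes_odd_even: "r + length a \<le> N \<Longrightarrow> set (boxes N r a) \<subseteq> odd_even N"
  by (auto simp: set_boxes odd_even_def)

lemma anti_odd_even: "P \<subseteq> odd_even N \<Longrightarrow> anti N P"
proof -
  assume "P \<subseteq> odd_even N"
  then have "N \<le> fst p \<and> snd p < N" if "p \<in> P" for p
    using that by (auto simp: odd_even_def)
  then show ?thesis unfolding anti_def by (metis leD)
qed

lemma anti_swap_odd_even: "P \<subseteq> prod.swap ` odd_even N \<Longrightarrow> anti N P"
proof -
  assume "P \<subseteq> prod.swap ` odd_even N"
  then have "N \<le> snd p \<and> fst p < N" if "p \<in> P" for p
    using that by (auto simp: odd_even_def)
  then show ?thesis unfolding anti_def by (metis leD)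
qed

lemma sop_absent:
  assumes "\<And>w. f w \<noteq> 0 \<Longrightarrow> \<beta> \<notin> set w" "\<alpha> \<noteq> \<beta>"
  shows "sop N \<alpha> \<beta> f = (\<lambda>w. 0)"
proof (rule ext, rule ccontr)
  fix w assume "sop N \<alpha> \<beta> f w \<noteq> 0"
  then obtain u where u: "f u \<noteq> 0" "add_mset \<beta> (mset w) = add_mset \<alpha> (mset u)"
    using sop_support by blast
  have "\<beta> \<in># add_mset \<alpha> (mset u)" unfolding u(2)[symmetric] by simp
  then show False using assms(1)[OF u(1)] assms(2) by simp
qed

text \<open>Supercommuting with the operator of a box in row \<open>j > q\<close> leaves at most the
  raising operator from \<open>j\<close> to \<open>q\<close>. That one commutes with all other
  boxes, because none of them lies in row \<open>q\<close>, and it kills \<open>F\<close>.\<close>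

lemma sop_annihilate_lower_rows:
  assumes ys: "\<And>b. b \<in> set ys \<Longrightarrow> N \<le> fst b \<and> q < snd b \<and> snd b < m" and "m \<le> N" "N \<le> \<gamma>"
    and F: "\<And>w. F w \<noteq> 0 \<Longrightarrow> set w \<subseteq> {..<N}"
    and raise: "\<And>j. q < j \<Longrightarrow> j < m \<Longrightarrow> sop N q j F = (\<lambda>w. 0)" and "q < N"
  shows "sop N q \<gamma> (sops N ys F) = (\<lambda>w. 0)"
  using ys
proof (induction ys)
  case Nil
  have "\<gamma> \<notin> set w" if "F w \<noteq> 0" for w using F[OF that] \<open>N \<le> \<gamma>\<close> by auto
  then show ?case using \<open>q < N\<close> \<open>N \<le> \<gamma>\<close> by (auto intro!: sop_absent)
next
  case (Cons b ys)
  define g where "g = sops N ys F"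
  have b: "N \<le> fst b" "q < snd b" "snd b < m" using Cons.prems[of b] by auto
  have IH: "sop N q \<gamma> g = (\<lambda>w. 0)" using Cons unfolding g_def by simp
  have "sop N q (snd b) g = sops N ys (sop N q (snd b) F)"
    unfolding g_def
  proof (rule sops_commute)
    fix xs b' zs assume "ys = xs @ b' # zs"
    then have b': "b' \<in> set (b # ys)" by simp
    show "sops N (xs @ (q, snd b') # zs) F = (\<lambda>w. 0)" if "fst b' = snd b"
      using Cons.prems[OF b'] that b \<open>m \<le> N\<close> by linarith
    show "sops N (xs @ (fst b', snd b) # zs) F = (\<lambda>w. 0)" if "snd b' = q"
      using Cons.prems[OF b'] that by linarith
  qed (use b assms in auto)
  then have "sop N q (snd b) g = (\<lambda>w. 0)" using raise b by simp
  then show ?case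
    using IH b assms(2,3,6) by (intro ext) (auto simp: sop_commute g_def[symmetric])
qed

text \<open>
  Odd reflections: if \<open>v\<close> is killed by \<open>f\<^sub>c \<mapsto> x\<^sub>i\<close>, then following \<open>x\<^sub>i \<mapsto> f\<^sub>c\<close> by \<open>f\<^sub>c \<mapsto> x\<^sub>i\<close> multiplies \<open>v\<close>
  by the number of letters \<open>x\<^sub>i\<close> and \<open>f\<^sub>c\<close>, which is positive as long as row \<open>i\<close> is not exhausted.
\<close>

lemma hw_sops_boxes_nonzero:
  assumes N: "r + length a \<le> N"
    and cont: "\<And>w. F w \<noteq> 0 \<Longrightarrow> mset w = mset (map snd (boxes N r a))"
    and raise: "\<And>i j. r \<le> i \<Longrightarrow> i < j \<Longrightarrow> j < r + length a \<Longrightarrow> sop N i j F = (\<lambda>w. 0)"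
    and nz: "F \<noteq> (\<lambda>w. 0)"
  shows "sops N (boxes N r a) F \<noteq> (\<lambda>w. 0)"
proof -
  have Fset: "set w \<subseteq> {..<N}" if "F w \<noteq> 0" for w
    using arg_cong[OF cont[OF that], of set_mset] N by (auto simp: set_boxes)
  \<comment> \<open>The lower rows act first, so the induction runs over the tail \<open>ls\<close>,
    before any row of \<open>pre\<close> is applied.\<close>
  have main: "sops N (boxes N (r + length pre) ls) F \<noteq> (\<lambda>w. 0)" if "a = pre @ ls" for pre ls
    using that
  proof (induction ls arbitrary: pre)
    case (Cons l ls)
    define q where "q = r + length pre"
    define rest where "rest = boxes N (Suc q) ls"
    define row where "row c = map (\<lambda>c. (N + c, q)) (rev [0..<c])" for c
    have row_Suc: "row (Suc c) = (N + c, q) # row c" for c by (simp add: row_def)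
    have len: "r + length a = q + Suc (length ls)" using Cons.prems by (simp add: q_def)
    have qN: "q < N" using N len by simp
    have rest_b: "N \<le> fst b \<and> q < snd b \<and> snd b < r + length a" if "b \<in> set rest" for b
      using that len by (auto simp: rest_def set_boxes)
    have row_odd_even: "set (row c @ rest) \<subseteq> odd_even N" for c
      using qN rest_b N by (fastforce simp: row_def odd_even_def)
    have raise': "sop N q j F = (\<lambda>w. 0)" if "q < j" "j < r + length a" for j
      using raise[of q j] that by (simp add: q_def)
    have A1: "sop N q (N + c) (sops N rest F) = (\<lambda>w. 0)" for c
      by (rule sop_annihilate_lower_rows[where m = "r + length a"]) (use rest_b N Fset raise' qN in auto)
    \<comment> \<open>Here \<open>c'\<close> boxes of row \<open>q\<close> are filled.
      Supercommuting with the next one leaves the even operator from column \<open>c\<close> to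
      column \<open>c'\<close>, so that operator has to vanish on what is filled so far.\<close>
    have A2: "sop N q (N + c) (sops N (row c' @ rest) F) = (\<lambda>w. 0)" if "c' \<le> c" for c c'
      using that
    proof (induction c')
      case 0
      then show ?case using A1 by (simp add: row_def)
    next
      case (Suc c')
      define g where "g = sops N (row c' @ rest) F"
      have IH: "sop N q (N + c) g = (\<lambda>w. 0)" using Suc by (simp add: g_def)
      have "sop N (N + c') (N + c) g = sops N (row c' @ rest) (sop N (N + c') (N + c) F)"
        unfolding g_def
      proof (rule sops_commute)
        fix xs b ys assume split: "row c' @ rest = xs @ b # ys"
        \<comment> \<open>A factor of column \<open>c\<close> must come from a lower row. That row
          also has a box in column \<open>c'\<close>, which is further left, so the replacement
          repeats a factor.\<close>
        show "sops N (xs @ (N + c', snd b) # ys) F = (\<lambda>w. 0)" if fb: "fst b = N + c"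
        proof (rule sops_not_distinct)
          have b_in: "b \<in> set (row c' @ rest)" using split by simp
          have "b \<notin> set (row c')" using fb Suc.prems by (auto simp: row_def)
          with b_in have "b \<in> set rest" by simp
          then have "(N + c', snd b) \<in> set rest"
            using fb Suc.prems by (cases b rule: prod.exhaust) (auto simp: rest_def set_boxes)
          then have "(N + c', snd b) \<in> set (xs @ b # ys)"
            unfolding split[symmetric] set_append by (rule UnI2)
          then have "(N + c', snd b) \<in> set xs \<union> set ys" using fb Suc.prems by (cases b rule: prod.exhaust) auto
          then show "\<not> distinct (xs @ (N + c', snd b) # ys)" by auto
          have "b \<in> odd_even N" using b_in row_odd_even by blast
          moreover have "set xs \<union> set ys \<subseteq> odd_even N"
            using row_odd_even[of c'] unfolding split by auto
          ultimately show "anti N (set (xs @ (N + c', snd b) # ys))"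
            by (intro anti_odd_even) (auto simp: odd_even_def)
        qed
        have "b \<in> odd_even N" using split row_odd_even[of c'] by auto
        then show "sops N (xs @ (fst b, N + c) # ys) F = (\<lambda>w. 0)" if "snd b = N + c'"
          using that by (auto simp: odd_even_def)
      qed simp
      moreover have "sop N (N + c') (N + c) F = (\<lambda>w. 0)"
        using Suc.prems Fset by (intro sop_absent) fastforce+
      ultimately have "sop N (N + c') (N + c) g = (\<lambda>w. 0)" by simp
      moreover have "sop N q (N + c) (sop N (N + c') q g) w
          = - sop N (N + c') q (sop N q (N + c) g) w + sop N (N + c') (N + c) g w" for w
        using Suc.prems qN by (subst sop_commute) auto
      ultimately show ?case using IH by (auto simp: row_Suc g_def[symmetric])
    qed
    have "sops N (row c @ rest) F \<noteq> (\<lambda>w. 0)" if "c \<le> l" for c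
      using that
    proof (induction c)
      case 0
      show ?case using Cons.IH[of "pre @ [l]"] Cons.prems by (simp add: row_def rest_def q_def)
    next
      case (Suc c)
      define g where "g = sops N (row c @ rest) F"
      obtain w where w: "g w \<noteq> 0" using Suc by (auto simp: g_def fun_eq_iff)
      obtain u where u: "F u \<noteq> 0"
        "mset w + mset (map snd (row c @ rest)) = mset u + mset (map fst (row c @ rest))"
        using sops_support[of N "row c @ rest" F w] w unfolding g_def by blast
      have "map snd (row c) = replicate c q"
        by (simp add: row_def comp_def map_replicate_const)
      moreover have "q \<notin> snd ` set rest" using rest_b by fastforce
      then have "count (mset (map snd rest)) q = 0" by (simp add: count_eq_zero_iff)
      moreover have "q \<notin> fst ` set (row c @ rest)" using row_odd_even[of c] qN by (fastforce simp: odd_even_def)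
      then have "count (mset (map fst (row c @ rest))) q = 0"
        by (simp only: count_eq_zero_iff set_mset_mset set_map not_False_eq_True)
      \<comment> \<open>\<open>F\<close> has \<open>l\<close> letters \<open>q\<close>, and each of
        the \<open>c\<close> boxes filled so far uses up one of them; as \<open>c < l\<close>, at
        least one is left.\<close>
      moreover have "count (mset u) q = l"
        unfolding cont[OF u(1)] count_snd_boxes using Cons.prems len by (auto simp: q_def nth_append)
      ultimately have "count (mset w) q + c = l"
        using arg_cong[OF u(2), of "\<lambda>M. count M q"] by simp
      then have cnt: "count (mset w) q > 0" using Suc.prems by linarith
      have "sop N q (N + c) (sop N (N + c) q g) w
          = - sop N (N + c) q (sop N q (N + c) g) w + sop N q q g w + sop N (N + c) (N + c) g w"
        using qN by (subst sop_commute) auto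
      also have "\<dots> = of_nat (count (mset w) q + count (mset w) (N + c)) * g w"
        using A2[of c c] by (simp add: g_def[symmetric] sop_diag algebra_simps)
      also have "\<dots> \<noteq> 0" using w cnt by (simp del: of_nat_add)
      finally have "sop N (N + c) q g \<noteq> (\<lambda>w. 0)" by auto
      then show ?case by (simp add: row_Suc g_def)
    qed
    from this[of l] show ?case by (simp add: row_def rest_def q_def)
  qed (use nz in simp)
  from main[of "[]" a] show ?thesis by simp
qed

section \<open>Operators on products of tensors\<close>

definition ext_prod :: "nat \<Rightarrow> (nat list \<Rightarrow> complex) \<Rightarrow> (nat list \<Rightarrow> complex) \<Rightarrow> nat list \<Rightarrow> complex" where
  "ext_prod m F G = (\<lambda>w. F (take m w) * G (drop m w))"

lemma sop_ext_prod:
  assumes F: "\<And>u. F u \<noteq> 0 \<Longrightarrow> length u = m"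
  shows "sop N \<alpha> \<beta> (ext_prod m F H) w = sop N \<alpha> \<beta> F (take m w) * H (drop m w)
    + (if opar N \<alpha> \<beta> then (- 1) ^ nodd N (take m w) else 1) * F (take m w) * sop N \<alpha> \<beta> H (drop m w)"
proof -
  define u v where "u = take m w" and "v = drop m w"
  have w: "w = u @ v" by (simp add: u_def v_def)
  have uv: "length u < m \<Longrightarrow> v = []" "length u \<le> m" by (auto simp: u_def v_def)
  have 1: "sop N \<alpha> \<beta> (\<lambda>u. ext_prod m F H (u @ v)) u = H v * sop N \<alpha> \<beta> F u"
    unfolding sop_cmult[symmetric]
  proof (rule sop_cong)
    fix u' :: "nat list" assume "length u' = length u"
    then show "ext_prod m F H (u' @ v) = H v * F u'"
      using uv by (cases "length u = m") (auto simp: ext_prod_def)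
  qed
  have 2: "sop N \<alpha> \<beta> (\<lambda>v. ext_prod m F H (u @ v)) v = F u * sop N \<alpha> \<beta> H v"
    unfolding sop_cmult[symmetric]
  proof (rule sop_cong)
    fix v' :: "nat list" assume "length v' = length v"
    then show "ext_prod m F H (u @ v') = F u * H v'"
      using uv F[of u] by (cases "length u = m") (auto simp: ext_prod_def)
  qed
  have "sop N \<alpha> \<beta> (ext_prod m F H) (u @ v) = H v * sop N \<alpha> \<beta> F u
    + (if opar N \<alpha> \<beta> then (- 1) ^ nodd N u else 1) * (F u * sop N \<alpha> \<beta> H v)"
    unfolding sop_append 1 2 ..
  then show ?thesis unfolding w[symmetric] u_def[symmetric] v_def[symmetric] by (simp add: mult_ac)
qed

text \<open>The letters of \<open>F\<close> are even, so carrying odd operators past them costs no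
  sign.\<close>

lemma sops_ext_prod_right:
  assumes F: "\<And>u. F u \<noteq> 0 \<Longrightarrow> length u = m \<and> set u \<subseteq> {..<N}"
    and z: "\<And>p. p \<in> set ps \<Longrightarrow> sop N (fst p) (snd p) F = (\<lambda>w. 0)"
  shows "sops N ps (ext_prod m F H) = ext_prod m F (sops N ps H)"
  using z
proof (induction ps)
  case (Cons p ps)
  have "nodd N u = 0" if "F u \<noteq> 0" for u
    using F[OF that] by (auto simp: nodd_def filter_empty_conv)
  moreover have "sop N (fst p) (snd p) F = (\<lambda>w. 0)" using Cons.prems by simp
  ultimately have "sop N (fst p) (snd p) (ext_prod m F G) w = ext_prod m F (sop N (fst p) (snd p) G) w" for G w
    using F by (subst sop_ext_prod, blast, cases "F (take m w) = 0") (auto simp: ext_prod_def)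
  then show ?case using Cons.IH Cons.prems by auto
qed simp

lemma sops_ext_prod_left:
  assumes F: "\<And>u. F u \<noteq> 0 \<Longrightarrow> length u = m"
    and z: "\<And>p. p \<in> set ps \<Longrightarrow> sop N (fst p) (snd p) H = (\<lambda>w. 0)"
  shows "sops N ps (ext_prod m F H) = ext_prod m (sops N ps F) H"
  using z
proof (induction ps)
  case (Cons p ps)
  have "length u = m" if nz: "sops N ps F u \<noteq> 0" for u
  proof -
    obtain u' where u': "F u' \<noteq> 0" "mset u + mset (map snd ps) = mset u' + mset (map fst ps)"
      using sops_support[OF nz] by blast
    from arg_cong[OF u'(2), of size] F[OF u'(1)] show ?thesis by simp
  qed
  moreover have "sop N (fst p) (snd p) H = (\<lambda>w. 0)" using Cons.prems by simp
  ultimately have "sop N (fst p) (snd p) (ext_prod m (sops N ps F) H) w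
      = ext_prod m (sop N (fst p) (snd p) (sops N ps F)) H w" for w
    by (subst sop_ext_prod) (auto simp: ext_prod_def)
  then show ?case using Cons.IH Cons.prems by auto
qed simp

lemma sop_sum: "sop N \<alpha> \<beta> (\<lambda>w. \<Sum>i\<in>I. f i w) w = (\<Sum>i\<in>I. sop N \<alpha> \<beta> (f i) w)"
  by (induction I rule: infinite_finite_induct) (auto simp: sop_add)

lemma sop_cong_words:
  "set w \<subseteq> X \<Longrightarrow> \<beta> \<in> X \<Longrightarrow> (\<And>u. set u \<subseteq> X \<Longrightarrow> f u = g u) \<Longrightarrow> sop N \<alpha> \<beta> f w = sop N \<alpha> \<beta> g w"
proof (induction w arbitrary: f g)
  case (Cons x w)
  have "sop N \<alpha> \<beta> (\<lambda>w. f (x # w)) w = sop N \<alpha> \<beta> (\<lambda>w. g (x # w)) w"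
    using Cons.prems by (intro Cons.IH) simp_all
  then show ?case using Cons.prems by simp
qed simp

text \<open>For invertible \<open>g\<close>, conjugating a matrix unit brings in column
  \<open>\<alpha>\<close> of \<open>g\<close> and row \<open>\<beta>\<close> of its inverse. Row
  \<open>\<beta>\<close> of \<open>g\<close> is a unit row, hence so is that of the inverse, which
  therefore drops out. As \<open>g\<close> preserves parity, Koszul signs survive.\<close>

lemma act_sop:
  assumes "\<alpha> < L" "\<beta> < L" "set w \<subseteq> {..<L}"
    and row: "\<And>y. y < L \<Longrightarrow> g \<beta> y = (if y = \<beta> then 1 else 0)"
    and par: "\<And>x y. g x y \<noteq> 0 \<Longrightarrow> (N \<le> x) = (N \<le> y)"
  shows "act L g (sop N \<alpha> \<beta> f) w = (\<Sum>\<gamma><L. g \<gamma> \<alpha> * sop N \<gamma> \<beta> (act L g f) w)"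
  using assms(3)
proof (induction w arbitrary: f)
  case (Cons x w)
  define sg :: "nat \<Rightarrow> nat \<Rightarrow> complex"
    where "sg a y = (if N \<le> y \<and> opar N a \<beta> then - 1 else 1)" for a y
  have step: "sop N a \<beta> h (y # w) = of_bool (y = a) * h (\<beta> # w) + sg a y * sop N a \<beta> (\<lambda>w. h (y # w)) w"
    for a h y w
    by (simp add: sg_def)
  have delta: "(\<Sum>y<L. c y * of_bool (y = a)) = c a" if "a < L" for c :: "nat \<Rightarrow> complex" and a
    using that by (simp add: of_bool_def if_distrib cong: if_cong)
  define A where "A = act L g (\<lambda>w. f (\<beta> # w)) w"
  define B where "B \<gamma> y = sop N \<gamma> \<beta> (act L g (\<lambda>w. f (y # w))) w" for \<gamma> y
  have act_row: "act L g f (\<beta> # w) = A"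
  proof -
    have "act L g f (\<beta> # w) = (\<Sum>y<L. (if y = \<beta> then A else 0))"
      unfolding act.simps by (rule sum.cong) (auto simp: row A_def)
    then show ?thesis using assms(2) by simp
  qed
  have IH: "act L g (sop N \<alpha> \<beta> (\<lambda>w. f (y # w))) w = (\<Sum>\<gamma><L. g \<gamma> \<alpha> * B \<gamma> y)" for y
    using Cons by (simp add: B_def)
  have "act L g (sop N \<alpha> \<beta> f) (x # w)
      = (\<Sum>y<L. g x y * (of_bool (y = \<alpha>) * A + sg \<alpha> y * (\<Sum>\<gamma><L. g \<gamma> \<alpha> * B \<gamma> y)))"
    unfolding act.simps step act_add act_cmult IH A_def ..
  also have "\<dots> = (\<Sum>y<L. (g x y * A) * of_bool (y = \<alpha>)) + (\<Sum>y<L. \<Sum>\<gamma><L. g x y * sg \<alpha> y * g \<gamma> \<alpha> * B \<gamma> y)"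
    unfolding sum.distrib[symmetric]
    by (intro sum.cong refl) (simp only: distrib_left sum_distrib_left mult.assoc mult.commute[of A])
  also have "\<dots> = g x \<alpha> * A + (\<Sum>\<gamma><L. \<Sum>y<L. g x y * sg \<alpha> y * g \<gamma> \<alpha> * B \<gamma> y)"
    unfolding delta[OF assms(1)] by (subst sum.swap) (rule refl)
  also have "\<dots> = g x \<alpha> * A + (\<Sum>\<gamma><L. \<Sum>y<L. g \<gamma> \<alpha> * sg \<gamma> x * g x y * B \<gamma> y)"
  proof -
    \<comment> \<open>For nonzero entries, \<open>x\<close> and \<open>y\<close> have the same
      parity, and so have \<open>\<gamma>\<close> and \<open>\<alpha>\<close>; hence the two signs
      agree.\<close>
    have "g x y * sg \<alpha> y * g \<gamma> \<alpha> * B \<gamma> y = g \<gamma> \<alpha> * sg \<gamma> x * g x y * B \<gamma> y" for \<gamma> y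
      using par[of x y] par[of \<gamma> \<alpha>] by (cases "g x y = 0 \<or> g \<gamma> \<alpha> = 0") (auto simp: sg_def)
    then show ?thesis by presburger
  qed
  also have "\<dots> = (\<Sum>\<gamma><L. g \<gamma> \<alpha> * A * of_bool (\<gamma> = x)) + (\<Sum>\<gamma><L. g \<gamma> \<alpha> * sg \<gamma> x * (\<Sum>y<L. g x y * B \<gamma> y))"
    using Cons.prems delta[of x "\<lambda>\<gamma>. g \<gamma> \<alpha> * A"] by (simp only: sum_distrib_left mult.assoc) simp
  also have "\<dots> = (\<Sum>\<gamma><L. g \<gamma> \<alpha> * sop N \<gamma> \<beta> (act L g f) (x # w))"
    unfolding step act_row B_def
    by (simp only: act.simps sop_sum sop_cmult sum.distrib[symmetric] distrib_left mult.assoc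
        mult.commute[of _ "of_bool _"] mult.left_commute[of _ "of_bool _"] eq_commute[of x])
  finally show ?case .
qed simp

definition ext_mat :: "nat \<Rightarrow> (nat \<Rightarrow> nat \<Rightarrow> complex) \<Rightarrow> nat \<Rightarrow> nat \<Rightarrow> complex" where
  "ext_mat N g = (\<lambda>x y. if x < N then g x y else if x = y then 1 else 0)"

lemma mat_zero: "g \<in> mat N \<Longrightarrow> N \<le> x \<or> N \<le> y \<Longrightarrow> g x y = 0"
  unfolding mat_def by (metis (mono_tags, lifting) mem_Collect_eq not_le)

lemma act_ext_mat:
  assumes "g \<in> mat N" "N \<le> L" "set w \<subseteq> {..<N}"
  shows "act L (ext_mat N g) f w = act N g f w"
  using assms(3)
proof (induction w arbitrary: f)
  case (Cons x w)
  have "act L (ext_mat N g) f (x # w) = (\<Sum>y<L. g x y * act N g (\<lambda>w. f (y # w)) w)"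
    using Cons by (auto simp: ext_mat_def intro!: sum.cong)
  also have "\<dots> = (\<Sum>y<N. g x y * act N g (\<lambda>w. f (y # w)) w)"
    using assms(1,2) by (intro sum.mono_neutral_right) (auto simp: mat_zero)
  finally show ?case by simp
qed simp

lemma act_ext_mat_odd:
  assumes "g \<in> mat N" "set w \<subseteq> {..<L}" "\<And>w. f w \<noteq> 0 \<Longrightarrow> set w \<subseteq> {N..}"
  shows "act L (ext_mat N g) f w = f w"
  using assms(2,3)
proof (induction w arbitrary: f)
  case (Cons x w)
  have f0: "f (y # w) = 0" if "y < N" for y w
    using that Cons.prems(2)[of "y # w"] by fastforce
  have IH: "act L (ext_mat N g) (\<lambda>w. f (y # w)) w = f (y # w)" for y
    using Cons.prems by (intro Cons.IH) fastforce+
  have "g x y * f (y # w) = 0" for y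
    using f0 assms(1) by (cases "y < N") (auto simp: mat_zero)
  then have "act L (ext_mat N g) f (x # w) = (\<Sum>y<L. if y = x then f (x # w) else 0)"
    unfolding act.simps IH
    by (intro sum.cong refl) (auto simp: ext_mat_def f0 simp del: mult_eq_0_iff)
  then show ?case using Cons.prems(1) by simp
qed simp

definition unitri :: "nat \<Rightarrow> (nat \<Rightarrow> nat \<Rightarrow> complex) \<Rightarrow> bool" where
  "unitri N g \<longleftrightarrow> g \<in> mat N \<and> (\<forall>x<N. g x x = 1) \<and> (\<forall>x y. y < x \<longrightarrow> g x y = 0)"

text \<open>
  Moving \<open>g\<close> past \<open>f\<^sub>c \<mapsto> x\<^sub>i\<close> adds multiples of \<open>f\<^sub>c \<mapsto> x\<^sub>j\<close> with \<open>j < i\<close>; these operators anticommute,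
  have square zero and occur further to the right.
\<close>

lemma unitri_fixes_sops:
  assumes g: "unitri N g" and "N \<le> L"
    and ps: "set ps \<subseteq> prod.swap ` odd_even N" "\<And>p. p \<in> set ps \<Longrightarrow> snd p < L"
    and above: "\<And>xs i \<gamma> ys j. ps = xs @ (i, \<gamma>) # ys \<Longrightarrow> j < i \<Longrightarrow> (j, \<gamma>) \<in> set ys"
    and odd: "\<And>w. z w \<noteq> 0 \<Longrightarrow> set w \<subseteq> {N..}"
    and w: "set w \<subseteq> {..<L}"
  shows "act L (ext_mat N g) (sops N ps z) w = sops N ps z w"
  using ps above w
proof (induction ps arbitrary: w)
  case Nil
  show ?case using g act_ext_mat_odd[of g N w L z] Nil odd by (auto simp: unitri_def)
next
  case (Cons p ps)
  obtain i \<gamma> where p: "p = (i, \<gamma>)" by fastforce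
  have i: "i < N" "N \<le> \<gamma>" "\<gamma> < L" using Cons.prems(1) Cons.prems(2)[of p] by (auto simp: p odd_even_def)
  define h where "h = sops N ps z"
  have above': "(j, \<gamma>') \<in> set ys" if "ps = xs @ (i', \<gamma>') # ys" "j < i'" for xs i' \<gamma>' ys j
    using Cons.prems(3)[of "p # xs" i' \<gamma>' ys j] that by simp
  have IH: "act L (ext_mat N g) h u = h u" if "set u \<subseteq> {..<L}" for u
    unfolding h_def using Cons.prems(1,2) above' that by (intro Cons.IH) auto
  have sm: "sop N j \<gamma> h = (\<lambda>w. 0)" if "j < i" for j
  proof -
    have "(j, \<gamma>) \<in> set ps" using Cons.prems(3)[of "[]" i \<gamma> ps j] that p by simp
    then show ?thesis
      using sops_mem[OF anti_swap_odd_even[OF Cons.prems(1)], of ps "(j, \<gamma>)" z] unfolding h_def by auto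
  qed
  have "act L (ext_mat N g) (sop N i \<gamma> h) w = (\<Sum>j<L. ext_mat N g j i * sop N j \<gamma> (act L (ext_mat N g) h) w)"
  proof (rule act_sop)
    have gm: "x < N \<and> y < N" if "g x y \<noteq> 0" for x y
      using g that unfolding unitri_def mat_def by blast
    show "(N \<le> x) = (N \<le> y)" if "ext_mat N g x y \<noteq> 0" for x y
      using that gm[of x y] by (auto simp: ext_mat_def split: if_splits)
  qed (use i \<open>N \<le> L\<close> Cons.prems(4) in \<open>auto simp: ext_mat_def\<close>)
  also have "\<dots> = (\<Sum>j<L. ext_mat N g j i * sop N j \<gamma> h w)"
  proof -
    have "sop N j \<gamma> (act L (ext_mat N g) h) w = sop N j \<gamma> h w" for j
      by (rule sop_cong_words[OF Cons.prems(4)]) (use i(3) IH in auto)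
    then show ?thesis by simp
  qed
  also have "\<dots> = (\<Sum>j<L. if j = i then sop N i \<gamma> h w else 0)"
  proof (intro sum.cong refl)
    fix j
    consider "j < i" | "j = i" | "i < j" by linarith
    then show "ext_mat N g j i * sop N j \<gamma> h w = (if j = i then sop N i \<gamma> h w else 0)"
      using sm g i by cases (auto simp: ext_mat_def unitri_def)
  qed
  also have "\<dots> = sop N i \<gamma> h w" using i \<open>N \<le> L\<close> by simp
  finally show ?case by (simp add: p h_def)
qed

text \<open>In a partition diagram every box has all boxes of its column above it. Transposition
  reverses the order, so the upper rows act first and stand to the right. This supplies the premise
  on \<open>ps\<close> in \<open>unitri_fixes_sops\<close>.\<close>

lemma boxes_above:
  assumes "sorted_wrt (\<ge>) lam" and "rev (map prod.swap (boxes N r lam)) = xs @ (i, \<gamma>) # ys"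
    and "r \<le> j" "j < i"
  shows "(j, \<gamma>) \<in> set ys"
proof -
  have "map prod.swap (boxes N r lam) = rev (xs @ (i, \<gamma>) # ys)"
    unfolding assms(2)[symmetric] by simp
  then have eq: "map prod.swap (boxes N r lam) = rev ys @ (i, \<gamma>) # rev xs" by simp
  have "map fst (map prod.swap (boxes N r lam)) = map snd (boxes N r lam)" by simp
  then have "sorted (map fst (rev ys @ (i, \<gamma>) # rev xs))"
    unfolding eq[symmetric] using sorted_snd_boxes[of N r lam] by (simp only:)
  then have later: "i \<le> i'" if "(i', \<gamma>') \<in> set xs" for i' \<gamma>'
    using that by (force simp: sorted_append)
  have mem: "p \<in> set (boxes N r lam) \<longleftrightarrow> prod.swap p \<in> set (rev ys @ (i, \<gamma>) # rev xs)" for p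
    unfolding eq[symmetric] by (cases p) force
  have "(\<gamma>, i) \<in> set (boxes N r lam)" unfolding mem by simp
  then obtain c q where q: "\<gamma> = N + c" "i = r + q" "q < length lam" "c < lam ! q"
    by (auto simp: set_boxes)
  have "lam ! q \<le> lam ! (j - r)"
    using assms(1,3,4) q by (auto simp: sorted_wrt_iff_nth_less)
  then have "(\<gamma>, j) \<in> set (boxes N r lam)"
    using q assms(3,4) unfolding set_boxes
    by (intro CollectI exI[of _ c] exI[of _ "j - r"]) auto
  then have "(j, \<gamma>) \<in> set (rev ys @ (i, \<gamma>) # rev xs)" unfolding mem by simp
  then show ?thesis using later[of j \<gamma>] assms(4) by auto
qed

section \<open>Tensor powers of an alternating form\<close>

primrec tprod :: "nat \<Rightarrow> ('a list \<Rightarrow> complex) list \<Rightarrow> 'a list \<Rightarrow> complex" where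
  "tprod d [] w = (if w = [] then 1 else 0)"
| "tprod d (c # cs) w = c (take d w) * tprod d cs (drop d w)"

lemma tprod_append:
  "length u = length cs * d \<Longrightarrow> tprod d (cs @ cs') (u @ v) = tprod d cs u * tprod d cs' v"
proof (induction cs arbitrary: u)
  case (Cons c cs)
  have "length (take d u) = d" "length (drop d u) = length cs * d" using Cons.prems by auto
  then show ?case using Cons.IH[of "drop d u"] by simp
qed simp

lemma tprod_concat:
  "length bs = length cs \<Longrightarrow> \<forall>b\<in>set bs. length b = d \<Longrightarrow>
     tprod d cs (concat bs) = prod_list (map2 (\<lambda>c b. c b) cs bs)"
  by (induction cs bs rule: list_induct2') auto

lemma tprod_support:
  assumes "\<And>c w. c \<in> set cs \<Longrightarrow> c w \<noteq> 0 \<Longrightarrow> w \<in> words Y d" "tprod d cs w \<noteq> 0"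
  shows "w \<in> words Y (length cs * d)"
  using assms
proof (induction cs arbitrary: w)
  case (Cons c cs)
  have "take d w \<in> words Y d" "drop d w \<in> words Y (length cs * d)"
    using Cons.prems(2) by (auto intro!: Cons.prems(1)[of c] Cons.IH Cons.prems(1))
  then show ?case using append_in_words[of "take d w" Y d "drop d w" "length cs * d"] by simp
qed (auto split: if_splits)

definition alt :: "'a set \<Rightarrow> nat \<Rightarrow> ('a list \<Rightarrow> complex) set" where
  "alt Y d = {M. (\<forall>w. M w \<noteq> 0 \<longrightarrow> w \<in> words Y d) \<and> (\<forall>p x y q. M (p @ x # y # q) = - M (p @ y # x # q))}"

lemma alt_swap: "M \<in> alt Y d \<Longrightarrow> M (p @ x # y # q) = - M (p @ y # x # q)"
  unfolding alt_def by blast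

text \<open>Peels off \<open>j\<close> leading factors; the premise covers all lists over
  \<open>S\<close> because the list shrinks. When the factors run out, \<open>p > 0\<close> ensures
  that the remaining word is nonempty, so that both sides are zero.\<close>

lemma sswap_tprod_shift:
  assumes "\<And>cs. set cs \<subseteq> S \<Longrightarrow> sswap N r p (tprod d cs)" and "set cs \<subseteq> S" "p > 0"
  shows "sswap N (j * d + r) p (tprod d cs)"
  using assms(2)
proof (induction j arbitrary: cs)
  case (Suc j)
  show ?case unfolding sswap_def
  proof (intro allI impI)
    fix u b c v :: "nat list"
    assume len: "length u = Suc j * d + r" "length b = p" "length c = p"
    have d: "length (take d u) = d" "length (drop d u) = j * d + r" using len by auto
    show "tprod d cs (u @ b @ c @ v) = (- 1) ^ (nodd N b * nodd N c) * tprod d cs (u @ c @ b @ v)"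
    proof (cases cs)
      case Nil
      have "b \<noteq> []" using len(2) assms(3) by auto
      then show ?thesis using Nil by simp
    next
      case (Cons f cs')
      have "sswap N (j * d + r) p (tprod d cs')" using Suc Cons by simp
      then have "tprod d cs' (drop d u @ b @ c @ v)
          = (- 1) ^ (nodd N b * nodd N c) * tprod d cs' (drop d u @ c @ b @ v)"
        using d len unfolding sswap_def by blast
      then show ?thesis using Cons d len by simp
    qed
  qed
qed (use assms in simp)

lemma sswap_tprod_inner:
  assumes "M \<in> alt Y d" "Y \<subseteq> {N..}" "Suc r < d"
  shows "sswap N (j * d + r) 1 (tprod d (replicate k M))"
proof (rule sswap_tprod_shift[where S = "{M}"])
  fix cs assume cs: "set cs \<subseteq> {M}"
  show "sswap N r 1 (tprod d cs)"
    unfolding sswap_def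
  proof (intro allI impI)
    fix u b c v :: "nat list"
    assume "length u = r" "length b = 1" "length c = 1"
    then obtain x y where u: "length u = r" "b = [x]" "c = [y]" by (auto simp: length_Suc_conv)
    obtain d' where d: "d = r + Suc (Suc d')" using less_imp_Suc_add[OF assms(3)] by auto
    show "tprod d cs (u @ b @ c @ v) = (- 1) ^ (nodd N b * nodd N c) * tprod d cs (u @ c @ b @ v)"
    proof (cases cs)
      case (Cons f cs')
      have f: "f = M" using Cons cs by simp
      define q where "q = take d' v"
      have t: "take d (u @ x' # y' # v) = u @ x' # y' # q" "drop d (u @ x' # y' # v) = drop d' v" for x' y'
        using u(1) d by (simp_all add: q_def)
      have "M (u @ x # y # q) = (- 1) ^ (nodd N b * nodd N c) * M (u @ y # x # q)"
      proof (cases "N \<le> x \<and> N \<le> y")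
        case True
        then show ?thesis using alt_swap[OF assms(1), of u x y q] u by simp
      next
        \<comment> \<open>\<open>M\<close> lives on odd letters only, so both values vanish.\<close>
        case False
        then have "u @ x # y # q \<notin> words Y d" "u @ y # x # q \<notin> words Y d"
          using assms(2) by (auto simp: words_def)
        then have "M (u @ x # y # q) = 0" "M (u @ y # x # q) = 0"
          using assms(1) unfolding alt_def by blast+
        then show ?thesis by simp
      qed
      then show ?thesis unfolding Cons f u(2,3) append.simps tprod.simps t by simp
    qed (use u in simp)
  qed
qed auto

text \<open>On the support of \<open>M\<close> a block has \<open>d\<close> odd letters, so
  exchanging two blocks has the Koszul sign of exponent \<open>d * d\<close>, which is trivial for
  even \<open>d\<close>. The plain symmetry of a power of one form is therefore the signed
  one.\<close>

lemma sswap_tprod_block: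
  assumes "M \<in> alt Y d" "Y \<subseteq> {N..}" "even d" "d > 0"
  shows "sswap N (j * d) d (tprod d (replicate k M))"
proof -
  have "sswap N 0 d (tprod d cs)" if cs: "set cs \<subseteq> {M}" for cs
    unfolding sswap_def
  proof (intro allI impI)
    fix u b c v :: "nat list"
    assume len: "length u = 0" "length b = d" "length c = d"
    have nodd: "nodd N b = d" if "M b \<noteq> 0" for b
    proof -
      have "b \<in> words Y d" using that assms(1) unfolding alt_def by blast
      then show ?thesis using assms(2) by (auto simp: words_def nodd_def subset_iff)
    qed
    have ne: "b \<noteq> []" "c \<noteq> []" using len assms(4) by auto
    consider "cs = []" | "cs = [M]" | cs' where "cs = M # M # cs'"
      using cs by (cases cs; cases "tl cs") auto
    then show "tprod d cs (u @ b @ c @ v) = (- 1) ^ (nodd N b * nodd N c) * tprod d cs (u @ c @ b @ v)"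
    proof cases
      case 3
      show ?thesis
      proof (cases "M b = 0 \<or> M c = 0")
        case False
        then have "nodd N b = d" "nodd N c = d" using nodd by auto
        then have "(- 1 :: complex) ^ (nodd N b * nodd N c) = 1" using assms(3) by simp
        then show ?thesis using 3 len by simp
      qed (use 3 len in auto)
    qed (use len ne in auto)
  qed
  moreover have "set (replicate k M) \<subseteq> {M}" by (rule subsetI) simp
  ultimately have "sswap N (j * d + 0) d (tprod d (replicate k M))"
    using assms(4) by (rule sswap_tprod_shift)
  then show ?thesis by simp
qed

subsection \<open>Polarization\<close>

primrec pder :: "('a \<Rightarrow> complex) \<Rightarrow> ('a \<Rightarrow> complex) \<Rightarrow> 'a list \<Rightarrow> complex" where
  "pder \<phi> \<psi> [] = 0"
| "pder \<phi> \<psi> (x # w) = \<psi> x * prod_list (map \<phi> w) + \<phi> x * pder \<phi> \<psi> w"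

lemma pder_deriv:
  "((\<lambda>t. prod_list (map (\<lambda>x. \<phi> x + t * \<psi> x) w)) has_field_derivative pder \<phi> \<psi> w) (at 0)"
  by (induction w) (auto intro!: derivative_eq_intros)

lemma tsum_deriv:
  "(\<And>w. ((\<lambda>t. f t w) has_field_derivative f' w) (at 0)) \<Longrightarrow>
     ((\<lambda>t. tsum X n (f t)) has_field_derivative tsum X n f') (at 0)"
  by (induction n arbitrary: f f') (auto intro!: DERIV_sum)

text \<open>The product rule puts \<open>\<psi>\<close> at each of the \<open>n\<close> positions in
  turn; by symmetry of \<open>\<Omega>\<close> each position contributes as much as the
  first.\<close>

lemma tsum_pder:
  assumes "\<And>us x y vs. set us \<subseteq> X \<Longrightarrow> x \<in> X \<Longrightarrow> y \<in> X \<Longrightarrow> set vs \<subseteq> X \<Longrightarrow>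
    \<Omega> (us @ x # y # vs) = \<Omega> (us @ y # x # vs)"
  shows "tsum X n (\<lambda>w. \<Omega> w * pder \<phi> \<psi> w)
    = of_nat n * tsum X (n - 1) (\<lambda>w. (\<Sum>x\<in>X. \<Omega> (x # w) * \<psi> x) * prod_list (map \<phi> w))"
  using assms
proof (induction n arbitrary: \<Omega>)
  case (Suc n)
  define T where "T n \<Omega> = tsum X n (\<lambda>w. (\<Sum>x\<in>X. \<Omega> (x # w) * \<psi> x) * prod_list (map \<phi> w))" for n and \<Omega> :: "'a list \<Rightarrow> complex"
  have IH: "tsum X n (\<lambda>w. \<Omega> (x # w) * pder \<phi> \<psi> w) = of_nat n * T (n - 1) (\<lambda>w. \<Omega> (x # w))"
    if "x \<in> X" for x
    unfolding T_def using that Suc.prems[of "x # _"] by (intro Suc.IH) simp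
  have 2: "(\<Sum>x\<in>X. \<phi> x * (of_nat n * T (n - 1) (\<lambda>w. \<Omega> (x # w)))) = of_nat n * T n \<Omega>"
  proof (cases n)
    case (Suc m)
    have "T m (\<lambda>w. \<Omega> (x # w)) * \<phi> x
        = tsum X m (\<lambda>w. (\<Sum>y\<in>X. \<Omega> (y # x # w) * \<psi> y) * (\<phi> x * prod_list (map \<phi> w)))" if "x \<in> X" for x
      unfolding T_def tsum_cmult_right[symmetric]
    proof (rule tsum_cong)
      fix w assume "w \<in> words X m"
      then have "\<Omega> (x # y # w) = \<Omega> (y # x # w)" if "y \<in> X" for y
        using Suc.prems[of "[]" x y w] that \<open>x \<in> X\<close> by (simp add: words_def)
      then have "(\<Sum>y\<in>X. \<Omega> (x # y # w) * \<psi> y) = (\<Sum>y\<in>X. \<Omega> (y # x # w) * \<psi> y)" by (intro sum.cong) auto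
      then show "(\<Sum>y\<in>X. \<Omega> (x # y # w) * \<psi> y) * prod_list (map \<phi> w) * \<phi> x
          = (\<Sum>y\<in>X. \<Omega> (y # x # w) * \<psi> y) * (\<phi> x * prod_list (map \<phi> w))" by (simp add: mult_ac)
    qed
    then have "(\<Sum>x\<in>X. T m (\<lambda>w. \<Omega> (x # w)) * \<phi> x) = T (Suc m) \<Omega>"
      by (simp add: T_def)
    moreover have "(\<Sum>x\<in>X. \<phi> x * (c * U x)) = c * (\<Sum>x\<in>X. U x * \<phi> x)" for c and U :: "'a \<Rightarrow> complex"
      by (simp add: sum_distrib_left mult_ac)
    ultimately show ?thesis by (simp add: Suc)
  qed simp
  have "tsum X (Suc n) (\<lambda>w. \<Omega> w * pder \<phi> \<psi> w)
      = (\<Sum>x\<in>X. tsum X n (\<lambda>w. \<Omega> (x # w) * \<psi> x * prod_list (map \<phi> w)))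
      + (\<Sum>x\<in>X. \<phi> x * tsum X n (\<lambda>w. \<Omega> (x # w) * pder \<phi> \<psi> w))"
    unfolding sum.distrib[symmetric] tsum_cmult[symmetric] tsum_add[symmetric]
    by (simp add: algebra_simps)
  also have "(\<Sum>x\<in>X. tsum X n (\<lambda>w. \<Omega> (x # w) * \<psi> x * prod_list (map \<phi> w))) = T n \<Omega>"
    by (simp add: T_def tsum_sum sum_distrib_right)
  also have "(\<Sum>x\<in>X. \<phi> x * tsum X n (\<lambda>w. \<Omega> (x # w) * pder \<phi> \<psi> w)) = of_nat n * T n \<Omega>"
    unfolding 2[symmetric] using IH by (intro sum.cong) auto
  finally show ?case by (simp add: T_def algebra_simps)
qed simp

text \<open>If a symmetric form vanishes on the diagonal of \<open>A\<close>, differentiating along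
  the line \<open>\<phi> + t \<psi>\<close> shows that its contraction with \<open>\<psi>\<close>
  vanishes there as well, and the degree drops by one.\<close>

lemma polarization:
  fixes \<Omega> :: "'a list \<Rightarrow> complex"
  assumes "\<And>us x y vs. set us \<subseteq> X \<Longrightarrow> x \<in> X \<Longrightarrow> y \<in> X \<Longrightarrow> set vs \<subseteq> X \<Longrightarrow>
      \<Omega> (us @ x # y # vs) = \<Omega> (us @ y # x # vs)"
    and closed: "\<And>\<phi> \<psi> c. \<phi> \<in> A \<Longrightarrow> \<psi> \<in> A \<Longrightarrow> (\<lambda>x. \<phi> x + c * \<psi> x) \<in> A"
    and "\<And>\<phi>. \<phi> \<in> A \<Longrightarrow> tsum X k (\<lambda>w. \<Omega> w * prod_list (map \<phi> w)) = 0"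
    and "set \<phi>s \<subseteq> A" "length \<phi>s = k" and "A \<noteq> {}"
  shows "tsum X k (\<lambda>w. \<Omega> w * prod_list (map2 (\<lambda>\<phi> x. \<phi> x) \<phi>s w)) = 0"
  using assms(1,3,4,5)
proof (induction k arbitrary: \<Omega> \<phi>s)
  case 0
  \<comment> \<open>In degree 0 any member of \<open>A\<close> yields
    \<open>\<Omega> [] = 0\<close>, so one has to exist.\<close>
  with assms(6) show ?case by auto
next
  case (Suc k)
  obtain \<psi> \<psi>s where \<phi>s: "\<phi>s = \<psi> # \<psi>s" using Suc.prems(4) by (cases \<phi>s) auto
  have \<psi>: "\<psi> \<in> A" "set \<psi>s \<subseteq> A" "length \<psi>s = k" using Suc.prems \<phi>s by auto
  define \<Omega>' where "\<Omega>' w = (\<Sum>x\<in>X. \<Omega> (x # w) * \<psi> x)" for w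
  have "tsum X k (\<lambda>w. \<Omega>' w * prod_list (map2 (\<lambda>\<phi> x. \<phi> x) \<psi>s w)) = 0"
  proof (rule Suc.IH)
    show "\<Omega>' (us @ x # y # vs) = \<Omega>' (us @ y # x # vs)"
      if "set us \<subseteq> X" "x \<in> X" "y \<in> X" "set vs \<subseteq> X" for us x y vs
      unfolding \<Omega>'_def
    proof (rule sum.cong)
      fix z assume "z \<in> X"
      then show "\<Omega> (z # us @ x # y # vs) * \<psi> z = \<Omega> (z # us @ y # x # vs) * \<psi> z"
        using Suc.prems(1)[of "z # us" x y vs] that by simp
    qed simp
    show "tsum X k (\<lambda>w. \<Omega>' w * prod_list (map \<phi> w)) = 0" if "\<phi> \<in> A" for \<phi>
    proof -
      have "((\<lambda>t. tsum X (Suc k) (\<lambda>w. \<Omega> w * prod_list (map (\<lambda>x. \<phi> x + t * \<psi> x) w)))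
          has_field_derivative tsum X (Suc k) (\<lambda>w. \<Omega> w * pder \<phi> \<psi> w)) (at 0)"
        by (intro tsum_deriv DERIV_cmult pder_deriv)
      moreover have "tsum X (Suc k) (\<lambda>w. \<Omega> w * prod_list (map (\<lambda>x. \<phi> x + t * \<psi> x) w)) = 0" for t
        using Suc.prems(2) closed[OF that \<psi>(1)] .
      ultimately have "((\<lambda>t. 0) has_field_derivative tsum X (Suc k) (\<lambda>w. \<Omega> w * pder \<phi> \<psi> w)) (at 0)"
        by (simp only:)
      then have "tsum X (Suc k) (\<lambda>w. \<Omega> w * pder \<phi> \<psi> w) = 0"
        by (rule DERIV_unique) (rule DERIV_const)
      then show ?thesis
        using tsum_pder[of X \<Omega> "Suc k" \<phi> \<psi>] Suc.prems(1) by (simp add: \<Omega>'_def del: of_nat_Suc)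
    qed
  qed (use \<psi> in auto)
  then show ?case
    by (simp add: \<phi>s \<Omega>'_def sum_distrib_right tsum_sum mult.assoc)
qed

text \<open>Passes from pairings to coefficients, one slot at a time: pairing all slots but the
  first gives a function in \<open>C\<close>, and on \<open>C\<close> the test functions of
  \<open>A\<close> detect zero.\<close>

lemma slots_zero:
  fixes \<Omega> :: "'a list \<Rightarrow> complex"
  assumes "finite X"
    and C_sum: "\<And>(I :: 'a list set) f c. finite I \<Longrightarrow> (\<And>i. i \<in> I \<Longrightarrow> f i \<in> C) \<Longrightarrow> (\<lambda>x. \<Sum>i\<in>I. f i x * c i) \<in> C"
    and det: "\<And>g. g \<in> C \<Longrightarrow> (\<And>\<phi>. \<phi> \<in> A \<Longrightarrow> (\<Sum>x\<in>X. g x * \<phi> x) = 0) \<Longrightarrow> \<forall>x\<in>X. g x = 0"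
    and "\<And>us vs. set us \<subseteq> X \<Longrightarrow> set vs \<subseteq> X \<Longrightarrow> length us + length vs + 1 = k \<Longrightarrow> (\<lambda>x. \<Omega> (us @ x # vs)) \<in> C"
    and "\<And>\<phi>s. set \<phi>s \<subseteq> A \<Longrightarrow> length \<phi>s = k \<Longrightarrow>
      tsum X k (\<lambda>w. \<Omega> w * prod_list (map2 (\<lambda>\<phi> x. \<phi> x) \<phi>s w)) = 0"
    and "w \<in> words X k"
  shows "\<Omega> w = 0"
  using assms(4-6)
proof (induction k arbitrary: \<Omega> w)
  case 0
  then show ?case using 0(2)[of "[]"] by simp
next
  case (Suc k)
  obtain x u where w: "w = x # u" "x \<in> X" "u \<in> words X k"
    using Suc.prems(3) by (cases w) (auto simp: words_def)
  have "\<Omega> (x # u) = 0"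
  proof (rule Suc.IH[of "\<lambda>u. \<Omega> (x # u)"])
    show "(\<lambda>y. \<Omega> (x # us @ y # vs)) \<in> C"
      if "set us \<subseteq> X" "set vs \<subseteq> X" "length us + length vs + 1 = k" for us vs
      using Suc.prems(1)[of "x # us" vs] that w by simp
    fix \<phi>s assume \<phi>s: "set \<phi>s \<subseteq> A" "length \<phi>s = k"
    define g where "g y = tsum X k (\<lambda>w. \<Omega> (y # w) * prod_list (map2 (\<lambda>\<phi> x. \<phi> x) \<phi>s w))" for y
    have "g \<in> C"
    proof -
      have "(\<lambda>y. \<Sum>w\<in>words X k. \<Omega> (y # w) * prod_list (map2 (\<lambda>\<phi> x. \<phi> x) \<phi>s w)) \<in> C"
        using finite_words[OF assms(1), of k]
        by (rule C_sum) (use Suc.prems(1)[of "[]"] in \<open>auto simp: words_def\<close>)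
      then show ?thesis unfolding g_def tsum_eq_sum[OF assms(1)] .
    qed
    moreover have "(\<Sum>y\<in>X. g y * \<phi> y) = 0" if "\<phi> \<in> A" for \<phi>
      using Suc.prems(2)[of "\<phi> # \<phi>s"] that \<phi>s
      by (simp add: g_def tsum_cmult mult_ac)
    ultimately have "g x = 0" using det w(2) by blast
    then show "tsum X k (\<lambda>w. \<Omega> (x # w) * prod_list (map2 (\<lambda>\<phi> x. \<phi> x) \<phi>s w)) = 0"
      by (simp add: g_def)
  qed (use w in auto)
  then show ?case by (simp add: w)
qed

text \<open>Unlike \<open>alt\<close> this says nothing off \<open>words Y d\<close>: a slice of a
  tensor on longer words is not cut off to one block length.\<close>

definition alt_on :: "'a set \<Rightarrow> nat \<Rightarrow> ('a list \<Rightarrow> complex) \<Rightarrow> bool" where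
  "alt_on Y d g \<longleftrightarrow> (\<forall>p x y q. p @ x # y # q \<in> words Y d \<longrightarrow> g (p @ x # y # q) = - g (p @ y # x # q))"

lemma alt_onD: "alt_on Y d g \<Longrightarrow> p @ x # y # q \<in> words Y d \<Longrightarrow> g (p @ x # y # q) = - g (p @ y # x # q)"
  unfolding alt_on_def by blast

lemma swap_in_words: "p @ x # y # q \<in> words Y d \<longleftrightarrow> p @ y # x # q \<in> words Y d"
  by (auto simp: words_def)

lemma alt_closed:
  assumes "\<phi> \<in> alt Y d" "\<psi> \<in> alt Y d" shows "(\<lambda>x. \<phi> x + c * \<psi> x) \<in> alt Y d"
  unfolding alt_def
proof (intro CollectI conjI allI impI)
  show "w \<in> words Y d" if "\<phi> w + c * \<psi> w \<noteq> 0" for w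
    using that assms unfolding alt_def by force
  show "\<phi> (p @ x # y # q) + c * \<psi> (p @ x # y # q) = - (\<phi> (p @ y # x # q) + c * \<psi> (p @ y # x # q))" for p x y q
    using alt_swap[OF assms(1), of p x y q] alt_swap[OF assms(2), of p x y q] by simp
qed

text \<open>A nonzero symmetric tensor of alternating forms is a nonzero polynomial function.
  Otherwise \<open>polarization\<close> makes all mixed pairings vanish, and then
  \<open>slots_zero\<close> makes all coefficients vanish.\<close>

lemma exists_alt_nonzero:
  fixes \<Omega> :: "'a list list \<Rightarrow> complex"
  assumes "finite Y"
    and sym: "\<And>us x y vs. set us \<subseteq> words Y d \<Longrightarrow> x \<in> words Y d \<Longrightarrow> y \<in> words Y d \<Longrightarrow>
      set vs \<subseteq> words Y d \<Longrightarrow> \<Omega> (us @ x # y # vs) = \<Omega> (us @ y # x # vs)"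
    and slices: "\<And>us vs. set us \<subseteq> words Y d \<Longrightarrow> set vs \<subseteq> words Y d \<Longrightarrow>
      alt_on Y d (\<lambda>b. \<Omega> (us @ b # vs))"
    and nz: "bs \<in> words (words Y d) k" "\<Omega> bs \<noteq> 0"
  shows "\<exists>M\<in>alt Y d. tsum (words Y d) k (\<lambda>bs. \<Omega> bs * prod_list (map M bs)) \<noteq> 0"
proof (rule ccontr)
  assume "\<not> ?thesis"
  then have z: "tsum (words Y d) k (\<lambda>bs. \<Omega> bs * prod_list (map M bs)) = 0" if "M \<in> alt Y d" for M
    using that by blast
  have fin: "finite (words Y d)" using assms(1) by (rule finite_words)
  have zero: "(\<lambda>b. 0) \<in> alt Y d" by (simp add: alt_def)
  have "\<Omega> bs = 0"
  proof (rule slots_zero[where C = "Collect (alt_on Y d)" and A = "alt Y d", OF fin _ _ _ _ nz(1)])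
    fix I :: "'a list list set" and f :: "'a list list \<Rightarrow> 'a list \<Rightarrow> complex" and c
    assume f: "\<And>i. i \<in> I \<Longrightarrow> f i \<in> Collect (alt_on Y d)"
    show "(\<lambda>x. \<Sum>i\<in>I. f i x * c i) \<in> Collect (alt_on Y d)"
      unfolding alt_on_def mem_Collect_eq
    proof (intro allI impI)
      fix p x y q assume "p @ x # y # q \<in> words Y d"
      then have "f i (p @ x # y # q) = - f i (p @ y # x # q)" if "i \<in> I" for i
        using f[OF that] unfolding alt_on_def by blast
      then show "(\<Sum>i\<in>I. f i (p @ x # y # q) * c i) = - (\<Sum>i\<in>I. f i (p @ y # x # q) * c i)"
        by (simp add: sum_negf[symmetric])
    qed
  next
    fix g assume g: "g \<in> Collect (alt_on Y d)"
      and 0: "\<And>\<phi>. \<phi> \<in> alt Y d \<Longrightarrow> (\<Sum>x\<in>words Y d. g x * \<phi> x) = 0"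
    \<comment> \<open>Testing \<open>g\<close> against its own conjugate gives the sum of the
      squared moduli.\<close>
    define \<phi> where "\<phi> b = (if b \<in> words Y d then cnj (g b) else 0)" for b
    have "\<phi> \<in> alt Y d"
      unfolding alt_def
    proof (intro CollectI conjI allI impI)
      fix p x y q
      show "\<phi> (p @ x # y # q) = - \<phi> (p @ y # x # q)"
      proof (cases "p @ x # y # q \<in> words Y d")
        case True
        then have "g (p @ x # y # q) = - g (p @ y # x # q)" using g by (simp add: alt_on_def)
        then show ?thesis using True swap_in_words[of p x y q Y d] by (simp add: \<phi>_def)
      next
        case False
        then show ?thesis using swap_in_words[of p x y q Y d] by (simp add: \<phi>_def)
      qed
    qed (auto simp: \<phi>_def split: if_splits)
    then have "(\<Sum>x\<in>words Y d. g x * cnj (g x)) = 0"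
      using 0[of \<phi>] by (simp add: \<phi>_def cong: sum.cong)
    then have "of_real (\<Sum>x\<in>words Y d. (cmod (g x))\<^sup>2) = (0 :: complex)"
      unfolding of_real_sum complex_norm_square .
    then have "(\<Sum>x\<in>words Y d. (cmod (g x))\<^sup>2) = 0" by (simp only: of_real_eq_0_iff)
    then show "\<forall>x\<in>words Y d. g x = 0"
      by (subst (asm) sum_nonneg_eq_0_iff) (auto simp: fin)
  next
    show "(\<lambda>x. \<Omega> (us @ x # vs)) \<in> Collect (alt_on Y d)"
      if "set us \<subseteq> words Y d" "set vs \<subseteq> words Y d" for us vs
      using slices[OF that] by simp
  next
    show "tsum (words Y d) k (\<lambda>w. \<Omega> w * prod_list (map2 (\<lambda>\<phi> x. \<phi> x) \<phi>s w)) = 0"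
      if "set \<phi>s \<subseteq> alt Y d" "length \<phi>s = k" for \<phi>s
      by (rule polarization[where A = "alt Y d"]) (use sym z that zero in \<open>auto intro: alt_closed\<close>)
  qed
  with nz(2) show False by simp
qed

lemma alt_on_repeat:
  assumes "alt_on Y d f" "p @ x # q @ x # r \<in> words Y d"
  shows "f (p @ x # q @ x # r) = 0"
  using assms(2)
proof (induction q arbitrary: p)
  case Nil
  then have "f (p @ x # x # r) = - f (p @ x # x # r)"
    using alt_onD[OF assms(1), of p x x r] by simp
  then show ?case by simp
next
  case (Cons y q)
  then have "f (p @ x # y # q @ x # r) = - f (p @ y # x # q @ x # r)"
    using alt_onD[OF assms(1), of p x y "q @ x # r"] by simp
  moreover have "f ((p @ [y]) @ x # q @ x # r) = 0"
    using Cons.prems by (intro Cons.IH) (auto simp: words_def)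
  ultimately show ?case by simp
qed

text \<open>Two nonzero polynomial functions do not cover \<open>A\<close> by their zeros. On the
  line through \<open>M\<close> and \<open>M'\<close> they restrict to one-variable polynomials that
  are nonzero at parameters 0 and 1 respectively, so their product has only finitely many
  roots.\<close>

lemma exists_common_nonzero:
  fixes \<Omega> :: "'a list \<Rightarrow> complex" and \<Omega>' :: "'a list \<Rightarrow> complex"
  assumes "finite X" and closed: "\<And>\<phi> \<psi> c. \<phi> \<in> A \<Longrightarrow> \<psi> \<in> A \<Longrightarrow> (\<lambda>x. \<phi> x + c * \<psi> x) \<in> A"
    and "M \<in> A" "tsum X k (\<lambda>w. \<Omega> w * prod_list (map M w)) \<noteq> 0"
    and "M' \<in> A" "tsum X l (\<lambda>w. \<Omega>' w * prod_list (map M' w)) \<noteq> 0"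
  shows "\<exists>M\<in>A. tsum X k (\<lambda>w. \<Omega> w * prod_list (map M w)) \<noteq> 0
    \<and> tsum X l (\<lambda>w. \<Omega>' w * prod_list (map M w)) \<noteq> 0"
proof -
  define D where "D = (\<lambda>x. M' x + (- 1) * M x)"
  define P where "P n (\<Omega> :: 'a list \<Rightarrow> complex) = (\<Sum>w\<in>words X n. smult (\<Omega> w) (prod_list (map (\<lambda>x. [:M x, D x:]) w)))" for n \<Omega>
  have "poly (prod_list (map (\<lambda>x. [:M x, D x:]) w)) t = prod_list (map (\<lambda>x. M x + t * D x) w)" for t w
    by (induction w) (auto simp: algebra_simps)
  then have P: "poly (P n \<Omega>) t = tsum X n (\<lambda>w. \<Omega> w * prod_list (map (\<lambda>x. M x + t * D x) w))" for n \<Omega> t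
    by (simp add: P_def poly_sum tsum_eq_sum[OF assms(1)])
  have "poly (P k \<Omega>) 0 \<noteq> 0" using assms(4) by (simp add: P)
  moreover have "poly (P l \<Omega>') 1 \<noteq> 0" using assms(6) by (simp add: P D_def)
  ultimately have "P k \<Omega> * P l \<Omega>' \<noteq> 0" by auto
  then have "finite {t. poly (P k \<Omega> * P l \<Omega>') t = 0}" by (rule poly_roots_finite)
  then obtain t where "poly (P k \<Omega> * P l \<Omega>') t \<noteq> 0"
    using ex_new_if_finite[OF infinite_UNIV_char_0] by blast
  then show ?thesis
    using closed[OF assms(3) closed[OF assms(5,3), of "- 1"], of t]
    by (intro bexI[of _ "\<lambda>x. M x + t * D x"]) (auto simp: P D_def)
qed

subsection \<open>Stacking highest weight tensors\<close>

text \<open>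
  Invariance under the wreath product of \<open>S\<^sub>d\<close> and \<open>S\<^sub>k\<close>, for tensors on words of length \<open>k * d\<close>;
  \<open>binv\<close> has the Koszul signs, \<open>einv\<close> has none.
\<close>

definition binv :: "nat \<Rightarrow> nat \<Rightarrow> (nat list \<Rightarrow> complex) \<Rightarrow> bool" where
  "binv N d F \<longleftrightarrow> (\<forall>j r. Suc r < d \<longrightarrow> sswap N (j * d + r) 1 F) \<and> (\<forall>j. sswap N (j * d) d F)"

definition einv :: "nat \<Rightarrow> ('a list \<Rightarrow> complex) \<Rightarrow> bool" where
  "einv d F \<longleftrightarrow>
     (\<forall>j r u x y v. Suc r < d \<longrightarrow> length u = j * d + r \<longrightarrow> F (u @ x # y # v) = F (u @ y # x # v)) \<and>
     (\<forall>j u b c v. length u = j * d \<longrightarrow> length b = d \<longrightarrow> length c = d \<longrightarrow> F (u @ b @ c @ v) = F (u @ c @ b @ v))"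

lemma einvI:
  assumes "\<And>j r u x y v. Suc r < d \<Longrightarrow> length u = j * d + r \<Longrightarrow> F (u @ x # y # v) = F (u @ y # x # v)"
    and "\<And>j u b c v. length u = j * d \<Longrightarrow> length b = d \<Longrightarrow> length c = d \<Longrightarrow> F (u @ b @ c @ v) = F (u @ c @ b @ v)"
  shows "einv d F"
  unfolding einv_def using assms by blast

lemma einv_letters:
  "einv d F \<Longrightarrow> Suc r < d \<Longrightarrow> length u = j * d + r \<Longrightarrow> F (u @ x # y # v) = F (u @ y # x # v)"
  unfolding einv_def by blast

lemma einv_blocks:
  "einv d F \<Longrightarrow> length u = j * d \<Longrightarrow> length b = d \<Longrightarrow> length c = d \<Longrightarrow> F (u @ b @ c @ v) = F (u @ c @ b @ v)"
  unfolding einv_def by blast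

lemma sswap_even_iff:
  assumes "\<And>w. F w \<noteq> 0 \<Longrightarrow> set w \<subseteq> {..<N}"
  shows "sswap N m p F \<longleftrightarrow> (\<forall>u b c v. length u = m \<longrightarrow> length b = p \<longrightarrow> length c = p \<longrightarrow>
    F (u @ b @ c @ v) = F (u @ c @ b @ v))"
proof -
  have "(- 1) ^ (nodd N b * nodd N c) * F (u @ c @ b @ v) = F (u @ c @ b @ v)" for u b c v
  proof (cases "F (u @ c @ b @ v) = 0")
    case False
    then have "nodd N b = 0" using assms[of "u @ c @ b @ v"] by (auto simp: nodd_def filter_empty_conv)
    then show ?thesis by simp
  qed simp
  then show ?thesis unfolding sswap_def by (simp only:)
qed

lemma binv_even_iff:
  assumes "\<And>w. F w \<noteq> 0 \<Longrightarrow> set w \<subseteq> {..<N}"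
  shows "binv N d F \<longleftrightarrow> einv d F"
proof -
  have sw: "sswap N m p F \<longleftrightarrow> (\<forall>u b c v. length u = m \<longrightarrow> length b = p \<longrightarrow> length c = p \<longrightarrow>
    F (u @ b @ c @ v) = F (u @ c @ b @ v))" for m p
    by (rule sswap_even_iff) (use assms in blast)
  have len1: "length b = Suc 0 \<longleftrightarrow> (\<exists>x. b = [x])" for b :: "nat list" by (auto simp: length_Suc_conv)
  have 1: "sswap N m 1 F \<longleftrightarrow> (\<forall>u x y v. length u = m \<longrightarrow> F (u @ x # y # v) = F (u @ y # x # v))" for m
    unfolding sw One_nat_def
  proof (intro iffI allI impI)
    fix u v :: "nat list" and x y :: nat
    assume *: "\<forall>u b c v. length u = m \<longrightarrow> length b = Suc 0 \<longrightarrow> length c = Suc 0 \<longrightarrow>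
      F (u @ b @ c @ v) = F (u @ c @ b @ v)" and "length u = m"
    moreover have "length [x] = Suc 0" "length [y] = Suc 0" by simp_all
    ultimately have "F (u @ [x] @ [y] @ v) = F (u @ [y] @ [x] @ v)" by blast
    then show "F (u @ x # y # v) = F (u @ y # x # v)" by simp
  next
    fix u b c v :: "nat list"
    assume *: "\<forall>u x y v. length u = m \<longrightarrow> F (u @ x # y # v) = F (u @ y # x # v)"
      and u: "length u = m" and "length b = Suc 0" "length c = Suc 0"
    then obtain x y where "b = [x]" "c = [y]" unfolding len1 by blast
    moreover have "F (u @ x # y # v) = F (u @ y # x # v)" using * u by blast
    ultimately show "F (u @ b @ c @ v) = F (u @ c @ b @ v)" by (simp only: append.simps)
  qed
  show ?thesis unfolding binv_def einv_def 1 unfolding sw by blast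
qed

lemma sswapD:
  "sswap N m p f \<Longrightarrow> length u = m \<Longrightarrow> length b = p \<Longrightarrow> length c = p \<Longrightarrow>
     f (u @ b @ c @ v) = (- 1) ^ (nodd N b * nodd N c) * f (u @ c @ b @ v)"
  unfolding sswap_def by blast

lemma length_concat_words: "set bs \<subseteq> words Y d \<Longrightarrow> length (concat bs) = length bs * d"
  by (induction bs) (auto simp: words_def)

lemma nodd_words_odd: "b \<in> words Y d \<Longrightarrow> Y \<subseteq> {N..} \<Longrightarrow> nodd N b = d"
  by (auto simp: words_def nodd_def subset_iff)

text \<open>For even \<open>d\<close> two blocks of odd letters commute without sign, which is the
  symmetry that polarization requires.\<close>

lemma binv_blocks_sym:
  assumes "binv N d W" "even d" "Y \<subseteq> {N..}"
    and "set us \<subseteq> words Y d" "x \<in> words Y d" "y \<in> words Y d"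
  shows "W (concat (us @ x # y # vs)) = W (concat (us @ y # x # vs))"
proof -
  have "sswap N (length us * d) d W" using assms(1) unfolding binv_def by blast
  then have "W (concat us @ x @ y @ concat vs)
      = (- 1) ^ (nodd N x * nodd N y) * W (concat us @ y @ x @ concat vs)"
    by (rule sswapD) (use assms(4-6) in \<open>simp_all add: length_words length_concat_words\<close>)
  moreover have "(- 1 :: complex) ^ (nodd N x * nodd N y) = 1"
    using nodd_words_odd[OF _ assms(3)] assms(2,5,6) by simp
  ultimately show ?thesis by simp
qed

lemma binv_blocks_alt:
  assumes "binv N d W" "Y \<subseteq> {N..}" "set us \<subseteq> words Y d"
  shows "alt_on Y d (\<lambda>b. W (concat (us @ b # vs)))"
  unfolding alt_on_def
proof (intro allI impI)
  fix p x y q assume w: "p @ x # y # q \<in> words Y d"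
  then have "Suc (length p) < d" "N \<le> x" "N \<le> y" using assms(2) by (auto simp: words_def)
  then have "sswap N (length us * d + length p) 1 W" using assms(1) unfolding binv_def by blast
  then have "W ((concat us @ p) @ [x] @ [y] @ (q @ concat vs))
      = (- 1) ^ (nodd N [x] * nodd N [y]) * W ((concat us @ p) @ [y] @ [x] @ (q @ concat vs))"
    by (rule sswapD) (simp_all add: length_concat_words[OF assms(3)])
  then show "W (concat (us @ (p @ x # y # q) # vs)) = - W (concat (us @ (p @ y # x # q) # vs))"
    using \<open>N \<le> x\<close> \<open>N \<le> y\<close> by simp
qed

lemma tsum_mono_letters:
  assumes "finite Z" "Y \<subseteq> Z" "\<And>w. f w \<noteq> 0 \<Longrightarrow> w \<in> words Y n"
  shows "tsum Z n f = tsum Y n f"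
proof -
  have "finite Y" using assms finite_subset by blast
  moreover have "words Y n \<subseteq> words Z n" using assms(2) by (auto simp: words_def)
  ultimately show ?thesis
    unfolding tsum_eq_sum[OF assms(1)] tsum_eq_sum[OF \<open>finite Y\<close>]
    using assms by (intro sum.mono_neutral_right finite_words) auto
qed

definition has_content :: "nat \<Rightarrow> nat \<Rightarrow> nat list \<Rightarrow> (nat list \<Rightarrow> complex) \<Rightarrow> bool" where
  "has_content N r a F \<longleftrightarrow> (\<forall>w. F w \<noteq> 0 \<longrightarrow> mset w = mset (map snd (boxes N r a)))"

definition raised :: "nat \<Rightarrow> nat \<Rightarrow> nat list \<Rightarrow> (nat list \<Rightarrow> complex) \<Rightarrow> bool" where
  "raised N r a F \<longleftrightarrow> (\<forall>i j. r \<le> i \<longrightarrow> i < j \<longrightarrow> j < r + length a \<longrightarrow> sop N i j F = (\<lambda>w. 0))"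

lemma content_set:
  assumes "has_content N r a F" "F w \<noteq> 0"
  shows "set w \<subseteq> {r..<r + length a}" "length w = sum_list a"
proof -
  have m: "mset w = mset (map snd (boxes N r a))" using assms unfolding has_content_def by blast
  from arg_cong[OF m, of set_mset] show "set w \<subseteq> {r..<r + length a}" by (auto simp: set_boxes)
  from arg_cong[OF m, of size] show "length w = sum_list a" by simp
qed

text \<open>The boxes use up all letters of \<open>F\<close>, so only column letters remain,
  \<open>N + c\<close> as often as column \<open>c\<close> has boxes: this is the conjugate weight.
  The bound on \<open>L\<close> suffices because no row is longer than the sum of all rows.\<close>

lemma omega:
  fixes r L k d N :: nat and a :: "nat list" and F :: "nat list \<Rightarrow> complex"
  assumes N: "r + length a \<le> N" and F: "has_content N r a F" "raised N r a F" "F \<noteq> (\<lambda>w. 0)"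
    and n: "sum_list a = k * d" and L: "N + sum_list a \<le> L"
  defines "W \<equiv> sops N (boxes N r a) F"
  shows omega_content: "\<And>w. W w \<noteq> 0 \<Longrightarrow> mset w = mset (map fst (boxes N r a))"
    and omega_words: "\<And>w. W w \<noteq> 0 \<Longrightarrow> w \<in> words {N..<L} (k * d)"
    and omega_nonzero: "\<exists>bs\<in>words (words {N..<L} d) k. W (concat bs) \<noteq> 0"
proof -
  show c: "mset w = mset (map fst (boxes N r a))" if nz: "W w \<noteq> 0" for w
  proof -
    obtain u where u: "F u \<noteq> 0" "mset w + mset (map snd (boxes N r a)) = mset u + mset (map fst (boxes N r a))"
      using sops_support[of N "boxes N r a" F w] nz unfolding W_def by blast
    have "mset u = mset (map snd (boxes N r a))" using F(1) u(1) unfolding has_content_def by blast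
    with u(2) show ?thesis by simp
  qed
  show w: "w \<in> words {N..<L} (k * d)" if "W w \<noteq> 0" for w
  proof -
    have "length w = k * d" using arg_cong[OF c[OF that], of size] n by simp
    moreover have "set w = fst ` set (boxes N r a)" using arg_cong[OF c[OF that], of set_mset] by simp
    moreover have "N + c < L" if "i < length a" "c < a ! i" for i c
    proof -
      have "a ! i \<le> sum_list a" using that by (intro member_le_sum_list) auto
      then show ?thesis using that L by linarith
    qed
    ultimately show ?thesis by (auto simp: words_def set_boxes)
  qed
  have "W \<noteq> (\<lambda>w. 0)"
    unfolding W_def by (rule hw_sops_boxes_nonzero) (use N F in \<open>auto simp: has_content_def raised_def\<close>)
  then obtain x where "W x \<noteq> 0" by auto
  then show "\<exists>bs\<in>words (words {N..<L} d) k. W (concat bs) \<noteq> 0"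
    using w words_concat[of x "{N..<L}" k d] by blast
qed

lemma count_first_column:
  "\<forall>x\<in>set a. 0 < x \<Longrightarrow> count (mset (map fst (boxes N r a))) N = length a"
proof (induction a arbitrary: r)
  case (Cons l ls)
  have "count (mset (map (\<lambda>c. N + c) (rev [0..<l]))) N = (if N \<in> set (map (\<lambda>c. N + c) (rev [0..<l])) then 1 else 0)"
    by (rule distinct_count_atmost_1[THEN iffD1, rule_format]) (simp add: distinct_map)
  then show ?case using Cons by (force simp: comp_def)
qed simp

text \<open>An alternating block has no repeated letter, so a letter occurs at most once in each of
  the \<open>k\<close> blocks. For the letter \<open>N\<close> of the first column this bounds the
  number of rows of the partition.\<close>

lemma rows_le:
  assumes "binv N d W" "Y \<subseteq> {N..}" "bs \<in> words (words Y d) k" "W (concat bs) \<noteq> 0"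
  shows "count (mset (concat bs)) x \<le> k"
proof -
  have "distinct b" if b: "b \<in> set bs" for b
  proof (rule ccontr)
    assume "\<not> distinct b"
    then obtain p x q r where split: "b = p @ [x] @ q @ [x] @ r" by (auto dest: not_distinct_decomp)
    obtain us vs where bs: "bs = us @ b # vs" using b by (meson split_list)
    have "set us \<subseteq> words Y d" "b \<in> words Y d" using assms(3) bs by (auto simp: words_def)
    then have "W (concat (us @ b # vs)) = 0"
      using alt_on_repeat[OF binv_blocks_alt[OF assms(1,2), of us vs], of p x q r] split by simp
    then show False using assms(4) bs by simp
  qed
  then have "count (mset (concat bs)) x \<le> length bs"
  proof (induction bs)
    case (Cons b bs)
    have "count (mset b) x \<le> 1"
      using Cons.prems[of b] distinct_count_atmost_1[of b] by auto
    then show ?case using Cons by force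
  qed simp
  then show ?thesis using assms(3) by (simp add: length_words)
qed

text \<open>Truncated subtraction would send every letter below \<open>p\<close> to 0; the case
  distinction excludes such words.\<close>

definition shift :: "nat \<Rightarrow> (nat list \<Rightarrow> complex) \<Rightarrow> nat list \<Rightarrow> complex" where
  "shift p G = (\<lambda>w. if set w \<subseteq> {p..} then G (map (\<lambda>x. x - p) w) else 0)"

lemma shift_map: "shift p G (map (\<lambda>x. x + p) w) = G w"
  by (auto simp: shift_def comp_def)

lemma unshift: "set w \<subseteq> {p..} \<Longrightarrow> \<exists>u. w = map (\<lambda>x. x + p) u" for w :: "nat list"
  by (rule exI[of _ "map (\<lambda>x. x - p) w"]) (auto simp: comp_def intro!: map_idI[symmetric])

lemma sop_map_add:
  assumes "\<alpha> < N" "\<beta> < N" "\<alpha> + p < N" "\<beta> + p < N"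
  shows "sop N (\<alpha> + p) (\<beta> + p) G (map (\<lambda>x. x + p) w) = sop N \<alpha> \<beta> (\<lambda>w. G (map (\<lambda>x. x + p) w)) w"
  using assms by (induction w arbitrary: G) auto

lemma boxes_shift: "map snd (boxes N (r + p) a) = map (\<lambda>x. x + p) (map snd (boxes N r a))"
proof (induction a arbitrary: r)
  case (Cons l ls)
  show ?case using Cons[of "Suc r"] by (simp add: comp_def)
qed simp

lemma content_shift:
  assumes "has_content N 0 b G" shows "has_content N p b (shift p G)"
  unfolding has_content_def
proof (intro allI impI)
  fix w assume nz: "shift p G w \<noteq> 0"
  then have "set w \<subseteq> {p..}" by (auto simp: shift_def split: if_splits)
  then obtain u where w: "w = map (\<lambda>x. x + p) u" using unshift by blast
  then have "mset u = mset (map snd (boxes N 0 b))"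
    using nz assms by (simp add: shift_map has_content_def)
  then have "image_mset (\<lambda>x. x + p) (mset u) = image_mset (\<lambda>x. x + p) (mset (map snd (boxes N 0 b)))"
    by simp
  then show "mset w = mset (map snd (boxes N p b))"
    using boxes_shift[of N 0 p b] unfolding w by (metis add_0 mset_map)
qed

lemma raised_shift:
  assumes "raised N 0 b G" "p + length b \<le> N" shows "raised N p b (shift p G)"
  unfolding raised_def
proof (intro allI impI ext)
  fix i j w assume ij: "p \<le> i" "i < j" "j < p + length b"
  define i' j' where "i' = i - p" and "j' = j - p"
  have e: "i = i' + p" "j = j' + p" "i' < j'" "j' < length b" using ij by (auto simp: i'_def j'_def)
  show "sop N i j (shift p G) w = 0"
  proof (cases "set w \<subseteq> {p..}")
    case True
    then obtain u where w: "w = map (\<lambda>x. x + p) u" using unshift by blast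
    have "sop N i' j' G = (\<lambda>w. 0)" using assms(1) e unfolding raised_def by simp
    then show ?thesis
      unfolding w e(1,2) using e assms(2) by (subst sop_map_add) (auto simp: shift_map)
  next
    case False
    show ?thesis
    proof (rule ccontr)
      assume "sop N i j (shift p G) w \<noteq> 0"
      then obtain u where u: "shift p G u \<noteq> 0" "add_mset j (mset w) = add_mset i (mset u)"
        using sop_support by blast
      have "set u \<subseteq> {p..}" using u(1) by (auto simp: shift_def split: if_splits)
      moreover have "set w \<subseteq> insert i (set u)" using arg_cong[OF u(2), of set_mset] by auto
      ultimately show False using False ij by auto
    qed
  qed
qed

lemma einv_shift:
  assumes "einv d G" shows "einv d (shift p G)"
proof (rule einvI)
  let ?f = "\<lambda>x. x - p"
  fix j r :: nat and u v :: "nat list" and x y :: nat assume *: "Suc r < d" "length u = j * d + r"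
  have "set (u @ x # y # v) = set (u @ y # x # v)" by auto
  moreover have "G (map ?f (u @ x # y # v)) = G (map ?f (u @ y # x # v))"
    using einv_letters[OF assms *(1), of "map ?f u" j] *(2) by simp
  ultimately show "shift p G (u @ x # y # v) = shift p G (u @ y # x # v)"
    by (simp only: shift_def)
next
  let ?f = "\<lambda>x. x - p"
  fix j and u b c v :: "nat list" assume *: "length u = j * d" "length b = d" "length c = d"
  have "set (u @ b @ c @ v) = set (u @ c @ b @ v)" by auto
  moreover have "G (map ?f (u @ b @ c @ v)) = G (map ?f (u @ c @ b @ v))"
    using einv_blocks[OF assms, of "map ?f u" j "map ?f b" "map ?f c"] * by simp
  ultimately show "shift p G (u @ b @ c @ v) = shift p G (u @ c @ b @ v)"
    by (simp only: shift_def)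
qed

lemma tprod_replicate_concat:
  assumes "bs \<in> words (words Y d) k"
  shows "tprod d (replicate k M) (concat bs) = prod_list (map M bs)"
proof -
  have "tprod d (replicate k M) (concat bs) = prod_list (map2 (\<lambda>c b. c b) (replicate k M) bs)"
    using assms by (intro tprod_concat) (auto simp: words_def)
  also have "\<dots> = prod_list (map M bs)"
    using length_words[OF assms] by (induction bs arbitrary: k) auto
  finally show ?thesis .
qed

text \<open>The right-hand side is the value at \<open>M\<close> of the polynomial attached to
  \<open>W\<close>, in the form used by \<open>exists_alt_nonzero\<close>.\<close>

lemma tsum_odd_blocks:
  fixes L :: nat
  assumes "M \<in> alt {N..<L} d"
  shows "tsum {..<L} (k * d) (\<lambda>u. W u * tprod d (replicate k M) u)
    = tsum (words {N..<L} d) k (\<lambda>bs. W (concat bs) * prod_list (map M bs))"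
proof -
  have sup: "u \<in> words {N..<L} (k * d)" if nz: "tprod d (replicate k M) u \<noteq> 0" for u
  proof -
    have "w \<in> words {N..<L} d" if "c \<in> set (replicate k M)" "c w \<noteq> 0" for c w
      using that assms by (auto simp: alt_def)
    from tprod_support[OF this nz] show ?thesis by simp
  qed
  have "tsum {..<L} (k * d) (\<lambda>u. W u * tprod d (replicate k M) u)
     = tsum {N..<L} (k * d) (\<lambda>u. W u * tprod d (replicate k M) u)"
    using sup by (intro tsum_mono_letters) auto
  also have "\<dots> = tsum (words {N..<L} d) k (\<lambda>bs. W (concat bs) * tprod d (replicate k M) (concat bs))"
    by (rule tsum_concat) simp
  also have "\<dots> = tsum (words {N..<L} d) k (\<lambda>bs. W (concat bs) * prod_list (map M bs))"
    by (rule tsum_cong) (simp add: tprod_replicate_concat)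
  finally show ?thesis .
qed

lemma tensor_concat:
  fixes N d k l :: nat and a b :: "nat list"
  assumes d: "even d" "d > 0"
    and part: "sorted_wrt (\<ge>) (a @ b)" "\<forall>x\<in>set (a @ b). 0 < x"
    and N: "k + l \<le> N" "length a \<le> N" "length b \<le> N"
    and n: "sum_list a = k * d" "sum_list b = l * d"
    and F: "has_content N 0 a F" "raised N 0 a F" "F \<noteq> (\<lambda>w. 0)" "einv d F"
    and G: "has_content N 0 b G" "raised N 0 b G" "G \<noteq> (\<lambda>w. 0)" "einv d G"
  shows "length (a @ b) \<le> N"
    and "\<exists>v \<in> tens N ((k + l) * d). v \<noteq> (\<lambda>w. 0) \<and> has_content N 0 (a @ b) v \<and> einv d v
      \<and> (\<forall>g. unitri N g \<longrightarrow> act N g v = v)"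
proof -
  define L where "L = N + sum_list a + sum_list b"
  define Y where "Y = {N..<L}"
  have Y: "Y \<subseteq> {N..}" "finite Y" by (auto simp: Y_def)
  \<comment> \<open>The letter \<open>N\<close> occurs once for every row, since the parts are
    positive, and at most once in every block.\<close>
  have rows: "length c \<le> m"
    if H: "length c \<le> N" "has_content N 0 c H" "raised N 0 c H" "H \<noteq> (\<lambda>w. 0)" "einv d H"
      "sum_list c = m * d" "N + sum_list c \<le> L" "\<forall>x\<in>set c. 0 < x" for c m H
  proof -
    define W where "W = sops N (boxes N 0 c) H"
    have "set w \<subseteq> {..<N}" if "H w \<noteq> 0" for w
      using content_set(1)[OF \<open>has_content N 0 c H\<close> that] \<open>length c \<le> N\<close> by auto
    then have "binv N d H" using binv_even_iff \<open>einv d H\<close> by blast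
    then have W: "binv N d W" unfolding binv_def W_def by (auto intro: sswap_sops)
    obtain bs where bs: "bs \<in> words (words Y d) m" "W (concat bs) \<noteq> 0"
      using omega_nonzero[of 0 c N H m d L] H unfolding W_def Y_def by auto
    have "mset (concat bs) = mset (map fst (boxes N 0 c))"
      using omega_content[of 0 c N H m d L] H bs(2) unfolding W_def by auto
    then have "count (mset (concat bs)) N = length c"
      using count_first_column[OF \<open>\<forall>x\<in>set c. 0 < x\<close>] by metis
    then show ?thesis using rows_le[OF W Y(1) bs, of N] by simp
  qed
  have "length a \<le> k" "length b \<le> l"
    using part(2) N n by (auto intro!: rows[OF _ F] rows[OF _ G] simp: L_def)
  then show ab: "length (a @ b) \<le> N" using N(1) by simp
  define p where "p = length a"
  define G' where "G' = shift p G"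
  have pN: "p + length b \<le> N" using ab by (simp add: p_def)
  have G': "has_content N p b G'" "raised N p b G'" "einv d G'"
    unfolding G'_def using G pN content_shift raised_shift einv_shift by auto
  obtain w where "G w \<noteq> 0" using G(3) by auto
  then have "G' \<noteq> (\<lambda>w. 0)" using shift_map[of p G w] unfolding G'_def by metis
  note G' = G' this
  have evF: "set w \<subseteq> {..<N}" if "F w \<noteq> 0" for w
    using content_set(1)[OF F(1) that] N by auto
  have evG: "set w \<subseteq> {..<N}" if "G' w \<noteq> 0" for w
    using content_set(1)[OF G'(1) that] pN by auto
  define WF where "WF = sops N (boxes N 0 a) F"
  define WG where "WG = sops N (boxes N p b) G'"
  have "binv N d F" "binv N d G'" using binv_even_iff evF evG F(4) G'(3) by blast+
  then have bW: "binv N d WF" "binv N d WG" unfolding binv_def WF_def WG_def by (auto intro: sswap_sops)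
  have WFw: "w \<in> words Y (k * d)" if "WF w \<noteq> 0" for w
    using omega_words[of 0 a N F k d L w] F N n that unfolding WF_def Y_def L_def by auto
  have WGw: "w \<in> words Y (l * d)" if "WG w \<noteq> 0" for w
    using omega_words[of p b N G' l d L w] G' pN n that unfolding WG_def Y_def L_def by auto
  have exM: "\<exists>M\<in>alt Y d. tsum (words Y d) m (\<lambda>bs. W (concat bs) * prod_list (map M bs)) \<noteq> 0"
    if "bs \<in> words (words Y d) m" "W (concat bs) \<noteq> 0" "binv N d W" for W m bs
  proof (rule exists_alt_nonzero[where \<Omega> = "\<lambda>bs. W (concat bs)", OF Y(2) _ _ that(1) that(2)])
    show "W (concat (us @ x # y # vs)) = W (concat (us @ y # x # vs))"
      if "set us \<subseteq> words Y d" "x \<in> words Y d" "y \<in> words Y d" for us x y vs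
      using binv_blocks_sym[OF \<open>binv N d W\<close> d(1) Y(1) that] .
    show "alt_on Y d (\<lambda>b. W (concat (us @ b # vs)))" if "set us \<subseteq> words Y d" for us vs
      using binv_blocks_alt[OF \<open>binv N d W\<close> Y(1) that] .
  qed
  obtain M1 where M1: "M1 \<in> alt Y d" "tsum (words Y d) k (\<lambda>bs. WF (concat bs) * prod_list (map M1 bs)) \<noteq> 0"
    using omega_nonzero[of 0 a N F k d L] F N n exM[of _ k WF] bW unfolding WF_def Y_def L_def by auto
  obtain M2 where M2: "M2 \<in> alt Y d" "tsum (words Y d) l (\<lambda>bs. WG (concat bs) * prod_list (map M2 bs)) \<noteq> 0"
    using omega_nonzero[of p b N G' l d L] G' pN n exM[of _ l WG] bW unfolding WG_def Y_def L_def by auto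
  \<comment> \<open>One form has to serve both factors: only the power of a single form is symmetric
    under exchanging a block of the first factor with one of the second.\<close>
  obtain M where M: "M \<in> alt Y d"
    "tsum (words Y d) k (\<lambda>bs. WF (concat bs) * prod_list (map M bs)) \<noteq> 0"
    "tsum (words Y d) l (\<lambda>bs. WG (concat bs) * prod_list (map M bs)) \<noteq> 0"
    using exists_common_nonzero[OF finite_words[OF Y(2)] alt_closed M1 M2] by blast
  define z where "z = tprod d (replicate (k + l) M)"
  define bx where "bx = boxes N 0 (a @ b)"
  define ps where "ps = rev (map prod.swap bx)"
  define v where "v = sops N ps z"
  have bx: "bx = boxes N 0 a @ boxes N p b" by (simp add: bx_def boxes_append p_def)
  have bxDD: "set bx \<subseteq> odd_even N" unfolding bx_def using ab by (intro boxes_odd_even) simp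
  have bxL: "fst q < L \<and> snd q < L" if q0: "q \<in> set bx" for q
  proof -
    obtain c i where q: "q = (N + c, 0 + i)" "i < length (a @ b)" "c < (a @ b) ! i"
      using q0 unfolding bx_def set_boxes by blast
    have "(a @ b) ! i \<le> sum_list (a @ b)" using nth_mem[OF q(2)] by (intro member_le_sum_list) auto
    then show ?thesis using q ab unfolding L_def by auto
  qed
  have zodd: "set w \<subseteq> {N..<L} \<and> length w = (k + l) * d" if nz: "z w \<noteq> 0" for w
  proof -
    have "w \<in> words Y d" if "c \<in> set (replicate (k + l) M)" "c w \<noteq> 0" for c w
      using that M(1) by (auto simp: alt_def)
    from tprod_support[OF this nz[unfolded z_def]] show ?thesis by (simp add: words_def Y_def)
  qed
  \<comment> \<open>Compare the letters below \<open>N\<close>: neither \<open>u\<close> nor the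
    column letters contribute any, so \<open>w\<close> contains the row letters of all boxes. Its
    length is the number of boxes, so there is nothing else.\<close>
  have vsupp: "mset w = mset (map snd bx)" if nz: "v w \<noteq> 0" for w
  proof -
    obtain u where u: "z u \<noteq> 0" "mset w + mset (map snd ps) = mset u + mset (map fst ps)"
      using sops_support[of N ps z w] nz unfolding v_def by blast
    have ps': "mset (map snd ps) = mset (map fst bx)" "mset (map fst ps) = mset (map snd bx)"
    proof -
      have "map snd ps = rev (map fst bx)" "map fst ps = rev (map snd bx)"
        by (simp_all add: ps_def rev_map comp_def)
      then show "mset (map snd ps) = mset (map fst bx)" "mset (map fst ps) = mset (map snd bx)"
        by (simp_all only: mset_rev)
    qed
    have "size (mset u) = (k + l) * d" "size (mset (map snd bx)) = (k + l) * d"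
      using zodd[OF u(1)] n by (simp_all add: bx_def add_mult_distrib)
    moreover have "size (mset (map fst bx)) = size (mset (map snd bx))" by simp
    ultimately have size: "size (mset w) = size (mset (map snd bx))"
      using arg_cong[OF u(2)[unfolded ps'], of size] by simp
    have "filter_mset (\<lambda>x. x < N) (mset w) = mset (map snd bx)"
    proof -
      have 1: "filter_mset (\<lambda>x. x < N) (mset (map fst bx)) = {#}"
        "filter_mset (\<lambda>x. x < N) (mset u) = {#}"
        "filter_mset (\<lambda>x. x < N) (mset (map snd bx)) = mset (map snd bx)"
      proof -
        have "\<forall>q\<in>set bx. N \<le> fst q \<and> snd q < N" using bxDD by (auto simp: odd_even_def)
        then have "filter (\<lambda>x. x < N) (map fst bx) = []" "filter (\<lambda>x. x < N) u = []"
          "filter (\<lambda>x. x < N) (map snd bx) = map snd bx"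
          using zodd[OF u(1)] by (auto simp: filter_empty_conv filter_id_conv not_less)
        then show "filter_mset (\<lambda>x. x < N) (mset (map fst bx)) = {#}"
          "filter_mset (\<lambda>x. x < N) (mset u) = {#}"
          "filter_mset (\<lambda>x. x < N) (mset (map snd bx)) = mset (map snd bx)"
          unfolding mset_filter[symmetric] by (simp_all only: mset.simps)
      qed
      from arg_cong[OF u(2)[unfolded ps'], of "filter_mset (\<lambda>x. x < N)"] show ?thesis
        by (simp only: filter_union_mset 1 add_0 add_0_right)
    qed
    then have "mset (map snd bx) \<subseteq># mset w" by (metis multiset_filter_subset)
    then show ?thesis using size by (metis mset_subset_size nat_less_le subset_mset.le_less)
  qed
  have cont: "has_content N 0 (a @ b) v" using vsupp unfolding has_content_def bx_def by blast
  have vN: "set w \<subseteq> {..<N} \<and> length w = (k + l) * d" if "v w \<noteq> 0" for w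
    using content_set[OF cont that] ab n by (auto simp: add_mult_distrib)
  have vT: "v \<in> tens N ((k + l) * d)" using vN unfolding tens_def words_def by blast
  have "binv N d z"
    unfolding binv_def z_def using sswap_tprod_inner[OF M(1) Y(1)] sswap_tprod_block[OF M(1) Y(1) d] by blast
  then have "binv N d v" unfolding binv_def v_def by (auto intro: sswap_sops)
  then have "einv d v" using binv_even_iff[of v N d] vN by blast
  have fixed: "act N g v = v" if g: "unitri N g" for g
  proof
    fix w
    show "act N g v w = v w"
    proof (cases "set w \<subseteq> {..<N}")
      case True
      have "act L (ext_mat N g) (sops N ps z) w = sops N ps z w"
      proof (rule unitri_fixes_sops[OF g])
        show "N \<le> L" by (simp add: L_def)
        show "set ps \<subseteq> prod.swap ` odd_even N" using bxDD by (auto simp: ps_def)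
        show "snd q < L" if "q \<in> set ps" for q using that bxL by (auto simp: ps_def)
        show "(j, \<gamma>) \<in> set ys" if "ps = xs @ (i, \<gamma>) # ys" "j < i" for xs i \<gamma> ys j
          by (rule boxes_above[OF part(1), of N 0]) (use that in \<open>auto simp: ps_def bx_def\<close>)
        show "set w \<subseteq> {N..}" if "z w \<noteq> 0" for w using zodd[OF that] by auto
        show "set w \<subseteq> {..<L}" using True by (auto simp: L_def)
      qed
      moreover have "act L (ext_mat N g) v w = act N g v w"
        using g True by (intro act_ext_mat) (auto simp: unitri_def L_def)
      ultimately show ?thesis by (simp add: v_def)
    next
      case False
      then have "act N g v w = 0" "v w = 0"
        using act_nonzero[of g N v w] g vN unfolding unitri_def by blast+
      then show ?thesis by simp
    qed
  qed
  \<comment> \<open>This is the tensor against which \<open>v\<close> is tested; it only has to pair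
    with \<open>v\<close> to something nonzero.\<close>
  define y where "y = ext_prod (k * d) F G'"
  \<comment> \<open>The operators of the rows of \<open>b\<close> find none of their letters in
    \<open>F\<close>. Afterwards those of the rows of \<open>a\<close> find only odd letters in
    \<open>WG\<close>. So each group acts on its own factor.\<close>
  have "sops N (boxes N p b) y = ext_prod (k * d) F WG"
    unfolding y_def WG_def
  proof (rule sops_ext_prod_right)
    show "length u = k * d \<and> set u \<subseteq> {..<N}" if "F u \<noteq> 0" for u
      using evF[OF that] content_set(2)[OF F(1) that] n by simp
    fix q assume "q \<in> set (boxes N p b)"
    then have q: "N \<le> fst q" "p \<le> snd q" "snd q < N" using pN by (auto simp: set_boxes)
    show "sop N (fst q) (snd q) F = (\<lambda>w. 0)"
    proof (rule sop_absent)
      show "snd q \<notin> set w" if "F w \<noteq> 0" for w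
        using content_set(1)[OF F(1) that] q by (auto simp: p_def)
    qed (use q in auto)
  qed
  moreover have "sops N (boxes N 0 a) (ext_prod (k * d) F WG) = ext_prod (k * d) WF WG"
    unfolding WF_def
  proof (rule sops_ext_prod_left)
    show "length u = k * d" if "F u \<noteq> 0" for u
      using content_set(2)[OF F(1) that] n by simp
    fix q assume "q \<in> set (boxes N 0 a)"
    then have q: "N \<le> fst q" "snd q < N" using N by (auto simp: set_boxes)
    show "sop N (fst q) (snd q) WG = (\<lambda>w. 0)"
    proof (rule sop_absent)
      show "snd q \<notin> set w" if "WG w \<noteq> 0" for w
        using WGw[OF that] Y(1) q by (auto simp: words_def)
    qed (use q in auto)
  qed
  ultimately have sops_y: "sops N bx y = ext_prod (k * d) WF WG"
    unfolding bx sops_append by simp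
  have "tsum {..<L} ((k + l) * d) (\<lambda>w. y w * v w)
      = tsum {..<L} ((k + l) * d) (\<lambda>w. sops N bx y w * z w)"
    unfolding v_def ps_def using bxL by (rule sops_transpose[symmetric])
  also have "\<dots> = tsum {..<L} (k * d) (\<lambda>u. tsum {..<L} (l * d) (\<lambda>u'. sops N bx y (u @ u') * z (u @ u')))"
    unfolding add_mult_distrib tsum_append ..
  also have "\<dots> = tsum {..<L} (k * d) (\<lambda>u. tsum {..<L} (l * d) (\<lambda>u'.
      WF u * tprod d (replicate k M) u * (WG u' * tprod d (replicate l M) u')))"
  proof (intro tsum_cong)
    fix u u' assume "u \<in> words {..<L} (k * d)" "u' \<in> words {..<L} (l * d)"
    then have "length u = k * d" by (simp add: words_def)
    then show "sops N bx y (u @ u') * z (u @ u')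
        = WF u * tprod d (replicate k M) u * (WG u' * tprod d (replicate l M) u')"
      unfolding sops_y z_def replicate_add by (simp add: ext_prod_def tprod_append)
  qed
  also have "\<dots> = tsum {..<L} (k * d) (\<lambda>u. WF u * tprod d (replicate k M) u)
      * tsum {..<L} (l * d) (\<lambda>u'. WG u' * tprod d (replicate l M) u')"
    unfolding tsum_cmult tsum_cmult_right ..
  also have "\<dots> \<noteq> 0"
    using M unfolding Y_def by (simp add: tsum_odd_blocks)
  finally have "v \<noteq> (\<lambda>w. 0)" by auto
  with vT cont \<open>einv d v\<close> fixed
  show "\<exists>v \<in> tens N ((k + l) * d). v \<noteq> (\<lambda>w. 0) \<and> has_content N 0 (a @ b) v \<and> einv d v
      \<and> (\<forall>g. unitri N g \<longrightarrow> act N g v = v)" by blast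
qed

subsection \<open>Tensors and the plethysm\<close>

interpretation fs: vector_space fscale by (rule vector_space_fscale)

lemma dual_spaceI:
  assumes "vector_space s" "\<And>x y. \<eta> (x + y) = \<eta> x + \<eta> y" "\<And>c x. \<eta> (s c x) = c * \<eta> x"
  shows "\<eta> \<in> dual_space s"
proof -
  have "vector_space ((*) :: complex \<Rightarrow> complex \<Rightarrow> complex)"
    by unfold_locales (auto simp: algebra_simps)
  then show ?thesis using assms by (simp add: dual_space_def Vector_Spaces.linear_iff)
qed

lemma dual_add: "\<eta> \<in> dual_space s \<Longrightarrow> \<eta> (x + y) = \<eta> x + \<eta> y"
  and dual_scale: "\<eta> \<in> dual_space s \<Longrightarrow> \<eta> (s c x) = c * \<eta> x"
  by (simp_all add: dual_space_def Vector_Spaces.linear_iff)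

lemma dual_zero: "\<eta> \<in> dual_space s \<Longrightarrow> \<eta> 0 = 0"
  using dual_add[of \<eta> s 0 0] by simp

lemma dual_lincomb:
  "\<eta> \<in> dual_space s \<Longrightarrow> \<eta> (\<Sum>i\<in>I. s (c i) (x i)) = (\<Sum>i\<in>I. c i * \<eta> (x i))"
  by (induction I rule: infinite_finite_induct) (auto simp: dual_zero dual_add dual_scale)

lemma dual_vector_space: "\<eta> \<in> dual_space s \<Longrightarrow> vector_space s"
  by (simp add: dual_space_def Vector_Spaces.linear_iff)

lemma dual_combine:
  assumes "\<phi> \<in> dual_space s" "\<psi> \<in> dual_space s" shows "(\<lambda>x. \<phi> x + c * \<psi> x) \<in> dual_space s"
  using dual_vector_space[OF assms(1)]
  by (rule dual_spaceI) (simp_all add: dual_add[OF assms(1)] dual_add[OF assms(2)]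
      dual_scale[OF assms(1)] dual_scale[OF assms(2)] algebra_simps)

lemma eval_dual: "(\<lambda>F. F \<eta>) \<in> dual_space fscale"
  by (rule dual_spaceI[OF vector_space_fscale]) (simp_all add: fscale_def)

lemma prod_list_sum:
  "prod_list (map (\<lambda>v. \<Sum>x\<in>X. c v x * \<psi> x) vs)
    = tsum X (length vs) (\<lambda>b. prod_list (map2 c vs b) * prod_list (map \<psi> b))"
  by (induction vs) (simp_all add: sum_distrib_right sum_distrib_left tsum_cmult[symmetric] tsum_sum mult_ac)

lemma sum_fun_apply: "(\<Sum>i\<in>I. f i) x = (\<Sum>i\<in>I. f i x :: complex)"
  by (induction I rule: infinite_finite_induct) auto

lemma act_tsum: "act N g (\<lambda>w. tsum X k (\<lambda>bs. f bs w * c bs)) w = tsum X k (\<lambda>bs. act N g (f bs) w * c bs)"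
proof (induction k arbitrary: f c)
  case 0
  show ?case using act_cmult[of N g "c []" "f []" w] by (simp add: mult.commute)
qed (simp add: act_sum)

text \<open>Moves \<open>g\<close> from the tensor to the test function, where its transpose acts
  block by block. This is the equivariance of \<open>pleth\<close> at the level of
  coefficients.\<close>

lemma act_blocks:
  "tsum (words {..<N} d) k (\<lambda>bs. act N g f (concat bs) * prod_list (map \<psi> bs))
    = tsum (words {..<N} d) k (\<lambda>bs. f (concat bs) * prod_list (map (act N (\<lambda>x y. g y x) \<psi>) bs))"
proof (induction k arbitrary: f)
  case (Suc k)
  let ?X = "words {..<N} d" and ?h = "act N (\<lambda>x y. g y x) \<psi>"
  have X: "(\<Sum>b\<in>?X. F b) = tsum {..<N} d F" for F by (simp add: tsum_eq_sum)
  have "tsum ?X (Suc k) (\<lambda>bs. act N g f (concat bs) * prod_list (map \<psi> bs))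
      = tsum {..<N} d (\<lambda>b. tsum ?X k (\<lambda>bs. act N g (\<lambda>u. act N g (\<lambda>v. f (u @ v)) (concat bs)) b
          * prod_list (map \<psi> bs)) * \<psi> b)"
    by (simp add: X act_append tsum_cmult mult_ac)
  also have "\<dots> = tsum {..<N} d (\<lambda>b. act N g (\<lambda>u. tsum ?X k (\<lambda>bs. act N g (\<lambda>v. f (u @ v)) (concat bs)
          * prod_list (map \<psi> bs))) b * \<psi> b)"
    by (simp add: act_tsum)
  also have "\<dots> = tsum {..<N} d (\<lambda>b. tsum ?X k (\<lambda>bs. f (b @ concat bs) * prod_list (map ?h bs)) * ?h b)"
    unfolding Suc by (rule act_transpose)
  also have "\<dots> = tsum ?X (Suc k) (\<lambda>bs. f (concat bs) * prod_list (map ?h bs))"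
    by (simp add: X mult_ac flip: tsum_cmult)
  finally show ?case .
qed simp

lemma tens_comb:
  assumes "f \<in> tens N n" "g \<in> tens N n" shows "(\<lambda>w. c * f w + g w) \<in> tens N n"
  unfolding tens_def
proof (intro CollectI allI impI)
  fix w assume "c * f w + g w \<noteq> 0"
  then have "f w \<noteq> 0 \<or> g w \<noteq> 0" by auto
  then show "w \<in> words {..<N} n" using assms unfolding tens_def by blast
qed

section \<open>Invertible matrices and coordinates\<close>

definition GLm :: "nat \<Rightarrow> (nat \<Rightarrow> nat \<Rightarrow> complex) set" where
  "GLm N = {A \<in> mat N. \<exists>B\<in>mat N. mmul N A B = mone N \<and> mmul N B A = mone N}"

locale gl_basis = finite_dimensional_vector_space s "set e"
  for s :: "complex \<Rightarrow> 'v::ab_group_add \<Rightarrow> 'v" and e :: "'v list" +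
  assumes distinct_e: "distinct e"
begin

abbreviation "N \<equiv> length e"

definition coord :: "nat \<Rightarrow> 'v \<Rightarrow> complex" where
  "coord i v = representation (set e) v (e ! i)"

lemma coord_dual: "coord i \<in> dual_space s"
proof (rule dual_spaceI)
  show "vector_space s" by unfold_locales
qed (simp_all add: coord_def independent_Basis span_Basis representation_add representation_scale)

lemma coord_basis: "i < N \<Longrightarrow> j < N \<Longrightarrow> coord i (e ! j) = (if i = j then 1 else 0)"
  using distinct_e by (simp add: coord_def representation_basis independent_Basis nth_eq_iff_index_eq)

lemma sum_set_e: "(\<Sum>b\<in>set e. f b) = (\<Sum>i<N. f (e ! i))"
  using bij_betw_nth[OF distinct_e, of "{..<N}" "set e"] by (simp add: sum.reindex_bij_betw)

lemma coord_expand: "(\<Sum>i<N. s (coord i v) (e ! i)) = v"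
proof -
  have "(\<Sum>b\<in>set e. s (representation (set e) v b) b) = v"
    by (rule sum_representation_eq) (auto simp: independent_Basis span_Basis)
  then show ?thesis by (simp add: sum_set_e coord_def)
qed

lemma coord_ext: "(\<And>i. i < N \<Longrightarrow> coord i v = coord i w) \<Longrightarrow> v = w"
  using coord_expand[of v] coord_expand[of w] by (metis (no_types, lifting) lessThan_iff sum.cong)

lemma dual_coord: "\<eta> \<in> dual_space s \<Longrightarrow> \<eta> v = (\<Sum>i<N. coord i v * \<eta> (e ! i))"
  using dual_lincomb[of \<eta> s "\<lambda>i. coord i v" "\<lambda>i. e ! i" "{..<N}"] by (simp add: coord_expand)

definition mat_of :: "('v \<Rightarrow> 'v) \<Rightarrow> nat \<Rightarrow> nat \<Rightarrow> complex" where
  "mat_of g = (\<lambda>i j. if i < N \<and> j < N then coord i (g (e ! j)) else 0)"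

definition lin_of :: "(nat \<Rightarrow> nat \<Rightarrow> complex) \<Rightarrow> 'v \<Rightarrow> 'v" where
  "lin_of A v = (\<Sum>i<N. s (\<Sum>j<N. A i j * coord j v) (e ! i))"

lemma mat_of_mat: "mat_of g \<in> mat N"
  by (auto simp: mat_of_def mat_def split: if_splits)

lemma coord_sum: "coord i (\<Sum>j\<in>I. s (c j) (x j)) = (\<Sum>j\<in>I. c j * coord i (x j))"
  by (rule dual_lincomb[OF coord_dual])

lemma delta_sum: "i < N \<Longrightarrow> (\<Sum>j<N. c j * (if i = j then 1 else 0)) = (c i :: complex)"
  by (subst sum.remove[of _ i]) (auto intro!: sum.neutral)

lemma coord_lin_of: "i < N \<Longrightarrow> coord i (lin_of A v) = (\<Sum>j<N. A i j * coord j v)"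
proof -
  assume i: "i < N"
  have "coord i (lin_of A v) = (\<Sum>x<N. (\<Sum>j<N. A x j * coord j v) * (if i = x then 1 else 0))"
    unfolding lin_of_def coord_sum using i by (intro sum.cong refl) (simp add: coord_basis)
  then show ?thesis using i by (simp only: delta_sum)
qed

lemma lin_of_linear: "Vector_Spaces.linear s s (lin_of A)"
proof -
  have "lin_of A (x + y) = lin_of A x + lin_of A y" for x y
    by (rule coord_ext) (simp add: coord_lin_of dual_add[OF coord_dual] distrib_left sum.distrib)
  moreover have "lin_of A (s c x) = s c (lin_of A x)" for c x
    by (rule coord_ext) (simp add: coord_lin_of dual_scale[OF coord_dual] sum_distrib_left mult_ac)
  moreover have "vector_space s" by unfold_locales
  ultimately show ?thesis by (simp add: Vector_Spaces.linear_iff)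
qed

lemma lin_of_lin_of: "lin_of A (lin_of B v) = lin_of (mmul N A B) v"
proof (rule coord_ext)
  fix i assume i: "i < N"
  have "coord i (lin_of A (lin_of B v)) = (\<Sum>j<N. \<Sum>k<N. A i j * B j k * coord k v)"
    using i by (simp add: coord_lin_of sum_distrib_left mult.assoc)
  also have "\<dots> = coord i (lin_of (mmul N A B) v)"
    using i by (subst sum.swap) (simp add: coord_lin_of mmul_def sum_distrib_right)
  finally show "coord i (lin_of A (lin_of B v)) = coord i (lin_of (mmul N A B) v)" .
qed

lemma lin_of_mone: "lin_of (mone N) v = v"
proof (rule coord_ext)
  fix i assume i: "i < N"
  have "coord i (lin_of (mone N) v) = (\<Sum>j<N. coord j v * (if i = j then 1 else 0))"
    using i by (auto simp: coord_lin_of mone_def intro!: sum.cong)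
  then show "coord i (lin_of (mone N) v) = coord i v" using i by (simp add: delta_sum)
qed

lemma mat_of_lin_of: "A \<in> mat N \<Longrightarrow> mat_of (lin_of A) = A"
proof (intro ext)
  fix i j assume A: "A \<in> mat N"
  show "mat_of (lin_of A) i j = A i j"
  proof (cases "i < N \<and> j < N")
    case True
    have "(\<Sum>k<N. A i k * coord k (e ! j)) = (\<Sum>k<N. A i k * (if j = k then 1 else 0))"
      using True by (intro sum.cong refl) (simp add: coord_basis)
    then show ?thesis using True by (simp add: mat_of_def coord_lin_of delta_sum)
  next
    case False
    then show ?thesis using mat_zero[OF A, of i j] by (auto simp: mat_of_def not_less)
  qed
qed

lemma lin_of_GL: assumes "A \<in> GLm N" shows "lin_of A \<in> GL s"
proof -
  obtain B where "mmul N A B = mone N" "mmul N B A = mone N" using assms by (auto simp: GLm_def)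
  then have "lin_of A (lin_of B v) = v" "lin_of B (lin_of A v) = v" for v by (simp_all add: lin_of_lin_of lin_of_mone)
  then have "bij (lin_of A)" by (intro o_bij[of "lin_of B"]) (auto simp: fun_eq_iff)
  then show ?thesis using lin_of_linear by (simp add: GL_def)
qed

lemma GL_linear: assumes "g \<in> GL s" shows "g (x + y) = g x + g y" "g (s c x) = s c (g x)"
  using assms by (auto simp: GL_def Vector_Spaces.linear_iff)

lemma coord_GL: assumes "g \<in> GL s" "i < N" shows "coord i (g v) = (\<Sum>j<N. mat_of g i j * coord j v)"
proof -
  have "(\<lambda>v. coord i (g v)) \<in> dual_space s"
    by (rule dual_spaceI) (unfold_locales, simp_all add: GL_linear[OF assms(1)]
        dual_add[OF coord_dual] dual_scale[OF coord_dual])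
  from dual_coord[OF this, of v] show ?thesis
    using assms(2) by (simp add: mat_of_def mult.commute)
qed

lemma mat_of_comp: assumes "g \<in> GL s" shows "mat_of (g \<circ> h) = mmul N (mat_of g) (mat_of h)"
proof (intro ext)
  fix i j
  show "mat_of (g \<circ> h) i j = mmul N (mat_of g) (mat_of h) i j"
  proof (cases "i < N \<and> j < N")
    case True
    then show ?thesis by (auto simp: mat_of_def[of "g \<circ> h"] mat_of_def[of h] coord_GL[OF assms] mmul_def)
  next
    case False
    then show ?thesis
      using mat_zero[OF mat_mmul[OF mat_of_mat mat_of_mat], of i j g h] by (auto simp: mat_of_def[of "g \<circ> h"] not_less)
  qed
qed

lemma mat_of_id: "mat_of id = mone N"
  by (intro ext) (auto simp: mat_of_def mone_def coord_basis)

lemma GL_comp: assumes "g \<in> GL s" "h \<in> GL s" shows "g \<circ> h \<in> GL s"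
  using assms Vector_Spaces.linear_compose[of s s h s g] by (auto simp: GL_def bij_comp)

lemma inv_GL: assumes g: "g \<in> GL s" shows "inv g \<in> GL s"
proof -
  have b: "bij g" using g by (simp add: GL_def)
  then have gi: "g (inv g x) = x" "inv g (g x) = x" for x
    by (simp_all add: bij_is_surj surj_f_inv_f bij_is_inj)
  have "inv g (x + y) = inv g x + inv g y" for x y
    using gi(2)[of "inv g x + inv g y"] by (simp add: GL_linear[OF g] gi)
  moreover have "inv g (s c x) = s c (inv g x)" for c x
    using gi(2)[of "s c (inv g x)"] by (simp add: GL_linear[OF g] gi)
  moreover have "vector_space s" by unfold_locales
  ultimately show ?thesis using b by (simp add: GL_def Vector_Spaces.linear_iff bij_imp_bij_inv)
qed

lemma mat_of_GLm: assumes g: "g \<in> GL s" shows "mat_of g \<in> GLm N"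
proof -
  have "bij g" using g by (simp add: GL_def)
  then have "g \<circ> inv g = id" "inv g \<circ> g = id"
    by (simp_all add: fun_eq_iff bij_is_surj surj_f_inv_f bij_is_inj)
  then have "mmul N (mat_of g) (mat_of (inv g)) = mone N" "mmul N (mat_of (inv g)) (mat_of g) = mone N"
    using mat_of_comp[OF g, of "inv g"] mat_of_comp[OF inv_GL[OF g], of g] by (simp_all add: mat_of_id)
  then show ?thesis unfolding GLm_def using mat_of_mat by blast
qed

section \<open>The projection from tensors onto the plethysm\<close>

definition smonom :: "nat list \<Rightarrow> ('v \<Rightarrow> complex) \<Rightarrow> complex" where
  "smonom b = sym_prod s (map ((!) e) b)"

text \<open>The canonical map from tensors of degree \<open>k * d\<close> to S^k(S^d V), given by
  its values at functionals \<open>\<phi>\<close> on S^d V. The value 0 at other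
  \<open>\<phi>\<close> agrees with the convention of \<open>sym_prod\<close>.\<close>

definition pleth :: "nat \<Rightarrow> nat \<Rightarrow> (nat list \<Rightarrow> complex) \<Rightarrow> ((('v \<Rightarrow> complex) \<Rightarrow> complex) \<Rightarrow> complex) \<Rightarrow> complex" where
  "pleth k d f = (\<lambda>\<phi>. if \<phi> \<in> dual_space fscale
     then tsum (words {..<N} d) k (\<lambda>bs. f (concat bs) * prod_list (map (\<lambda>b. \<phi> (smonom b)) bs)) else 0)"

lemma pleth_add: "pleth k d (\<lambda>w. f w + g w) = pleth k d f + pleth k d g"
  by (auto simp: pleth_def fun_eq_iff distrib_right tsum_add)

lemma pleth_scale: "pleth k d (\<lambda>w. c * f w) = fscale c (pleth k d f)"
  by (auto simp: pleth_def fun_eq_iff fscale_def mult.assoc tsum_cmult)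

lemma pleth_diff: "pleth k d (\<lambda>w. f w - g w) = pleth k d f - pleth k d g"
  by (auto simp: pleth_def fun_eq_iff left_diff_distrib tsum_diff)

lemma pleth_zero: "pleth k d (\<lambda>w. 0) = 0"
  by (auto simp: pleth_def fun_eq_iff)

lemma sym_prod_expand:
  "sym_prod s vs = (\<Sum>b\<in>words {..<N} (length vs). fscale (prod_list (map2 (\<lambda>v i. coord i v) vs b)) (smonom b))"
proof
  fix \<eta>
  show "sym_prod s vs \<eta>
    = (\<Sum>b\<in>words {..<N} (length vs). fscale (prod_list (map2 (\<lambda>v i. coord i v) vs b)) (smonom b)) \<eta>"
  proof (cases "\<eta> \<in> dual_space s")
    case True
    have "sym_prod s vs \<eta> = prod_list (map (\<lambda>v. \<Sum>i<N. coord i v * \<eta> (e ! i)) vs)"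
      using True by (simp add: sym_prod_def flip: dual_coord)
    also have "\<dots> = tsum {..<N} (length vs) (\<lambda>b. prod_list (map2 (\<lambda>v i. coord i v) vs b) * prod_list (map (\<lambda>i. \<eta> (e ! i)) b))"
      by (rule prod_list_sum)
    finally show ?thesis
      using True by (simp add: tsum_eq_sum sum_fun_apply fscale_def smonom_def sym_prod_def comp_def)
  next
    case False
    then show ?thesis by (simp add: sum_fun_apply fscale_def smonom_def sym_prod_def)
  qed
qed

lemma dual_sym_prod:
  assumes "\<phi> \<in> dual_space fscale"
  shows "\<phi> (sym_prod s vs) = tsum {..<N} (length vs) (\<lambda>b. prod_list (map2 (\<lambda>v i. coord i v) vs b) * \<phi> (smonom b))"
  by (subst sym_prod_expand) (simp add: dual_lincomb[OF assms] tsum_eq_sum)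

text \<open>The image under \<open>g\<close> of a basis vector is a column of the matrix of
  \<open>g\<close>; this is where the transpose comes from.\<close>

lemma dual_act_smonom:
  assumes "\<phi> \<in> dual_space fscale" "g \<in> GL s" "set b \<subseteq> {..<N}"
  shows "\<phi> (sym_act g (smonom b)) = act N (\<lambda>x y. mat_of g y x) (\<lambda>b. \<phi> (smonom b)) b"
proof -
  have w: "prod_list (map2 (\<lambda>v i. coord i v) (map g (map ((!) e) b)) b') = wprod (\<lambda>x y. mat_of g y x) b b'"
    if "b' \<in> words {..<N} (length b)" for b'
    using that assms(3)
  proof (induction b arbitrary: b')
    case (Cons x b)
    then show ?case by (cases b') (auto simp: words_def mat_of_def)
  qed simp
  have "\<phi> (sym_act g (smonom b)) = \<phi> (sym_prod s (map g (map ((!) e) b)))"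
    by (simp only: smonom_def sym_act_sym_prod[OF assms(2)])
  also have "\<dots> = tsum {..<N} (length b)
      (\<lambda>b'. prod_list (map2 (\<lambda>v i. coord i v) (map g (map ((!) e) b)) b') * \<phi> (smonom b'))"
    using dual_sym_prod[OF assms(1), of "map g (map ((!) e) b)"] by (simp only: length_map)
  also have "\<dots> = tsum {..<N} (length b) (\<lambda>b'. wprod (\<lambda>x y. mat_of g y x) b b' * \<phi> (smonom b'))"
    by (rule tsum_cong) (simp only: w)
  finally show ?thesis by (simp add: act_eq_tsum)
qed

lemma pleth_act:
  assumes g: "g \<in> GL s"
  shows "plethysm_act g (pleth k d f) = pleth k d (act N (mat_of g) f)"
proof
  fix \<phi>
  have dual: "\<phi> \<circ> sym_act g \<in> dual_space fscale \<longleftrightarrow> \<phi> \<in> dual_space fscale"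
    by (rule dual_space_comp_iff[OF sym_act_GL[OF g]])
  show "plethysm_act g (pleth k d f) \<phi> = pleth k d (act N (mat_of g) f) \<phi>"
  proof (cases "\<phi> \<in> dual_space fscale")
    case True
    have "plethysm_act g (pleth k d f) \<phi>
        = tsum (words {..<N} d) k (\<lambda>bs. f (concat bs) * prod_list (map (\<lambda>b. \<phi> (sym_act g (smonom b))) bs))"
      using True dual by (simp add: plethysm_act_def sym_act_def[of "sym_act g"] pleth_def)
    also have "\<dots> = tsum (words {..<N} d) k (\<lambda>bs. f (concat bs)
        * prod_list (map (act N (\<lambda>x y. mat_of g y x) (\<lambda>b. \<phi> (smonom b))) bs))"
    proof (rule tsum_cong)
      fix bs assume "bs \<in> words (words {..<N} d) k"
      then have "map (\<lambda>b. \<phi> (sym_act g (smonom b))) bs = map (act N (\<lambda>x y. mat_of g y x) (\<lambda>b. \<phi> (smonom b))) bs"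
        by (auto simp: words_def intro!: dual_act_smonom[OF True g])
      then show "f (concat bs) * prod_list (map (\<lambda>b. \<phi> (sym_act g (smonom b))) bs)
        = f (concat bs) * prod_list (map (act N (\<lambda>x y. mat_of g y x) (\<lambda>b. \<phi> (smonom b))) bs)"
        by (simp only:)
    qed
    also have "\<dots> = pleth k d (act N (mat_of g) f) \<phi>"
      using True by (simp add: pleth_def act_blocks)
    finally show ?thesis .
  next
    case False
    then show ?thesis using dual by (simp add: plethysm_act_def sym_act_def[of "sym_act g"] pleth_def)
  qed
qed

lemma pleth_eq_sum:
  "pleth k d f = (\<Sum>bs\<in>words (words {..<N} d) k. fscale (f (concat bs)) (sym_prod fscale (map smonom bs)))"
proof
  fix \<phi>
  have "finite (words {..<N} d)" by (simp add: finite_words)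
  then show "pleth k d f \<phi>
      = (\<Sum>bs\<in>words (words {..<N} d) k. fscale (f (concat bs)) (sym_prod fscale (map smonom bs))) \<phi>"
    by (simp add: pleth_def tsum_eq_sum sum_fun_apply fscale_def sym_prod_def comp_def)
qed

lemma pleth_in_plethysm: "pleth k d f \<in> plethysm s k d"
  unfolding pleth_eq_sum plethysm_def sym_power_def
proof (intro fs.span_sum fs.span_scale fs.span_base)
  fix bs assume bs: "bs \<in> words (words {..<N} d) k"
  have "smonom b \<in> fs.span {sym_prod s us |us. length us = d \<and> set us \<subseteq> UNIV}" if "b \<in> set bs" for b
    using that bs by (intro fs.span_base) (auto simp: smonom_def words_def intro!: exI[of _ "map ((!) e) b"])
  then show "sym_prod fscale (map smonom bs) \<in> {sym_prod fscale us |us. length us = k \<and>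
      set us \<subseteq> fs.span {sym_prod s us |us. length us = d \<and> set us \<subseteq> UNIV}}"
    using bs by (auto simp: words_def intro!: exI[of _ "map smonom bs"])
qed

lemma sym_power_coeffs:
  assumes "u \<in> sym_power s d UNIV"
  shows "\<exists>c\<in>tens N d. u = (\<Sum>b\<in>words {..<N} d. fscale (c b) (smonom b))"
  using assms unfolding sym_power_def
proof (induction rule: fs.span_induct_alt)
  case base
  show ?case by (rule bexI[of _ "\<lambda>w. 0"]) (auto simp: tens_def fscale_def fun_eq_iff sum_fun_apply)
next
  case (step x v y)
  then obtain c where c: "c \<in> tens N d" "y = (\<Sum>b\<in>words {..<N} d. fscale (c b) (smonom b))" by blast
  obtain us where us: "v = sym_prod s us" "length us = d" using step by blast
  define c' where "c' b = (if b \<in> words {..<N} d then x * prod_list (map2 (\<lambda>v i. coord i v) us b) + c b else 0)" for b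
  have "c' \<in> tens N d" by (auto simp: c'_def tens_def)
  moreover have "fscale x v + y = (\<Sum>b\<in>words {..<N} d. fscale (c' b) (smonom b))"
    unfolding us(1) c(2) sym_prod_expand[of us] us(2)
    by (auto simp: fun_eq_iff sum_fun_apply fscale_def c'_def sum_distrib_left sum.distrib[symmetric]
        algebra_simps intro!: sum.cong)
  ultimately show ?case by blast
qed

text \<open>Every factor is a combination of monomials; the tensor product of the coefficient
  functions is a preimage.\<close>

lemma sym_prod_in_pleth:
  assumes "length us = k" "set us \<subseteq> sym_power s d UNIV"
  shows "\<exists>f\<in>tens N (k * d). pleth k d f = sym_prod fscale us"
proof -
  have "\<exists>cs. length cs = length us \<and> set cs \<subseteq> tens N d \<and>
      (\<forall>\<phi>\<in>dual_space fscale. map \<phi> us = map (\<lambda>c. \<Sum>b\<in>words {..<N} d. c b * \<phi> (smonom b)) cs)"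
    using assms(2)
  proof (induction us)
    case (Cons u us)
    then obtain cs where cs: "length cs = length us" "set cs \<subseteq> tens N d"
      "\<forall>\<phi>\<in>dual_space fscale. map \<phi> us = map (\<lambda>c. \<Sum>b\<in>words {..<N} d. c b * \<phi> (smonom b)) cs" by auto
    obtain c where c: "c \<in> tens N d" "u = (\<Sum>b\<in>words {..<N} d. fscale (c b) (smonom b))"
      using sym_power_coeffs[of u d] Cons.prems by auto
    have "\<phi> u = (\<Sum>b\<in>words {..<N} d. c b * \<phi> (smonom b))" if "\<phi> \<in> dual_space fscale" for \<phi>
      unfolding c(2) by (rule dual_lincomb[OF that])
    then show ?case using c(1) cs by (intro exI[of _ "c # cs"]) simp
  qed simp
  then obtain cs where cs: "length cs = k" "set cs \<subseteq> tens N d"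
    "\<And>\<phi>. \<phi> \<in> dual_space fscale \<Longrightarrow> map \<phi> us = map (\<lambda>c. \<Sum>b\<in>words {..<N} d. c b * \<phi> (smonom b)) cs"
    using assms(1) by auto
  have sup: "w \<in> words {..<N} d" if "c \<in> set cs" "c w \<noteq> 0" for c w
    using that cs(2) by (auto simp: tens_def)
  have "tprod d cs \<in> tens N (k * d)"
    using tprod_support[of cs "{..<N}" d] sup cs(1) unfolding tens_def by blast
  moreover have "pleth k d (tprod d cs) \<phi> = sym_prod fscale us \<phi>" for \<phi>
  proof (cases "\<phi> \<in> dual_space fscale")
    case True
    have "sym_prod fscale us \<phi> = prod_list (map (\<lambda>c. \<Sum>b\<in>words {..<N} d. c b * \<phi> (smonom b)) cs)"
      using True cs(3) by (simp add: sym_prod_def)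
    also have "\<dots> = tsum (words {..<N} d) k (\<lambda>bs. prod_list (map2 (\<lambda>c b. c b) cs bs) * prod_list (map (\<lambda>b. \<phi> (smonom b)) bs))"
      unfolding cs(1)[symmetric] by (rule prod_list_sum)
    also have "\<dots> = tsum (words {..<N} d) k (\<lambda>bs. tprod d cs (concat bs) * prod_list (map (\<lambda>b. \<phi> (smonom b)) bs))"
      by (rule tsum_cong, subst tprod_concat) (auto simp: words_def cs(1))
    finally show ?thesis using True by (simp add: pleth_def)
  qed (simp add: pleth_def sym_prod_def)
  ultimately show ?thesis by blast
qed

lemma pleth_surj:
  assumes "\<Phi> \<in> plethysm s k d"
  shows "\<exists>f\<in>tens N (k * d). pleth k d f = \<Phi>"
  using assms unfolding plethysm_def sym_power_def[of fscale]
proof (induction rule: fs.span_induct_alt)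
  case base
  show ?case by (rule bexI[of _ "\<lambda>w. 0"]) (auto simp: tens_def pleth_zero)
next
  case (step c x y)
  obtain f g where f: "f \<in> tens N (k * d)" "pleth k d f = x" and g: "g \<in> tens N (k * d)" "pleth k d g = y"
    using step sym_prod_in_pleth by blast
  have "(\<lambda>w. c * f w + g w) \<in> tens N (k * d)" using f(1) g(1) by (rule tens_comb)
  moreover have "pleth k d (\<lambda>w. c * f w + g w) = fscale c x + y"
    using f g by (simp add: pleth_add pleth_scale)
  ultimately show ?case by blast
qed

end

subsection \<open>Cyclic modules of highest weight tensors are irreducible\<close>

text \<open>Turns invariance under unipotent matrices into annihilation by raising operators. All
  letters are even here, so \<open>sop\<close> carries no signs and is the ordinary Lie algebra
  action.\<close>

lemma act_mono_deriv:
  assumes "\<alpha> < N" "\<beta> < N" "set w \<subseteq> {..<N}"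
  shows "((\<lambda>t. act N (\<lambda>x y. mone N x y + (if x = \<alpha> \<and> y = \<beta> then t else 0)) f w)
    has_field_derivative sop N \<alpha> \<beta> f w) (at 0)"
  using assms(3)
proof (induction w arbitrary: f)
  case (Cons x w)
  let ?g = "\<lambda>t x y. mone N x y + (if x = \<alpha> \<and> y = \<beta> then t else 0)"
  have g0: "?g 0 = mone N" by auto
  have a0: "act N (?g 0) (\<lambda>w. f (y # w)) w = f (y # w)" for y
    unfolding g0 using Cons.prems by (intro act_mone) simp
  have "((\<lambda>t. \<Sum>y<N. ?g t x y * act N (?g t) (\<lambda>w. f (y # w)) w) has_field_derivative
      (\<Sum>y<N. (if x = \<alpha> \<and> y = \<beta> then 1 else 0) * act N (?g 0) (\<lambda>w. f (y # w)) w
        + sop N \<alpha> \<beta> (\<lambda>w. f (y # w)) w * ?g 0 x y)) (at 0)"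
  proof (intro DERIV_sum DERIV_mult)
    fix y
    show "((\<lambda>t. ?g t x y) has_field_derivative (if x = \<alpha> \<and> y = \<beta> then 1 else 0)) (at 0)"
      by (auto intro!: derivative_eq_intros)
    show "((\<lambda>t. act N (?g t) (\<lambda>w. f (y # w)) w) has_field_derivative sop N \<alpha> \<beta> (\<lambda>w. f (y # w)) w) (at 0)"
      using Cons by simp
  qed
  also have "(\<Sum>y<N. (if x = \<alpha> \<and> y = \<beta> then 1 else 0) * act N (?g 0) (\<lambda>w. f (y # w)) w
        + sop N \<alpha> \<beta> (\<lambda>w. f (y # w)) w * ?g 0 x y)
      = (\<Sum>y<N. if y = \<beta> then (if x = \<alpha> then f (\<beta> # w) else 0) else 0)
        + (\<Sum>y<N. if y = x then sop N \<alpha> \<beta> (\<lambda>w. f (x # w)) w else 0)"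
    unfolding a0 sum.distrib[symmetric] using Cons.prems by (intro sum.cong refl) (auto simp: mone_def)
  also have "\<dots> = sop N \<alpha> \<beta> f (x # w)"
    using assms(1,2) Cons.prems by simp
  finally show ?case by simp
qed simp

lemma act_continuous:
  "(\<And>x y. isCont (\<lambda>t. g t x y) a) \<Longrightarrow> isCont (\<lambda>t. act N (g t) f w) a"
  for g :: "complex \<Rightarrow> nat \<Rightarrow> nat \<Rightarrow> complex"
  by (induction w arbitrary: f) auto

lemma herm_continuous:
  assumes "\<And>w. isCont (\<lambda>t. F t w) (a :: complex)" shows "isCont (\<lambda>t. herm N n (F t) h) a"
  unfolding herm_def tsum_eq_sum[OF finite_lessThan] by (intro continuous_intros assms)

section \<open>Diagonal and elimination matrices\<close>

definition mdiag :: "nat \<Rightarrow> (nat \<Rightarrow> complex) \<Rightarrow> nat \<Rightarrow> nat \<Rightarrow> complex" where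
  "mdiag N z = (\<lambda>x y. if x = y \<and> x < N then z x else 0)"

lemma act_mdiag: "set w \<subseteq> {..<N} \<Longrightarrow> act N (mdiag N z) f w = prod_list (map z w) * f w"
proof (induction w arbitrary: f)
  case (Cons x w)
  have "act N (mdiag N z) f (x # w) = (\<Sum>y<N. (if y = x then z x * (prod_list (map z w) * f (x # w)) else 0))"
    unfolding act.simps by (rule sum.cong) (use Cons in \<open>auto simp: mdiag_def\<close>)
  then show ?case using Cons.prems by simp
qed simp

lemma mdiag_mat: "mdiag N z \<in> mat N"
  by (auto simp: mdiag_def mat_def split: if_splits)

lemma mmul_mdiag: "mmul N (mdiag N z) (mdiag N z') = mdiag N (\<lambda>x. z x * z' x)"
proof (intro ext)
  fix i j
  have "mmul N (mdiag N z) (mdiag N z') i j = (\<Sum>k<N. if k = i then z i * mdiag N z' i j else 0)"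
    unfolding mmul_def by (rule sum.cong) (auto simp: mdiag_def)
  then show "mmul N (mdiag N z) (mdiag N z') i j = mdiag N (\<lambda>x. z x * z' x) i j"
    by (auto simp: mdiag_def)
qed

lemma mdiag_GLm: assumes "\<And>i. z i \<noteq> 0" shows "mdiag N z \<in> GLm N"
proof -
  have "mdiag N (\<lambda>x. 1) = mone N" by (auto simp: mdiag_def mone_def)
  then show ?thesis unfolding GLm_def using mdiag_mat assms
    by (auto intro!: bexI[of _ "mdiag N (\<lambda>i. inverse (z i))"] simp: mmul_mdiag)
qed

text \<open>An elimination matrix: multiplication from the right clears row \<open>r\<close> beyond
  the pivot, multiplication by its conjugate transpose from the left clears column
  \<open>r\<close>.\<close>

definition mrow :: "nat \<Rightarrow> nat \<Rightarrow> (nat \<Rightarrow> complex) \<Rightarrow> nat \<Rightarrow> nat \<Rightarrow> complex" where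
  "mrow N r c = (\<lambda>x y. mone N x y + (if x = r \<and> r < y \<and> y < N then c y else 0))"

lemma mrow_unitri: "r < N \<Longrightarrow> unitri N (mrow N r c)"
  by (auto simp: mrow_def unitri_def mat_def mone_def split: if_splits)

lemma mmul_mrow_right:
  assumes "h \<in> mat N" "r < N"
  shows "mmul N h (mrow N r c) i j = h i j + (if r < j \<and> j < N then h i r * c j else 0)"
proof -
  have "mmul N h (mrow N r c) i j
      = (\<Sum>k<N. (if k = j then h i j else 0)) + (\<Sum>k<N. (if k = r then (if r < j \<and> j < N then h i r * c j else 0) else 0))"
    unfolding mmul_def sum.distrib[symmetric]
    by (rule sum.cong) (auto simp: mrow_def mone_def distrib_left)
  then show ?thesis using assms mat_zero[OF assms(1), of i j] by auto
qed

lemma madj_mmul: "madj (mmul N g h) = mmul N (madj h) (madj g)"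
  by (auto simp: madj_def mmul_def mult.commute)

lemma madj_madj [simp]: "madj (madj g) = g"
  by (simp add: madj_def)

lemma madj_mat: "g \<in> mat N \<Longrightarrow> madj g \<in> mat N"
  unfolding mat_def madj_def by auto

lemma madj_mone: "madj (mone N) = mone N"
  by (intro ext) (auto simp: madj_def mone_def)

lemma madj_GLm: "g \<in> GLm N \<Longrightarrow> madj g \<in> GLm N"
proof -
  assume "g \<in> GLm N"
  then obtain h where h: "g \<in> mat N" "h \<in> mat N" "mmul N g h = mone N" "mmul N h g = mone N"
    unfolding GLm_def by blast
  then have "mmul N (madj h) (madj g) = mone N" "mmul N (madj g) (madj h) = mone N"
    by (simp_all add: madj_mmul[symmetric] madj_mone)
  then show ?thesis using h madj_mat unfolding GLm_def by blast
qed

lemma mmul_mrow_left: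
  assumes "h \<in> mat N" "r < N"
  shows "mmul N (madj (mrow N r c)) h i j = h i j + (if r < i \<and> i < N then cnj (c i) * h r j else 0)"
proof -
  have "mmul N (madj (mrow N r c)) h i j = madj (mmul N (madj h) (mrow N r c)) i j"
    by (simp add: madj_mmul)
  also have "\<dots> = h i j + (if r < i \<and> i < N then cnj (c i) * h r j else 0)"
    by (simp add: madj_def[of "mmul _ _ _"] mmul_mrow_right[OF madj_mat[OF assms(1)] assms(2)])
      (simp add: madj_def mult.commute)
  finally show ?thesis .
qed

lemma mrow_GLm:
  assumes "r < N" shows "mrow N r c \<in> GLm N"
proof -
  have inv: "mmul N (mrow N r c) (mrow N r c') = mone N" if "\<And>j. c' j = - c j" for c c'
  proof (intro ext)
    fix i j
    have "mrow N r c \<in> mat N" using mrow_unitri[OF assms] by (simp add: unitri_def)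
    from mmul_mrow_right[OF this assms, of c' i j]
    show "mmul N (mrow N r c) (mrow N r c') i j = mone N i j"
      using assms that by (auto simp: mrow_def mone_def)
  qed
  have "mrow N r c' \<in> mat N" for c' using mrow_unitri[OF assms] by (simp add: unitri_def)
  then show ?thesis
    unfolding GLm_def using inv[of "\<lambda>j. - c j" c] inv[of c "\<lambda>j. - c j"] by fastforce
qed

text \<open>The big cell argument: generic matrices reduce to diagonal ones by elimination with row operations
  that fix \<open>v\<close> (from the right) and \<open>x\<close> (from the left); the others follow by continuity.\<close>

lemma big_cell:
  assumes v: "\<And>r c. r < N \<Longrightarrow> act N (mrow N r c) v = v" and x: "\<And>r c. r < N \<Longrightarrow> act N (mrow N r c) x = x"
    and vT: "v \<in> tens N n" and cont: "\<And>w. v w \<noteq> 0 \<Longrightarrow> mset w = C"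
    and orth: "herm N n v x = 0" and "g \<in> mat N"
  shows "herm N n (act N g v) x = 0"
proof -
  define P where "P g = herm N n (act N g v) x" for g
  have diag: "P g = 0" if "g \<in> mat N" "\<And>i j. i \<noteq> j \<Longrightarrow> g i j = 0" for g
  proof -
    have "g = mdiag N (\<lambda>i. g i i)"
      using that mat_zero[OF that(1)] by (auto simp: mdiag_def fun_eq_iff not_less)
    then obtain z where g: "g = mdiag N z" by blast
    have "act N g v w = prod_mset (image_mset z C) * v w" for w
    proof (cases "v w = 0")
      case False
      then have "set w \<subseteq> {..<N}" using vT by (auto simp: tens_def words_def)
      then have "act N g v w = prod_list (map z w) * v w" unfolding g by (rule act_mdiag)
      also have "prod_list (map z w) = prod_mset (image_mset z (mset w))"
        by (simp flip: prod_mset_prod_list mset_map)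
      finally show ?thesis using cont[OF False] by simp
    next
      case True
      show ?thesis
      proof (cases "set w \<subseteq> {..<N}")
        case True
        then show ?thesis unfolding g using \<open>v w = 0\<close> by (simp add: act_mdiag)
      next
        case False
        then have "act N g v w = 0" using act_nonzero[OF that(1), of v w] by blast
        then show ?thesis using \<open>v w = 0\<close> by simp
      qed
    qed
    then have "act N g v = (\<lambda>w. prod_mset (image_mset z C) * v w)" by auto
    then show ?thesis using orth by (simp add: P_def herm_cmult_left)
  qed
  \<comment> \<open>The number \<open>m\<close> is the size of the lower right block that may still
    differ from a diagonal one.\<close>
  have "P g = 0" if "g \<in> mat N" "\<And>i j. i \<noteq> j \<Longrightarrow> i < N - m \<or> j < N - m \<Longrightarrow> g i j = 0" "m \<le> N" for g m
    using that
  proof (induction m arbitrary: g)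
    case 0
    have "g i j = 0" if "i \<noteq> j" for i j
      using 0(2)[OF that] mat_zero[OF 0(1), of i j] by fastforce
    then show ?case using diag 0 by blast
  next
    case (Suc m)
    define r where "r = N - Suc m"
    have r: "r < N" "Suc r = N - m" using Suc.prems(3) by (auto simp: r_def)
    have pivot: "P g = 0" if g: "g \<in> mat N" "\<And>i j. i \<noteq> j \<Longrightarrow> i < r \<or> j < r \<Longrightarrow> g i j = 0"
      and nz: "g r r \<noteq> 0" for g
    proof -
      \<comment> \<open>\<open>c1\<close> clears column \<open>r\<close> and \<open>c2\<close>
        clears row \<open>r\<close> by means of the pivot; the conjugation in \<open>c1\<close>
        cancels the one in \<open>madj\<close>.\<close>
      define c1 where "c1 i = - cnj (g i r / g r r)" for i
      define c2 where "c2 j = - g r j / g r r" for j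
      define h where "h = mmul N g (mrow N r c2)"
      define g' where "g' = mmul N (madj (mrow N r c1)) h"
      have mr: "mrow N r c \<in> mat N" for c using mrow_unitri[OF r(1)] by (simp add: unitri_def)
      have hm: "h \<in> mat N" unfolding h_def using g(1) mr by (rule mat_mmul)
      have g'm: "g' \<in> mat N" unfolding g'_def using hm mr madj_mat mat_mmul by blast
      have h: "h i j = g i j + (if r < j \<and> j < N then g i r * c2 j else 0)" for i j
        unfolding h_def by (rule mmul_mrow_right[OF g(1) r(1)])
      have g': "g' i j = h i j + (if r < i \<and> i < N then cnj (c1 i) * h r j else 0)" for i j
        unfolding g'_def by (rule mmul_mrow_left[OF hm r(1)])
      have "P g' = 0"
      proof (rule Suc.IH[OF g'm])
        fix i j assume ij: "i \<noteq> j" "i < N - m \<or> j < N - m"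
        have hr: "h r j = (if j = r then g r r else 0)" for j
          using g(2)[of r j] nz mat_zero[OF g(1), of r j]
          by (cases "j < r"; cases "j = r"; cases "j < N") (auto simp: h c2_def)
        show "g' i j = 0"
        proof (cases "i < N \<and> j < N")
          case True
          have "i \<le> r \<or> j \<le> r" using ij r(2) by auto
          then consider "i < r" | "i = r" | "r < i" "j < r" | "r < i" "j = r"
            by linarith
          then show ?thesis
          proof cases
            case 1
            then show ?thesis using g(2)[of i j] g(2)[of i r] ij by (simp add: g' h)
          next
            case 2
            then show ?thesis using hr[of j] ij by (simp add: g')
          next
            case 3
            then show ?thesis using g(2)[of i j] hr[of j] ij by (simp add: g' h)
          next
            case 4
            then show ?thesis using hr[of j] nz True by (simp add: g' h c1_def)
          qed
        next
          case False
          then show ?thesis using mat_zero[OF g'm, of i j] by auto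
        qed
      qed (use Suc.prems in simp)
      moreover have "act N g' v = act N (madj (mrow N r c1)) (act N g v)"
        by (intro ext) (simp add: g'_def h_def act_act[symmetric] v[OF r(1)] act_act[symmetric, abs_def])
      ultimately show ?thesis
        unfolding P_def by (simp add: herm_adj x[OF r(1)])
    qed
    show ?case
    proof (cases "g r r = 0")
      case False
      then show ?thesis using pivot Suc.prems by (simp add: r_def)
    next
      case True
      \<comment> \<open>A zero pivot is replaced by \<open>t\<close>. Then \<open>P\<close> vanishes
        for all \<open>t\<close> other than 0, and by continuity also for 0.\<close>
      define gt where "gt t = (\<lambda>i j. g i j + (if i = r \<and> j = r then t else 0))" for t :: complex
      have gtm: "gt t \<in> mat N" for t
        unfolding mat_def
      proof (intro CollectI allI impI)
        fix i j assume "gt t i j \<noteq> 0"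
        then have "g i j \<noteq> 0 \<or> i = r \<and> j = r" by (auto simp: gt_def split: if_splits)
        then show "i < N \<and> j < N" using mat_zero[OF Suc.prems(1), of i j] r(1) by fastforce
      qed
      have nz: "P (gt t) = 0" if "t \<noteq> 0" for t
      proof (rule pivot[OF gtm])
        show "gt t i j = 0" if "i \<noteq> j" "i < r \<or> j < r" for i j
          using Suc.prems(2)[OF that(1)] that by (auto simp: gt_def r_def)
        show "gt t r r \<noteq> 0" using True that by (simp add: gt_def)
      qed
      have "isCont (\<lambda>t. gt t i j) 0" for i j
        unfolding gt_def by (cases "i = r \<and> j = r") auto
      then have "isCont (\<lambda>t. P (gt t)) 0"
        unfolding P_def by (intro herm_continuous act_continuous)
      then have "((\<lambda>t. P (gt t)) \<longlongrightarrow> P (gt 0)) (at 0)" by (simp add: isCont_def)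
      moreover have "((\<lambda>t. P (gt t)) \<longlongrightarrow> 0) (at 0)"
        by (rule tendsto_eventually) (auto simp: eventually_at nz intro!: exI[of _ 1])
      ultimately have "P (gt 0) = 0" using tendsto_unique[of "at (0::complex)"] by fastforce
      moreover have "gt 0 = g" by (auto simp: gt_def)
      ultimately show ?thesis by simp
    qed
  qed
  from this[of g N] assms(6) show ?thesis by (simp add: P_def)
qed

section \<open>Orthogonal projection\<close>

lemma tens_subspace: "fs.subspace (tens N n)"
  unfolding fs.subspace_def
proof (intro conjI ballI allI)
  show "0 \<in> tens N n" by (simp add: tens_def)
next
  fix f g c assume "f \<in> tens N n"
  then show "g \<in> tens N n \<Longrightarrow> f + g \<in> tens N n"
    using tens_comb[of f N n g 1] by (simp add: plus_fun_def)
  have "(\<lambda>w. 0) \<in> tens N n" by (simp add: tens_def)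
  from tens_comb[OF \<open>f \<in> tens N n\<close> this, of c] show "fscale c f \<in> tens N n" by (simp add: fscale_def)
qed

text \<open>A Gram-Schmidt step: \<open>b'\<close> is \<open>b\<close> made orthogonal to the span
  of \<open>B\<close>, and the projection is corrected by a multiple of \<open>b'\<close>.\<close>

lemma orth_span:
  assumes "finite B" "B \<subseteq> tens N n" "f \<in> tens N n"
  shows "\<exists>p\<in>fs.span B. \<forall>q\<in>fs.span B. herm N n q (\<lambda>w. f w - p w) = 0"
  using assms
proof (induction B arbitrary: f)
  case empty
  show ?case by (rule bexI[of _ 0]) (auto simp: herm_def zero_fun_def)
next
  case (insert b B)
  have sub: "fs.span B \<subseteq> tens N n"
    using insert.prems(1) by (intro fs.span_minimal tens_subspace) auto
  obtain p where p: "p \<in> fs.span B" "\<forall>q\<in>fs.span B. herm N n q (\<lambda>w. f w - p w) = 0"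
    using insert.IH[of f] insert.prems by auto
  obtain pb where pb: "pb \<in> fs.span B" "\<forall>q\<in>fs.span B. herm N n q (\<lambda>w. b w - pb w) = 0"
    using insert.IH[of b] insert.prems by auto
  define b' where "b' = (\<lambda>w. b w - pb w)"
  have b'f: "b' = b - pb" by (auto simp: b'_def)
  have b'T: "b' \<in> tens N n"
    unfolding b'f using insert.prems(1) pb(1) sub by (intro fs.subspace_diff[OF tens_subspace]) auto
  \<comment> \<open>The conjugate is there because \<open>herm\<close> is conjugate-linear in its
    second argument. If the norm of \<open>b'\<close> is zero, the quotient is 0 by convention and
    \<open>b'\<close> itself is zero.\<close>
  define c where "c = cnj (herm N n b' (\<lambda>w. f w - p w) / herm N n b' b')"
  define p' where "p' = (\<lambda>w. p w + c * b' w)"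
  have p'f: "p' = p + fscale c (b - pb)" by (auto simp: p'_def b'_def fscale_def)
  have "p' \<in> fs.span (insert b B)"
    unfolding p'f using p(1) pb(1) fs.span_mono[of B "insert b B"]
    by (intro fs.span_add fs.span_scale fs.span_diff) (auto intro: fs.span_base)
  moreover have "herm N n q (\<lambda>w. f w - p' w) = 0" if q: "q \<in> fs.span (insert b B)" for q
  proof -
    obtain k where k: "q - fscale k b \<in> fs.span B" using q fs.span_breakdown_eq by blast
    define q0 where "q0 = q - fscale k b + fscale k pb"
    have q0: "q0 \<in> fs.span B" unfolding q0_def using k pb(1) by (intro fs.span_add fs.span_scale)
    have qe: "q = (\<lambda>w. q0 w + k * b' w)" by (auto simp: q0_def b'_def fscale_def algebra_simps)
    have fp: "(\<lambda>w. f w - p' w) = (\<lambda>w. (f w - p w) - c * b' w)" by (auto simp: p'_def)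
    have 1: "herm N n q0 (\<lambda>w. f w - p' w) = 0"
      unfolding fp using p(2) pb(2) q0 herm_diff_right[of N n q0 "\<lambda>w. f w - p w" "\<lambda>w. c * b' w"]
      by (simp add: herm_cmult_right b'_def)
    have 2: "herm N n b' (\<lambda>w. f w - p' w) = 0"
    proof (cases "herm N n b' b' = 0")
      case True
      then show ?thesis using herm_self_zero[OF b'T] by (simp add: herm_def)
    next
      case False
      have "herm N n b' (\<lambda>w. f w - p' w) = herm N n b' (\<lambda>w. f w - p w) - cnj c * herm N n b' b'"
        unfolding fp using herm_diff_right[of N n b' "\<lambda>w. f w - p w" "\<lambda>w. c * b' w"]
        by (simp add: herm_cmult_right)
      then show ?thesis using False by (simp add: c_def)
    qed
    have "herm N n q (\<lambda>w. f w - p' w) = herm N n q0 (\<lambda>w. f w - p' w) + k * herm N n b' (\<lambda>w. f w - p' w)"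
      unfolding qe herm_add_left herm_cmult_left ..
    then show ?thesis using 1 2 by simp
  qed
  ultimately show ?case by blast
qed

lemma tens_span_deltas: "tens N n \<subseteq> fs.span ((\<lambda>u w. if w = u then 1 else 0) ` words {..<N} n)"
proof
  fix f assume f: "f \<in> tens N n"
  let ?\<delta> = "\<lambda>u w. if w = u then 1 else 0 :: complex"
  have "f = (\<Sum>u\<in>words {..<N} n. fscale (f u) (?\<delta> u))"
  proof
    fix w
    have fin: "finite (words {..<N} n)" by (simp add: finite_words)
    have "(\<Sum>u\<in>words {..<N} n. fscale (f u) (?\<delta> u)) w = (\<Sum>u\<in>words {..<N} n. if u = w then f w else 0)"
      unfolding sum_fun_apply fscale_def by (rule sum.cong) auto
    then show "f w = (\<Sum>u\<in>words {..<N} n. fscale (f u) (?\<delta> u)) w"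
      using fin f by (auto simp: tens_def)
  qed
  then show "f \<in> fs.span (?\<delta> ` words {..<N} n)"
    by (metis (no_types, lifting) fs.span_sum fs.span_scale fs.span_base imageI)
qed

lemma orth_projection:
  assumes S: "fs.subspace S" "S \<subseteq> tens N n" and f: "f \<in> tens N n"
  shows "\<exists>p\<in>S. \<forall>q\<in>S. herm N n q (\<lambda>w. f w - p w) = 0"
proof -
  let ?D = "(\<lambda>u w. if w = u then 1 else 0 :: complex) ` words {..<N} n"
  obtain B where B: "B \<subseteq> S" "fs.independent B" "S \<subseteq> fs.span B"
    using fs.basis_exists[of S] by metis
  have fin: "finite ?D" by (simp add: finite_words)
  have "B \<subseteq> tens N n" using B(1) S(2) by (rule order_trans)
  then have "B \<subseteq> fs.span ?D" using tens_span_deltas by (rule order_trans)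
  then have "finite B" using fs.independent_span_bound[OF fin B(2)] by simp
  have "fs.span B = S" using fs.span_minimal[OF B(1) S(1)] B(3) by (rule subset_antisym)
  then show ?thesis using orth_span[OF \<open>finite B\<close> \<open>B \<subseteq> tens N n\<close> f] by simp
qed

lemma act_diff: "act N g (\<lambda>w. f w - h w) w = act N g f w - act N g h w"
  using act_add[of N g f "\<lambda>w. (- 1) * h w" w] act_cmult[of N g "- 1" h w] by simp

lemma GLm_mat: "GLm N \<subseteq> mat N"
  by (auto simp: GLm_def)

lemma mone_GLm: "mone N \<in> GLm N"
proof -
  have "mdiag N (\<lambda>i. 1) = mone N" by (intro ext) (auto simp: mdiag_def mone_def)
  with mdiag_GLm[of "\<lambda>i. 1" N] show ?thesis by simp
qed

lemma herm_perp_subspace: "fs.subspace {q. herm N n q x = 0}"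
  unfolding fs.subspace_def
  using herm_add_left[of N n] herm_cmult_left[of N n]
  by (auto simp: plus_fun_def fscale_def zero_fun_def herm_def[of _ _ "\<lambda>w. 0"])

text \<open>The projection \<open>p\<close> of \<open>v\<close> to \<open>S\<close> is again fixed
  by the matrices \<open>mrow\<close>. By \<open>big_cell\<close> the part \<open>x\<close> of
  \<open>p\<close> orthogonal to \<open>v\<close> is orthogonal to all translates of
  \<open>v\<close>, hence to itself. So \<open>p\<close> is a multiple of \<open>v\<close>: if it is
  zero, \<open>S\<close> is orthogonal to the whole module that contains it, and otherwise
  \<open>S\<close> contains \<open>v\<close>.\<close>

lemma cyclic_module_irreducible:
  assumes v: "\<And>r c. r < N \<Longrightarrow> act N (mrow N r c) v = v" "v \<in> tens N n" "v \<noteq> (\<lambda>w. 0)"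
    and cont: "\<And>w. v w \<noteq> 0 \<Longrightarrow> mset w = C"
    and S: "fs.subspace S" "S \<subseteq> fs.span ((\<lambda>A. act N A v) ` GLm N)"
      "\<And>A f. A \<in> GLm N \<Longrightarrow> f \<in> S \<Longrightarrow> act N A f \<in> S"
  shows "S = {0} \<or> S = fs.span ((\<lambda>A. act N A v) ` GLm N)"
proof -
  define M where "M = fs.span ((\<lambda>A. act N A v) ` GLm N)"
  have MT: "M \<subseteq> tens N n"
    unfolding M_def using v(2) GLm_mat[of N] by (intro fs.span_minimal tens_subspace) (auto intro: act_tens)
  have ST: "S \<subseteq> tens N n" using S(2) MT unfolding M_def by (rule order_trans)
  have perp: "herm N n q x = 0" if "q \<in> M" "\<And>A. A \<in> GLm N \<Longrightarrow> herm N n (act N A v) x = 0" for q x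
  proof -
    have "M \<subseteq> {q. herm N n q x = 0}"
      unfolding M_def by (intro fs.span_minimal herm_perp_subspace) (use that(2) in auto)
    then show ?thesis using that(1) by blast
  qed
  have adj: "herm N n q (act N A x) = herm N n (act N (madj A) q) x" for q A x
    by (simp add: herm_adj)
  obtain p where p: "p \<in> S" "\<And>q. q \<in> S \<Longrightarrow> herm N n q (\<lambda>w. v w - p w) = 0"
    using orth_projection[OF S(1) ST v(2)] by blast
  have pfix: "act N (mrow N r c) p = p" if r: "r < N" for r c
  proof -
    let ?A = "mrow N r c"
    \<comment> \<open>The failure of \<open>p\<close> to be fixed. It lies in \<open>S\<close>,
      while the translate of \<open>v - p\<close> stays orthogonal to \<open>S\<close>, because
      \<open>S\<close> is stable under the adjoint; comparing the two makes the norm of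
      \<open>D\<close> zero.\<close>
    define D where "D = (\<lambda>w. act N ?A p w - p w)"
    have "D \<in> S"
      using fs.subspace_diff[OF S(1) S(3)[OF mrow_GLm[OF r] p(1)] p(1)] by (simp add: D_def fun_diff_def)
    have "herm N n D (act N ?A (\<lambda>w. v w - p w)) = 0"
      unfolding adj by (intro p(2) S(3) madj_GLm mrow_GLm r \<open>D \<in> S\<close>)
    moreover have "act N ?A (\<lambda>w. v w - p w) = (\<lambda>w. (v w - p w) - D w)"
      by (rule ext) (simp add: act_diff v(1)[OF r] D_def)
    ultimately have "herm N n D (\<lambda>w. v w - p w) - herm N n D D = 0"
      using herm_diff_right[of N n D "\<lambda>w. v w - p w" D] by simp
    then have "herm N n D D = 0" using p(2)[OF \<open>D \<in> S\<close>] by simp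
    then have "D = (\<lambda>w. 0)" using herm_self_zero \<open>D \<in> S\<close> ST by blast
    then show ?thesis by (auto simp: D_def fun_eq_iff)
  qed
  have nz: "herm N n v v \<noteq> 0" using herm_self_zero[OF v(2)] v(3) by blast
  define c where "c = herm N n p v / herm N n v v"
  define x where "x = (\<lambda>w. p w - c * v w)"
  have vM: "v \<in> M"
    unfolding M_def using act_mone_tens[OF v(2)] mone_GLm by (metis fs.span_base imageI)
  have xM: "x \<in> M"
  proof -
    have "p - fscale c v \<in> M"
      using p(1) S(2) vM unfolding M_def by (intro fs.span_diff fs.span_scale) auto
    then show ?thesis by (simp add: x_def fscale_def fun_diff_def)
  qed
  have "herm N n v x = 0"
  proof -
    have "herm N n x v = 0"
      unfolding x_def herm_diff_left herm_cmult_left using nz by (simp add: c_def)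
    then show ?thesis using herm_cnj[of N n v x] by simp
  qed
  moreover have "act N (mrow N r c') x = x" if "r < N" for r c'
    unfolding x_def by (rule ext) (simp add: act_diff act_cmult v(1)[OF that] pfix[OF that])
  ultimately have "herm N n (act N A v) x = 0" if "A \<in> GLm N" for A
    using big_cell[OF v(1) _ v(2) cont] that GLm_mat by blast
  then have "herm N n x x = 0" by (rule perp[OF xM])
  then have "x = (\<lambda>w. 0)" using herm_self_zero xM MT by blast
  then have pc: "p w = c * v w" for w by (auto simp: x_def fun_eq_iff)
  show ?thesis
  proof (cases "c = 0")
    case True
    have "q = 0" if q: "q \<in> S" for q
    proof -
      have "herm N n (act N A v) q = 0" if "A \<in> GLm N" for A
      proof -
        have "herm N n (act N (madj A) q) (\<lambda>w. v w - p w) = 0"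
          using p(2) S(3) madj_GLm that q by blast
        then have "herm N n q (act N A v) = 0" using True pc by (simp add: adj)
        then show ?thesis using herm_cnj[of N n "act N A v" q] by simp
      qed
      then have "herm N n q q = 0" using perp[of q q] q S(2) unfolding M_def by blast
      then show ?thesis using herm_self_zero q ST by (auto simp: zero_fun_def)
    qed
    then show ?thesis using fs.subspace_0[OF S(1)] by blast
  next
    case False
    have "v = fscale (1 / c) p" using False pc by (auto simp: fscale_def)
    then have "v \<in> S" using fs.subspace_scale[OF S(1) p(1)] by simp
    then have "M \<subseteq> S" unfolding M_def using S(3) by (intro fs.span_minimal S(1)) auto
    then show ?thesis using S(2) unfolding M_def by blast
  qed
qed

section \<open>Invariant tensors and the kernel of the projection\<close>

context gl_basis
begin

text \<open>Separation in two layers: functionals on V detect symmetric functions of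
  \<open>d\<close> letters, and functionals on S^d V detect symmetric functions of \<open>k\<close>
  blocks. In each layer \<open>polarization\<close> leads from powers to products and
  \<open>slots_zero\<close> to coefficients.\<close>

lemma pleth_inj:
  assumes f: "f \<in> tens N (k * d)" "einv d f" and zero: "pleth k d f = 0"
  shows "f = (\<lambda>w. 0)"
proof -
  let ?X = "words {..<N} d"
  have finX: "finite ?X" by (simp add: finite_words)
  define A where "A = {(\<lambda>b. \<phi> (smonom b)) | \<phi>. \<phi> \<in> dual_space fscale}"
  define A' where "A' = {(\<lambda>i. \<eta> (e ! i)) | \<eta>. \<eta> \<in> dual_space s}"
  define C where "C = {g :: nat list \<Rightarrow> complex. \<forall>p x y q. p @ x # y # q \<in> ?X \<longrightarrow> g (p @ x # y # q) = g (p @ y # x # q)}"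
  \<comment> \<open>Evaluation at \<open>\<eta>\<close> is a functional on S^d V, so
    \<open>A\<close> contains the powers of linear forms on which the inner layer is tested.\<close>
  have AI: "(\<lambda>b. prod_list (map (\<lambda>i. \<eta> (e ! i)) b)) \<in> A" if "\<eta> \<in> dual_space s" for \<eta>
  proof -
    have "(\<lambda>b. prod_list (map (\<lambda>i. \<eta> (e ! i)) b)) = (\<lambda>b. (\<lambda>F. F \<eta>) (smonom b))"
      using that by (simp add: smonom_def sym_prod_def comp_def)
    then show ?thesis unfolding A_def
      by (intro CollectI exI[of _ "\<lambda>F. F \<eta>"] conjI eval_dual)
  qed
  have closedA: "(\<lambda>x. \<phi> x + c * \<psi> x) \<in> A" if ps: "\<phi> \<in> A" "\<psi> \<in> A" for \<phi> \<psi> c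
  proof -
    obtain \<phi>' \<psi>' where "\<phi>' \<in> dual_space fscale" "\<psi>' \<in> dual_space fscale"
      "\<phi> = (\<lambda>b. \<phi>' (smonom b))" "\<psi> = (\<lambda>b. \<psi>' (smonom b))" using ps unfolding A_def by blast
    then show ?thesis unfolding A_def
      by (intro CollectI exI[of _ "\<lambda>x. \<phi>' x + c * \<psi>' x"]) (simp add: dual_combine)
  qed
  have closedA': "(\<lambda>x. \<phi> x + c * \<psi> x) \<in> A'" if ps: "\<phi> \<in> A'" "\<psi> \<in> A'" for \<phi> \<psi> c
  proof -
    obtain \<phi>' \<psi>' where "\<phi>' \<in> dual_space s" "\<psi>' \<in> dual_space s"
      "\<phi> = (\<lambda>i. \<phi>' (e ! i))" "\<psi> = (\<lambda>i. \<psi>' (e ! i))" using ps unfolding A'_def by blast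
    then show ?thesis unfolding A'_def
      by (intro CollectI exI[of _ "\<lambda>x. \<phi>' x + c * \<psi>' x"]) (simp add: dual_combine)
  qed
  have neA: "A \<noteq> {}" "A' \<noteq> {}" using AI[OF coord_dual] coord_dual unfolding A'_def by blast+
  have det: "\<forall>b\<in>?X. g b = 0" if g: "g \<in> C" "\<And>\<phi>. \<phi> \<in> A \<Longrightarrow> (\<Sum>b\<in>?X. g b * \<phi> b) = 0" for g
  proof
    fix b assume b: "b \<in> ?X"
    \<comment> \<open>\<open>polarization\<close> asks for symmetry on words of every length, but
      \<open>g\<close> is known to be symmetric only on words of length \<open>d\<close>.\<close>
    define h where "h b = (if length b = d then g b else 0)" for b
    have "h b = 0"
    proof (rule slots_zero[where X = "{..<N}" and C = UNIV and A = A', OF _ _ _ _ _ b])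
      fix \<phi>s assume \<phi>s: "set \<phi>s \<subseteq> A'" "length \<phi>s = d"
      show "tsum {..<N} d (\<lambda>w. h w * prod_list (map2 (\<lambda>\<phi> x. \<phi> x) \<phi>s w)) = 0"
      proof (rule polarization[where A = A'])
        show "(\<lambda>x. \<phi> x + c * \<psi> x) \<in> A'" if "\<phi> \<in> A'" "\<psi> \<in> A'" for \<phi> \<psi> c
          using that by (rule closedA')
      next
        fix us vs and x y :: nat
        assume "set us \<subseteq> {..<N}" "x \<in> {..<N}" "y \<in> {..<N}" "set vs \<subseteq> {..<N}"
        then show "h (us @ x # y # vs) = h (us @ y # x # vs)"
          using g(1) unfolding C_def h_def by (auto simp: words_def)
      next
        fix \<phi> assume "\<phi> \<in> A'"
        then obtain \<eta> where \<eta>: "\<eta> \<in> dual_space s" "\<phi> = (\<lambda>i. \<eta> (e ! i))" unfolding A'_def by blast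
        have "tsum {..<N} d (\<lambda>w. h w * prod_list (map \<phi> w)) = (\<Sum>b\<in>?X. g b * prod_list (map \<phi> b))"
          unfolding tsum_eq_sum[OF finite_lessThan] by (rule sum.cong) (auto simp: h_def words_def)
        then show "tsum {..<N} d (\<lambda>w. h w * prod_list (map \<phi> w)) = 0"
          using g(2)[OF AI[OF \<eta>(1)]] \<eta>(2) by simp
      qed (use \<phi>s neA in auto)
    next
      fix g' :: "nat \<Rightarrow> complex" assume 0: "\<And>\<phi>. \<phi> \<in> A' \<Longrightarrow> (\<Sum>x<N. g' x * \<phi> x) = 0"
      show "\<forall>x\<in>{..<N}. g' x = 0"
      proof
        fix i assume "i \<in> {..<N}"
        then have i: "i < N" by simp
        have "(\<lambda>j. coord i (e ! j)) \<in> A'" unfolding A'_def using coord_dual by blast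
        then have "(\<Sum>x<N. g' x * coord i (e ! x)) = 0" by (rule 0)
        moreover have "(\<Sum>x<N. g' x * coord i (e ! x)) = (\<Sum>x<N. g' x * (if i = x then 1 else 0))"
          using i by (intro sum.cong refl) (simp add: coord_basis)
        ultimately show "g' i = 0" using delta_sum[OF i, of g'] by simp
      qed
    qed auto
    then show "g b = 0" using b by (simp add: h_def length_words)
  qed
  have "f (concat bs) = 0" if bs: "bs \<in> words ?X k" for bs
  proof (rule slots_zero[where \<Omega> = "\<lambda>bs. f (concat bs)" and C = C and A = A, OF finX _ _ _ _ bs])
    show "\<forall>x\<in>?X. g x = 0" if "g \<in> C" "\<And>\<phi>. \<phi> \<in> A \<Longrightarrow> (\<Sum>x\<in>?X. g x * \<phi> x) = 0" for g
      using that by (rule det)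
  next
    fix I :: "nat list list set" and g :: "nat list list \<Rightarrow> nat list \<Rightarrow> complex" and c
    assume g: "\<And>i. i \<in> I \<Longrightarrow> g i \<in> C"
    show "(\<lambda>x. \<Sum>i\<in>I. g i x * c i) \<in> C"
      unfolding C_def
    proof (intro CollectI allI impI)
      fix p x y q assume w: "p @ x # y # q \<in> ?X"
      show "(\<Sum>i\<in>I. g i (p @ x # y # q) * c i) = (\<Sum>i\<in>I. g i (p @ y # x # q) * c i)"
      proof (rule sum.cong)
        fix i assume "i \<in> I"
        then have "g i (p @ x # y # q) = g i (p @ y # x # q)" using g w unfolding C_def by blast
        then show "g i (p @ x # y # q) * c i = g i (p @ y # x # q) * c i" by simp
      qed simp
    qed
  next
    fix us vs assume us: "set us \<subseteq> ?X"
    show "(\<lambda>x. f (concat (us @ x # vs))) \<in> C"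
      unfolding C_def
    proof (intro CollectI allI impI)
      fix p x y q assume w: "p @ x # y # q \<in> ?X"
      have "f ((concat us @ p) @ x # y # (q @ concat vs)) = f ((concat us @ p) @ y # x # (q @ concat vs))"
      proof (rule einv_letters[OF f(2), of "length p" _ "length us"])
        show "Suc (length p) < d" using w by (auto simp: words_def)
        show "length (concat us @ p) = length us * d + length p" by (simp add: length_concat_words[OF us])
      qed
      then show "f (concat (us @ (p @ x # y # q) # vs)) = f (concat (us @ (p @ y # x # q) # vs))" by simp
    qed
  next
    fix \<phi>s assume \<phi>s: "set \<phi>s \<subseteq> A" "length \<phi>s = k"
    show "tsum ?X k (\<lambda>w. f (concat w) * prod_list (map2 (\<lambda>\<phi> x. \<phi> x) \<phi>s w)) = 0"
    proof (rule polarization[where A = A])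
      show "(\<lambda>x. \<phi> x + c * \<psi> x) \<in> A" if "\<phi> \<in> A" "\<psi> \<in> A" for \<phi> \<psi> c
        using that by (rule closedA)
    next
      fix us vs x y
      assume us: "set us \<subseteq> ?X" "x \<in> ?X" "y \<in> ?X"
      have "f (concat us @ x @ y @ concat vs) = f (concat us @ y @ x @ concat vs)"
        by (rule einv_blocks[OF f(2), of _ "length us"])
          (use us in \<open>simp_all add: length_words length_concat_words\<close>)
      then show "f (concat (us @ x # y # vs)) = f (concat (us @ y # x # vs))" by simp
    next
      fix \<phi> assume "\<phi> \<in> A"
      then obtain \<phi>' where \<phi>': "\<phi>' \<in> dual_space fscale" "\<phi> = (\<lambda>b. \<phi>' (smonom b))" unfolding A_def by blast
      have "pleth k d f \<phi>' = 0" using zero by simp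
      then show "tsum ?X k (\<lambda>w. f (concat w) * prod_list (map \<phi> w)) = 0"
        using \<phi>' by (simp add: pleth_def)
    qed (use \<phi>s neA in auto)
  qed
  then show ?thesis using f(1) words_concat[of _ "{..<N}" k d] unfolding tens_def by blast
qed

definition delta :: "nat list \<Rightarrow> nat list \<Rightarrow> complex" where
  "delta u = (\<lambda>w. if w = u then 1 else 0)"

lemma pleth_delta:
  assumes bs: "bs \<in> words (words {..<N} d) k"
  shows "pleth k d (delta (concat bs)) = sym_prod fscale (map smonom bs)"
proof
  fix \<phi>
  have "concat bs' = concat bs \<longleftrightarrow> bs' = bs" if bs': "bs' \<in> words (words {..<N} d) k" for bs'
  proof
    assume eq: "concat bs' = concat bs"
    show "bs' = bs"
    proof (rule concat_injective[OF eq])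
      show "length bs' = length bs" using bs bs' by (simp add: length_words)
      show "\<forall>(x, y)\<in>set (zip bs' bs). length x = length y"
      proof clarify
        fix x y assume "(x, y) \<in> set (zip bs' bs)"
        then have "x \<in> set bs'" "y \<in> set bs" by (auto dest: set_zip_leftD set_zip_rightD)
        moreover have "length b = d" if "b \<in> set bs \<or> b \<in> set bs'" for b
          using that bs bs' by (auto simp: words_def)
        ultimately show "length x = length y" by simp
      qed
    qed
  qed simp
  then have "tsum (words {..<N} d) k (\<lambda>bs'. delta (concat bs) (concat bs') * prod_list (map (\<lambda>b. \<phi> (smonom b)) bs'))
    = tsum (words {..<N} d) k (\<lambda>bs'. (if bs' = bs then 1 else 0) * prod_list (map (\<lambda>b. \<phi> (smonom b)) bs'))"
    by (intro tsum_cong) (simp add: delta_def)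
  also have "\<dots> = prod_list (map (\<lambda>b. \<phi> (smonom b)) bs)"
    by (rule tsum_delta[OF _ bs]) (simp add: finite_words)
  finally show "pleth k d (delta (concat bs)) \<phi> = sym_prod fscale (map smonom bs) \<phi>"
    by (simp add: pleth_def sym_prod_def comp_def)
qed

lemma delta_tens: "w \<in> words {..<N} n \<Longrightarrow> delta w \<in> tens N n"
  by (auto simp: delta_def tens_def)

text \<open>Two words that spell the same product differ by an element of the kernel, and pairing a
  delta with \<open>F\<close> reads off a coefficient up to conjugation.\<close>

lemma perp_swap:
  assumes perp: "\<And>\<kappa>. \<kappa> \<in> tens N (k * d) \<Longrightarrow> pleth k d \<kappa> = 0 \<Longrightarrow> herm N (k * d) \<kappa> F = 0"
    and bs: "bs \<in> words (words {..<N} d) k" "cs \<in> words (words {..<N} d) k"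
    and eq: "sym_prod fscale (map smonom bs) = sym_prod fscale (map smonom cs)"
  shows "F (concat bs) = F (concat cs)"
proof -
  have w: "concat bs \<in> words {..<N} (k * d)" "concat cs \<in> words {..<N} (k * d)"
    using bs concat_in_words by blast+
  define \<kappa> where "\<kappa> = (\<lambda>w. delta (concat bs) w - delta (concat cs) w)"
  have "\<kappa> \<in> tens N (k * d)"
    using tens_comb[OF delta_tens[OF w(2)] delta_tens[OF w(1)], of "- 1"] by (simp add: \<kappa>_def)
  moreover have "pleth k d \<kappa> = 0"
    unfolding \<kappa>_def pleth_diff using bs eq by (simp add: pleth_delta)
  ultimately have "herm N (k * d) \<kappa> F = 0" by (rule perp)
  moreover have "herm N (k * d) (delta w) F = cnj (F w)" if "w \<in> words {..<N} (k * d)" for w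
    unfolding herm_def delta_def by (rule tsum_delta[OF _ that]) simp
  ultimately have "cnj (F (concat bs)) - cnj (F (concat cs)) = 0"
    unfolding \<kappa>_def herm_diff_left using w by simp
  then show ?thesis by simp
qed

lemma perp_einv:
  assumes F: "F \<in> tens N (k * d)"
    and perp: "\<And>\<kappa>. \<kappa> \<in> tens N (k * d) \<Longrightarrow> pleth k d \<kappa> = 0 \<Longrightarrow> herm N (k * d) \<kappa> F = 0"
  shows "einv d F"
proof (rule einvI)
  have F0: "F w = F w'" if "w \<notin> words {..<N} (k * d)" "w' \<notin> words {..<N} (k * d)" for w w'
  proof -
    have "F w = 0" "F w' = 0" using F that unfolding tens_def by blast+
    then show ?thesis by simp
  qed
  have split: "\<exists>us vs. us \<in> words (words {..<N} d) j \<and> vs \<in> words (words {..<N} d) i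
      \<and> u = concat us \<and> v = concat vs"
    if "u \<in> words {..<N} (j * d)" "v \<in> words {..<N} (i * d)" for u v j i
    using words_concat[OF that(1)] words_concat[OF that(2)] by blast
  {
    fix j r :: nat and u v :: "nat list" and x y :: nat
    assume r: "Suc r < d" "length u = j * d + r"
    have iff: "u @ x # y # v \<in> words {..<N} (k * d) \<longleftrightarrow> u @ y # x # v \<in> words {..<N} (k * d)"
      by (rule swap_in_words)
    show "F (u @ x # y # v) = F (u @ y # x # v)"
    proof (cases "u @ x # y # v \<in> words {..<N} (k * d)")
      case True
      \<comment> \<open>Cut so that \<open>u2 @ x # y # v1\<close> is the block containing both
        exchanged letters; it has \<open>r + 2 + (d - r - 2) = d\<close> letters.\<close>
      define u1 u2 v1 v2 where "u1 = take (j * d) u" and "u2 = drop (j * d) u"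
        and "v1 = take (d - r - 2) v" and "v2 = drop (d - r - 2) v"
      have uv: "u = u1 @ u2" "v = v1 @ v2" by (simp_all add: u1_def u2_def v1_def v2_def)
      have len: "j * d + r + 2 + length v = k * d" using True r by (simp add: words_def)
      have jk: "Suc j \<le> k"
      proof (rule ccontr)
        assume "\<not> Suc j \<le> k"
        then have "k * d \<le> j * d" by simp
        then show False using len by linarith
      qed
      then obtain i where i: "k = Suc j + i" using le_Suc_ex by blast
      have lens: "length u1 = j * d" "length u2 = r" "length v1 = d - r - 2" "length v2 = i * d"
        using r len i by (auto simp: u1_def u2_def v1_def v2_def add_mult_distrib)
      have letters: "set u1 \<subseteq> {..<N}" "set u2 \<subseteq> {..<N}" "set v1 \<subseteq> {..<N}" "set v2 \<subseteq> {..<N}" "x < N" "y < N"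
        using True uv by (auto simp: words_def)
      obtain us vs where us: "us \<in> words (words {..<N} d) j" "vs \<in> words (words {..<N} d) i"
        "u1 = concat us" "v2 = concat vs"
        using split[of u1 j v2 i] lens letters by (auto simp: words_def)
      have b: "u2 @ x' # y' # v1 \<in> words {..<N} d" if "x' < N" "y' < N" for x' y'
        using lens letters that r by (auto simp: words_def)
      have mem: "us @ (u2 @ x' # y' # v1) # vs \<in> words (words {..<N} d) k" if "x' < N" "y' < N" for x' y'
        using us(1,2) b[OF that] i by (auto simp: words_def)
      have "smonom (u2 @ x # y # v1) = smonom (u2 @ y # x # v1)"
        by (auto simp: smonom_def sym_prod_def fun_eq_iff mult_ac)
      then have "F (concat (us @ (u2 @ x # y # v1) # vs)) = F (concat (us @ (u2 @ y # x # v1) # vs))"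
        using letters by (intro perp_swap[where k = k and d = d] perp mem) auto
      then show ?thesis using uv us by simp
    qed (use iff F0 in blast)
  next
    fix j and u b c v :: "nat list"
    assume l: "length u = j * d" "length b = d" "length c = d"
    have iff: "u @ b @ c @ v \<in> words {..<N} (k * d) \<longleftrightarrow> u @ c @ b @ v \<in> words {..<N} (k * d)"
      by (auto simp: words_def)
    show "F (u @ b @ c @ v) = F (u @ c @ b @ v)"
    proof (cases "u @ b @ c @ v \<in> words {..<N} (k * d)")
      case True
      have len: "j * d + 2 * d + length v = k * d" using True l by (simp add: words_def)
      show ?thesis
      proof (cases "d = 0")
        case False
        have jk: "j + 2 \<le> k"
        proof -
          have "(j + 2) * d \<le> k * d" using len by (simp add: add_mult_distrib)
          then show ?thesis using False by (simp only: mult_le_cancel2)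
        qed
        then obtain i where i: "k = j + 2 + i" using le_Suc_ex by blast
        have lv: "length v = i * d" using len i by (simp add: add_mult_distrib)
        obtain us vs where us: "us \<in> words (words {..<N} d) j" "vs \<in> words (words {..<N} d) i"
          "u = concat us" "v = concat vs"
          using split[of u j v i] l lv True by (auto simp: words_def)
        have bc: "b \<in> words {..<N} d" "c \<in> words {..<N} d" using True l by (auto simp: words_def)
        have "F (concat (us @ b # c # vs)) = F (concat (us @ c # b # vs))"
          using us(1,2) bc i
          by (intro perp_swap[where k = k and d = d] perp) (auto simp: words_def sym_prod_def fun_eq_iff mult_ac)
        then show ?thesis using us by simp
      qed (use l in simp)
    qed (use iff F0 in blast)
  }
qed

end

section \<open>Permutation invariance is kept by matrices\<close>

lemma act_swap:
  "act N g (\<lambda>b. act N g (h b) c0) b0 = act N g (\<lambda>c. act N g (\<lambda>b. h b c) b0) c0"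
  by (induction b0 arbitrary: h) (simp_all add: act_sum act_cmult)

lemma act_block_swap:
  assumes "\<And>u' b' c' v'. length u' = length u \<Longrightarrow> length b' = length b \<Longrightarrow> length c' = length c \<Longrightarrow>
    f (u' @ b' @ c' @ v') = f (u' @ c' @ b' @ v')"
  shows "act N g f (u @ b @ c @ v) = act N g f (u @ c @ b @ v)"
proof -
  have "act N g f (u @ b @ c @ v)
      = act N g (\<lambda>u'. act N g (\<lambda>b'. act N g (\<lambda>c'. act N g (\<lambda>v'. f (u' @ b' @ c' @ v')) v) c) b) u"
    by (simp only: act_append)
  also have "\<dots> = act N g (\<lambda>u'. act N g (\<lambda>b'. act N g (\<lambda>c'. act N g (\<lambda>v'. f (u' @ c' @ b' @ v')) v) c) b) u"
  proof (intro act_cong)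
    fix u' b' c' v'
    assume "u' \<in> words {..<N} (length u)" "b' \<in> words {..<N} (length b)" "c' \<in> words {..<N} (length c)"
    then show "f (u' @ b' @ c' @ v') = f (u' @ c' @ b' @ v')" by (intro assms) (simp_all add: words_def)
  qed
  also have "\<dots> = act N g (\<lambda>u'. act N g (\<lambda>c'. act N g (\<lambda>b'. act N g (\<lambda>v'. f (u' @ c' @ b' @ v')) v) b) c) u"
    by (subst act_swap) (rule refl)
  also have "\<dots> = act N g f (u @ c @ b @ v)"
    by (simp only: act_append)
  finally show ?thesis .
qed

lemma einv_act:
  assumes "einv d f" shows "einv d (act N A f)"
proof (rule einvI)
  fix j r :: nat and u v :: "nat list" and x y :: nat
  assume r: "Suc r < d" "length u = j * d + r"
  have "act N A f (u @ [x] @ [y] @ v) = act N A f (u @ [y] @ [x] @ v)"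
  proof (rule act_block_swap)
    fix u' b' c' v' :: "nat list"
    assume l: "length u' = length u" "length b' = length [x]" "length c' = length [y]"
    then obtain x' y' where "b' = [x']" "c' = [y']" by (auto simp: length_Suc_conv)
    then show "f (u' @ b' @ c' @ v') = f (u' @ c' @ b' @ v')"
      using einv_letters[OF assms r(1), of u' j x' y' v'] l r(2) by simp
  qed
  then show "act N A f (u @ x # y # v) = act N A f (u @ y # x # v)" by simp
next
  fix j and u b c v :: "nat list" assume l: "length u = j * d" "length b = d" "length c = d"
  show "act N A f (u @ b @ c @ v) = act N A f (u @ c @ b @ v)"
    by (rule act_block_swap, rule einv_blocks[OF assms, of _ j]) (use l in simp_all)
qed

context gl_basis
begin

lemma pleth_plus: "pleth k d (f + g) = pleth k d f + pleth k d g"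
  using pleth_add[of k d f g] by (simp only: plus_fun_def)

lemma pleth_fscale: "pleth k d (fscale c f) = fscale c (pleth k d f)"
  using pleth_scale[of k d c f] by (simp only: fscale_def[of c f])

lemma pleth_0: "pleth k d 0 = 0"
  using pleth_zero[of k d] by (simp only: zero_fun_def)

text \<open>The orthogonal complement of the kernel provides an equivariant section of \<open>pleth\<close>.\<close>

lemma pleth_perp_lift:
  assumes "\<Phi> \<in> plethysm s k d"
  shows "\<exists>F\<in>tens N (k * d). pleth k d F = \<Phi> \<and>
    (\<forall>\<kappa>\<in>tens N (k * d). pleth k d \<kappa> = 0 \<longrightarrow> herm N (k * d) \<kappa> F = 0)"
proof -
  obtain f where f: "f \<in> tens N (k * d)" "pleth k d f = \<Phi>" using pleth_surj[OF assms] by blast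
  define K where "K = {\<kappa> \<in> tens N (k * d). pleth k d \<kappa> = 0}"
  have "fs.subspace K"
    unfolding fs.subspace_def
  proof (intro conjI ballI allI)
    show "0 \<in> K" using fs.subspace_0[OF tens_subspace] pleth_0 by (simp only: K_def mem_Collect_eq)
    show "x + y \<in> K" if "x \<in> K" "y \<in> K" for x y
      using that fs.subspace_add[OF tens_subspace, of x N "k * d" y] unfolding K_def
      by (simp only: mem_Collect_eq pleth_plus add_0)
    show "fscale c x \<in> K" if "x \<in> K" for c x
      using that fs.subspace_scale[OF tens_subspace, of x N "k * d" c] unfolding K_def
      by (simp only: mem_Collect_eq pleth_fscale fs.scale_zero_right)
  qed
  then obtain p where p: "p \<in> K" "\<forall>q\<in>K. herm N (k * d) q (\<lambda>w. f w - p w) = 0"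
    using orth_projection[of K N "k * d" f] f(1) by (auto simp: K_def)
  have "(\<lambda>w. f w - p w) \<in> tens N (k * d)"
    using fs.subspace_diff[OF tens_subspace f(1), of p] p(1) by (simp add: K_def fun_diff_def)
  moreover have "pleth k d (\<lambda>w. f w - p w) = \<Phi>"
    using p(1) f(2) by (simp add: pleth_diff K_def)
  ultimately show ?thesis using p(2) unfolding K_def by (intro bexI[of _ "\<lambda>w. f w - p w"]) auto
qed

section \<open>From Schur submodules to highest weight tensors\<close>

lemma lin_of_mdiag: "i < N \<Longrightarrow> lin_of (mdiag N z) (e ! i) = s (z i) (e ! i)"
proof (rule coord_ext)
  fix j assume i: "i < N" and j: "j < N"
  have "coord j (lin_of (mdiag N z) (e ! i)) = (\<Sum>k<N. (z j * coord k (e ! i)) * (if j = k then 1 else 0))"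
    unfolding coord_lin_of[OF j] using j by (intro sum.cong refl) (auto simp: mdiag_def)
  then show "coord j (lin_of (mdiag N z) (e ! i)) = coord j (s (z i) (e ! i))"
    using i j by (simp add: delta_sum dual_scale[OF coord_dual] coord_basis)
qed

lemma coord_span_take:
  assumes "v \<in> span (set (take j e))" "j \<le> i" "i < N"
  shows "coord i v = 0"
proof -
  have "subspace {v. coord i v = 0}"
    unfolding subspace_def by (simp add: dual_zero[OF coord_dual] dual_add[OF coord_dual] dual_scale[OF coord_dual])
  moreover have "set (take j e) \<subseteq> {v. coord i v = 0}"
    using assms(2,3) by (auto simp: in_set_conv_nth coord_basis)
  ultimately have "span (set (take j e)) \<subseteq> {v. coord i v = 0}" by (rule span_minimal[rotated])
  then show ?thesis using assms(1) by blast
qed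

lemma mat_of_unitri:
  assumes "g \<in> upper_unitriangular s e"
  shows "unitri N (mat_of g)"
proof -
  have d: "coord i (g (e ! j)) = (if i = j then 1 else 0)" if "j \<le> i" "i < N" for i j
  proof -
    have j: "j < N" using that by simp
    then have "g (e ! j) - e ! j \<in> span (set (take j e))"
      using assms by (simp add: upper_unitriangular_def)
    then have "coord i (g (e ! j) - e ! j) = 0" using that by (rule coord_span_take)
    moreover have "coord i (g (e ! j)) = coord i (g (e ! j) - e ! j) + coord i (e ! j)"
      unfolding dual_add[OF coord_dual, symmetric] by simp
    ultimately show ?thesis using that j by (simp add: coord_basis)
  qed
  then show ?thesis using mat_of_mat by (auto simp: unitri_def mat_of_def)
qed

lemma lin_of_unitri:
  assumes "unitri N A" "A \<in> GLm N"
  shows "lin_of A \<in> upper_unitriangular s e"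
proof -
  have "lin_of A (e ! j) - e ! j \<in> span (set (take j e))" if j: "j < N" for j
  proof -
  have "(\<Sum>k<N. A i k * coord k (e ! j)) = A i j" if "i < N" for i
  proof -
    have "(\<Sum>k<N. A i k * coord k (e ! j)) = (\<Sum>k<N. A i k * (if j = k then 1 else 0))"
      using j by (intro sum.cong refl) (simp add: coord_basis)
    then show ?thesis using j by (simp add: delta_sum)
  qed
  then have lin_of: "lin_of A (e ! j) = (\<Sum>i<N. s (A i j) (e ! i))"
    unfolding lin_of_def by (intro sum.cong refl) simp
  have "(\<Sum>i<N. s (A i j) (e ! i)) = s (A j j) (e ! j) + (\<Sum>i\<in>{..<N} - {j}. s (A i j) (e ! i))"
    using j by (intro sum.remove) auto
  then have "lin_of A (e ! j) - e ! j = (\<Sum>i\<in>{..<N} - {j}. s (A i j) (e ! i))"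
    using assms(1) j by (simp add: lin_of unitri_def)
  also have "\<dots> \<in> span (set (take j e))"
  proof (rule span_sum)
    fix i assume i: "i \<in> {..<N} - {j}"
    show "s (A i j) (e ! i) \<in> span (set (take j e))"
    proof (cases "i < j")
      case True
      then have "e ! i \<in> set (take j e)" using j by (auto simp: in_set_conv_nth intro!: exI[of _ i])
      then show ?thesis by (intro span_scale span_base)
    next
      case False
      then have "A i j = 0" using assms(1) i by (simp add: unitri_def)
      then show ?thesis by (simp add: span_zero)
    qed
  qed
  finally show "lin_of A (e ! j) - e ! j \<in> span (set (take j e))" .
  qed
  then show ?thesis using lin_of_GL[OF assms(2)] by (simp add: upper_unitriangular_def)
qed

text \<open>Among the preimages of the highest weight vector the one orthogonal to the kernel is
  taken. For it the torus and unipotent equations hold exactly, not only modulo the kernel, and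
  \<open>perp_einv\<close> gives its symmetry.\<close>

lemma hw_tensor:
  assumes "occurs_in_plethysm s e lam k d"
  shows "\<exists>F. length lam \<le> N \<and> F \<noteq> (\<lambda>w. 0) \<and> F \<in> tens N (k * d) \<and> einv d F
    \<and> has_content N 0 lam F \<and> raised N 0 lam F"
proof -
  obtain w where w: "w \<in> plethysm s k d" "weight_vector s e fscale plethysm_act lam w"
    "\<And>u. u \<in> upper_unitriangular s e \<Longrightarrow> plethysm_act u w = w"
    using assms unfolding occurs_in_plethysm_def is_Schur_module_def has_highest_weight_def by blast
  have len: "length lam \<le> N" and nz: "w \<noteq> 0"
    and wt: "\<And>g z. g \<in> GL s \<Longrightarrow> (\<And>i. i < N \<Longrightarrow> g (e ! i) = s (z i) (e ! i)) \<Longrightarrow>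
      plethysm_act g w = fscale (\<Prod>i<length lam. z i ^ (lam ! i)) w"
    using w(2) unfolding weight_vector_def by auto
  let ?n = "k * d"
  obtain F where F: "F \<in> tens N ?n" "pleth k d F = w"
    and perp: "\<And>\<kappa>. \<kappa> \<in> tens N ?n \<Longrightarrow> pleth k d \<kappa> = 0 \<Longrightarrow> herm N ?n \<kappa> F = 0"
    using pleth_perp_lift[OF w(1)] by blast
  \<comment> \<open>\<open>\<kappa>\<close> is in the kernel because \<open>pleth\<close> is
    equivariant, and orthogonal to the kernel because the kernel is stable under conjugate
    transposes. So it vanishes.\<close>
  have lift: "act N A F = (\<lambda>u. c * F u)" if A: "A \<in> GLm N" and eq: "plethysm_act (lin_of A) w = fscale c w" for A c
  proof -
    have Am: "A \<in> mat N" using A GLm_mat by blast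
    define \<kappa> where "\<kappa> = (\<lambda>u. act N A F u - c * F u)"
    have actT: "act N A F \<in> tens N ?n" using Am F(1) by (rule act_tens)
    have \<kappa>T: "\<kappa> \<in> tens N ?n"
      using tens_comb[OF F(1) actT, of "- c"] by (simp add: \<kappa>_def)
    have pimA: "pleth k d (act N B f) = plethysm_act (lin_of B) (pleth k d f)" if "B \<in> GLm N" for B f
    proof -
      have "B \<in> mat N" using that GLm_mat by blast
      then show ?thesis using pleth_act[OF lin_of_GL[OF that], of k d f] by (simp add: mat_of_lin_of)
    qed
    have "pleth k d \<kappa> = 0"
      unfolding \<kappa>_def pleth_diff pleth_scale pimA[OF A] F(2) eq by simp
    moreover have "herm N ?n \<kappa> (act N A F) = 0"
    proof -
      have "pleth k d (act N (madj A) \<kappa>) = plethysm_act (lin_of (madj A)) 0"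
        using pimA[OF madj_GLm[OF A], of \<kappa>] \<open>pleth k d \<kappa> = 0\<close> by simp
      also have "\<dots> = 0" by (simp add: plethysm_act_def sym_act_def fun_eq_iff)
      finally have "herm N ?n (act N (madj A) \<kappa>) F = 0"
        using madj_mat[OF Am] \<kappa>T by (intro perp act_tens)
      then show ?thesis by (simp add: herm_adj)
    qed
    ultimately have "herm N ?n \<kappa> \<kappa> = 0"
      using perp[OF \<kappa>T] herm_diff_right[of N ?n \<kappa> "act N A F" "\<lambda>u. c * F u"]
      by (simp add: \<kappa>_def[symmetric] herm_cmult_right)
    then have "\<kappa> = (\<lambda>u. 0)" using herm_self_zero[OF \<kappa>T] by blast
    then show ?thesis by (auto simp: \<kappa>_def fun_eq_iff)
  qed
  have Fnz: "F \<noteq> (\<lambda>u. 0)" using F(2) nz pleth_zero by blast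
  have cont: "has_content N 0 lam F"
    unfolding has_content_def
  proof (intro allI impI multiset_eqI)
    fix u x assume u: "F u \<noteq> 0"
    have uN: "set u \<subseteq> {..<N}" using u F(1) unfolding tens_def words_def by blast
    \<comment> \<open>Scaling only the basis vector \<open>x\<close> by 2 turns the eigenvalue into
      a power of 2 whose exponent counts the letters \<open>x\<close>.\<close>
    define z :: "nat \<Rightarrow> complex" where "z i = (if i = x then 2 else 1)" for i
    define c where "c = (\<Prod>i<length lam. z i ^ (lam ! i))"
    have D: "mdiag N z \<in> GLm N" by (rule mdiag_GLm) (simp add: z_def)
    have "plethysm_act (lin_of (mdiag N z)) w = fscale c w"
      unfolding c_def by (rule wt[OF lin_of_GL[OF D] lin_of_mdiag])
    from fun_cong[OF lift[OF D this], of u] have "prod_list (map z u) * F u = c * F u"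
      by (simp only: act_mdiag[OF uN])
    then have "prod_list (map z u) = c" using u by simp
    moreover have "prod_list (map z u) = 2 ^ count (mset u) x"
      by (induction u) (auto simp: z_def)
    moreover have "c = 2 ^ (if x < length lam then lam ! x else 0)"
    proof (cases "x < length lam")
      case True
      then have "c = z x ^ (lam ! x) * (\<Prod>i\<in>{..<length lam} - {x}. z i ^ (lam ! i))"
        unfolding c_def by (intro prod.remove) auto
      also have "(\<Prod>i\<in>{..<length lam} - {x}. z i ^ (lam ! i)) = 1"
        by (rule prod.neutral) (auto simp: z_def)
      finally show ?thesis using True by (simp add: z_def)
    next
      case False
      then have "c = 1" unfolding c_def by (intro prod.neutral) (auto simp: z_def)
      then show ?thesis using False by simp
    qed
    ultimately have "(2::complex) ^ count (mset u) x = 2 ^ (if x < length lam then lam ! x else 0)" by simp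
    then have "real 2 ^ count (mset u) x = real 2 ^ (if x < length lam then lam ! x else 0)"
      by (metis (mono_tags, lifting) norm_numeral norm_power of_nat_numeral)
    then have "count (mset u) x = (if x < length lam then lam ! x else 0)"
      by (subst (asm) power_inject_exp) auto
    then show "count (mset u) x = count (mset (map snd (boxes N 0 lam))) x"
      unfolding count_snd_boxes by simp
  qed
  have "raised N 0 lam F"
    unfolding raised_def
  proof (intro allI impI ext)
    fix i j u assume ij: "0 \<le> i" "i < j" "j < 0 + length lam"
    have jN: "i < N" "j < N" using ij len by auto
    show "sop N i j F u = 0"
    proof (cases "set u \<subseteq> {..<N}")
      case True
      \<comment> \<open>A one-parameter unipotent subgroup fixing \<open>F\<close>; its derivative
        at 0 is the raising operator, which therefore kills \<open>F\<close>.\<close>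
      define A where "A t = (\<lambda>x y. mone N x y + (if x = i \<and> y = j then t else 0))" for t :: complex
      have "A t = mrow N i (\<lambda>y. if y = j then t else 0)" for t
        using ij jN by (intro ext) (auto simp: A_def mrow_def)
      then have "A t \<in> GLm N" "unitri N (A t)" for t
        using mrow_GLm[OF jN(1)] mrow_unitri[OF jN(1)] by simp_all
      then have "act N (A t) F = F" for t
        using lift[of "A t" 1] w(3)[OF lin_of_unitri] by (simp add: fscale_def)
      then have "((\<lambda>t. F u) has_field_derivative sop N i j F u) (at 0)"
        using act_mono_deriv[OF jN True, of F] by (simp add: A_def)
      then show ?thesis by (rule DERIV_unique) (rule DERIV_const)
    next
      case False
      show ?thesis
      proof (rule ccontr)
        assume "sop N i j F u \<noteq> 0"
        then obtain u' where u': "F u' \<noteq> 0" "add_mset j (mset u) = add_mset i (mset u')"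
          using sop_support by blast
        have "set u' \<subseteq> {..<N}" using u'(1) F(1) unfolding tens_def words_def by blast
        moreover have "set u \<subseteq> insert i (set u')" using arg_cong[OF u'(2), of set_mset] by auto
        ultimately show False using False jN by auto
      qed
    qed
  qed
  with len Fnz F(1) cont perp_einv[OF F(1) perp] show ?thesis by blast
qed

section \<open>From highest weight tensors to Schur submodules\<close>

lemma poly_funs_sum:
  "(\<And>i. i \<in> I \<Longrightarrow> f i \<in> poly_funs s) \<Longrightarrow> (\<lambda>g. \<Sum>i\<in>I. f i g) \<in> poly_funs s"
  by (induction I rule: infinite_finite_induct) (auto intro: poly_funs.intros)

lemma poly_funs_act: "set w \<subseteq> {..<N} \<Longrightarrow> (\<lambda>g. act N (mat_of g) f w) \<in> poly_funs s"
proof (induction w arbitrary: f)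
  case (Cons x w)
  have "(\<lambda>g. mat_of g x y) \<in> poly_funs s" if "y < N" for y
    using Cons.prems that poly_funs.entry[OF coord_dual[of x], of "e ! y"] by (simp add: mat_of_def)
  then show ?case using Cons by (auto intro!: poly_funs_sum poly_funs.mult)
qed (auto intro: poly_funs.const)

text \<open>The Schur module is the image of the cyclic module generated by \<open>v\<close>. All
  tensors in that module are permutation invariant, so \<open>pleth\<close> is injective on it and
  does not kill \<open>v\<close>; a submodule of the image is the image of its preimage, to which
  \<open>cyclic_module_irreducible\<close> applies.\<close>

lemma occurs_from_tensor:
  assumes v: "v \<in> tens N (k * d)" "v \<noteq> (\<lambda>w. 0)" "has_content N 0 lam v" "einv d v"
    and fixed: "\<And>g. unitri N g \<Longrightarrow> act N g v = v" and len: "length lam \<le> N"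
  shows "occurs_in_plethysm s e lam k d"
proof -
  let ?n = "k * d"
  define M where "M = fs.span ((\<lambda>A. act N A v) ` GLm N)"
  define W where "W = pleth k d ` M"
  have MT: "M \<subseteq> tens N ?n"
    unfolding M_def using v(1) GLm_mat[of N] by (intro fs.span_minimal tens_subspace) (auto intro: act_tens)
  have einv_sub: "fs.subspace {f :: nat list \<Rightarrow> complex. einv d f}"
    unfolding fs.subspace_def
  proof (intro conjI ballI allI CollectI)
    show "einv d 0" by (simp add: einv_def)
    fix f :: "nat list \<Rightarrow> complex" assume f: "f \<in> {f. einv d f}"
    show "einv d (f + g)" if "g \<in> {f. einv d f}" for g :: "nat list \<Rightarrow> complex"
    proof (rule einvI)
      show "(f + g) (u @ x # y # w) = (f + g) (u @ y # x # w)"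
        if "Suc r < d" "length u = j * d + r" for j r u x y w
        using f \<open>g \<in> _\<close> einv_letters[of d f, OF _ that] einv_letters[of d g, OF _ that] by simp
      show "(f + g) (u @ b @ c @ w) = (f + g) (u @ c @ b @ w)"
        if "length u = j * d" "length b = d" "length c = d" for j u b c w
        using f \<open>g \<in> _\<close> einv_blocks[of d f, OF _ that, of w] einv_blocks[of d g, OF _ that, of w] by simp
    qed
    show "einv d (fscale c f)" for c
    proof (rule einvI)
      show "fscale c f (u @ x # y # w) = fscale c f (u @ y # x # w)"
        if "Suc r < d" "length u = j * d + r" for j r u x y w
        using f einv_letters[of d f, OF _ that] by (simp add: fscale_def)
      show "fscale c f (u @ b @ b' @ w) = fscale c f (u @ b' @ b @ w)"
        if "length u = j * d" "length b = d" "length b' = d" for j u b b' w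
        using f einv_blocks[of d f, OF _ that, of w] by (simp add: fscale_def)
    qed
  qed
  have ME: "einv d f" if "f \<in> M" for f
  proof -
    have "M \<subseteq> {f. einv d f}"
      unfolding M_def using v GLm_mat[of N] einv_act[OF v(4)]
      by (intro fs.span_minimal einv_sub) auto
    then show ?thesis using that by blast
  qed
  have inj: "f = (\<lambda>w. 0)" if "f \<in> M" "pleth k d f = 0" for f
    using pleth_inj[of f k d] MT ME that by blast
  have Msub: "fs.subspace M" unfolding M_def by (rule fs.subspace_span)
  have vM: "v \<in> M"
    unfolding M_def using act_mone_tens[OF v(1)] mone_GLm by (metis fs.span_base imageI)
  have Mact: "act N B f \<in> M" if "f \<in> M" and B: "B \<in> GLm N" for f B
  proof -
    have "M \<subseteq> {f. act N B f \<in> M}"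
      unfolding M_def
    proof (rule fs.span_minimal)
      show "(\<lambda>A. act N A v) ` GLm N \<subseteq> {f. act N B f \<in> fs.span ((\<lambda>A. act N A v) ` GLm N)}"
      proof clarify
        fix A assume A: "A \<in> GLm N"
        obtain A' B' where "A' \<in> mat N" "mmul N A A' = mone N" "mmul N A' A = mone N"
          "B' \<in> mat N" "mmul N B B' = mone N" "mmul N B' B = mone N" using A B unfolding GLm_def by blast
        have "lin_of B \<circ> lin_of A \<in> GL s" using lin_of_GL A B by (intro GL_comp)
        then have "mat_of (lin_of B \<circ> lin_of A) \<in> GLm N" by (rule mat_of_GLm)
        moreover have "mat_of (lin_of B \<circ> lin_of A) = mmul N B A"
          using mat_of_comp[OF lin_of_GL[OF B], of "lin_of A"] A B GLm_mat[of N] by (simp add: mat_of_lin_of subset_iff)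
        ultimately have "mmul N B A \<in> GLm N" by simp
        moreover have "act N B (act N A v) = act N (mmul N B A) v" by (rule ext) (rule act_act)
        ultimately show "act N B (act N A v) \<in> fs.span ((\<lambda>A. act N A v) ` GLm N)"
          by (metis fs.span_base imageI)
      qed
      show "fs.subspace {f. act N B f \<in> fs.span ((\<lambda>A. act N A v) ` GLm N)}"
        unfolding fs.subspace_def
      proof (intro conjI ballI allI CollectI)
        let ?S = "fs.span ((\<lambda>A. act N A v) ` GLm N)"
        have "act N B 0 = 0" using act_cmult[of N B 0 "\<lambda>w. 0"] by (auto simp: zero_fun_def fun_eq_iff)
        then show "act N B 0 \<in> ?S" by (simp add: fs.span_zero)
        show "act N B (x + y) \<in> ?S" if "x \<in> {f. act N B f \<in> ?S}" "y \<in> {f. act N B f \<in> ?S}" for x y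
        proof -
          have "act N B (x + y) = act N B x + act N B y" by (auto simp: plus_fun_def act_add)
          then show ?thesis using that by (simp add: fs.span_add)
        qed
        show "act N B (fscale c x) \<in> ?S" if "x \<in> {f. act N B f \<in> ?S}" for c x
        proof -
          have "act N B (fscale c x) = fscale c (act N B x)" by (auto simp: fscale_def act_cmult)
          then show ?thesis using that by (simp add: fs.span_scale)
        qed
      qed
    qed
    then show ?thesis using that(1) by blast
  qed
  have Wsub: "fs.subspace W"
    unfolding fs.subspace_def W_def
  proof (intro conjI ballI allI)
    show "0 \<in> pleth k d ` M" using fs.subspace_0[OF Msub] pleth_0 by (metis imageI)
    show "x + y \<in> pleth k d ` M" if xy: "x \<in> pleth k d ` M" "y \<in> pleth k d ` M" for x y
    proof -
      obtain f g where "f \<in> M" "g \<in> M" "x = pleth k d f" "y = pleth k d g" using xy by blast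
      then show ?thesis using fs.subspace_add[OF Msub, of f g] pleth_plus by (metis imageI)
    qed
    show "fscale c x \<in> pleth k d ` M" if x: "x \<in> pleth k d ` M" for c x
    proof -
      obtain f where "f \<in> M" "x = pleth k d f" using x by blast
      then show ?thesis using fs.subspace_scale[OF Msub, of f c] pleth_fscale by (metis imageI)
    qed
  qed
  have GLact: "plethysm_act g (pleth k d f) = pleth k d (act N (mat_of g) f)" if "g \<in> GL s" for g f
    using pleth_act[OF that] .
  have "GL_submodule s fscale plethysm_act W"
    unfolding GL_submodule_def
  proof (intro conjI ballI Wsub)
    fix g assume g: "g \<in> GL s"
    show "plethysm_act g ` W \<subseteq> W"
      unfolding W_def using GLact[OF g] Mact[OF _ mat_of_GLm[OF g]] by auto
  qed
  moreover have "pleth k d v \<noteq> 0" using inj[OF vM] v(2) by blast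
  then have "W \<noteq> {0}" unfolding W_def using vM by blast
  moreover have "W' = {0} \<or> W' = W" if W': "GL_submodule s fscale plethysm_act W'" "W' \<subseteq> W" for W'
  proof -
    define S where "S = {f \<in> M. pleth k d f \<in> W'}"
    have W'sub: "fs.subspace W'" and W'act: "\<And>g x. g \<in> GL s \<Longrightarrow> x \<in> W' \<Longrightarrow> plethysm_act g x \<in> W'"
      using W'(1) unfolding GL_submodule_def by blast+
    have "S = {0} \<or> S = fs.span ((\<lambda>A. act N A v) ` GLm N)"
    proof (rule cyclic_module_irreducible[where n = ?n and C = "mset (map snd (boxes N 0 lam))"])
      show "act N (mrow N r c) v = v" if "r < N" for r c using fixed mrow_unitri[OF that] by blast
      show "mset w = mset (map snd (boxes N 0 lam))" if "v w \<noteq> 0" for w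
        using v(3) that unfolding has_content_def by blast
      show "fs.subspace S"
        unfolding fs.subspace_def S_def
      proof (intro conjI ballI allI CollectI)
        show "0 \<in> M" by (rule fs.subspace_0[OF Msub])
        show "pleth k d 0 \<in> W'" using fs.subspace_0[OF W'sub] by (simp only: pleth_0)
        fix x y assume x: "x \<in> {f \<in> M. pleth k d f \<in> W'}"
        show "x + y \<in> M" if "y \<in> {f \<in> M. pleth k d f \<in> W'}"
          using x that fs.subspace_add[OF Msub] by blast
        show "pleth k d (x + y) \<in> W'" if "y \<in> {f \<in> M. pleth k d f \<in> W'}"
          using x that fs.subspace_add[OF W'sub] by (simp add: pleth_plus)
        fix c
        show "fscale c x \<in> M" using x fs.subspace_scale[OF Msub] by blast
        show "pleth k d (fscale c x) \<in> W'"
          using x fs.subspace_scale[OF W'sub] by (simp add: pleth_fscale)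
      qed
      show "S \<subseteq> fs.span ((\<lambda>A. act N A v) ` GLm N)" by (auto simp: S_def M_def)
      show "act N A f \<in> S" if "A \<in> GLm N" "f \<in> S" for A f
      proof -
        have "mat_of (lin_of A) = A" using that(1) GLm_mat[of N] by (auto intro: mat_of_lin_of)
        then have "pleth k d (act N A f) = plethysm_act (lin_of A) (pleth k d f)"
          using GLact[OF lin_of_GL[OF that(1)], of f] by simp
        then show ?thesis
          using that Mact[OF _ that(1)] W'act[OF lin_of_GL[OF that(1)]] by (simp add: S_def)
      qed
    qed (use v in auto)
    moreover have "W' = pleth k d ` S" using W'(2) unfolding S_def W_def by blast
    ultimately show ?thesis unfolding W_def M_def using pleth_0 by auto
  qed
  ultimately have irr: "irreducible_module s fscale plethysm_act W"
    unfolding irreducible_module_def by blast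
  have poly: "polynomial_module s fscale plethysm_act W"
    unfolding polynomial_module_def
  proof (intro ballI)
    fix w and \<phi> :: "(((('v \<Rightarrow> complex) \<Rightarrow> complex) \<Rightarrow> complex) \<Rightarrow> complex) \<Rightarrow> complex"
    assume "w \<in> W" and \<phi>: "\<phi> \<in> dual_space fscale"
    then obtain f where f: "f \<in> M" "w = pleth k d f" unfolding W_def by blast
    let ?X = "words (words {..<N} d) k"
    \<comment> \<open>Expanding the translate of \<open>w\<close> in products of monomials leaves
      \<open>g\<close> only in the coefficients of \<open>act\<close>, which are polynomial in the
      matrix entries.\<close>
    define p where "p g = (\<Sum>bs\<in>?X. act N (mat_of g) f (concat bs) * \<phi> (sym_prod fscale (map smonom bs)))" for g
    have "p \<in> poly_funs s"
      unfolding p_def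
    proof (intro poly_funs_sum poly_funs.mult poly_funs.const poly_funs_act)
      fix bs assume "bs \<in> ?X"
      then show "set (concat bs) \<subseteq> {..<N}" using concat_in_words unfolding words_def by blast
    qed
    moreover have "\<phi> (plethysm_act g w) = p g" if "g \<in> GL s" for g
      unfolding f(2) GLact[OF that] p_def by (subst pleth_eq_sum) (rule dual_lincomb[OF \<phi>])
    ultimately show "\<exists>p\<in>poly_funs s. \<forall>g\<in>GL s. \<phi> (plethysm_act g w) = p g" by blast
  qed
  have hw: "has_highest_weight s e fscale plethysm_act lam W"
    unfolding has_highest_weight_def
  proof (intro bexI[of _ "pleth k d v"] conjI ballI)
    show "pleth k d v \<in> W" unfolding W_def using vM by blast
    show "plethysm_act u (pleth k d v) = pleth k d v" if u: "u \<in> upper_unitriangular s e" for u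
    proof -
      have "u \<in> GL s" using u by (simp add: upper_unitriangular_def)
      then show ?thesis using GLact fixed[OF mat_of_unitri[OF u]] by simp
    qed
    show "weight_vector s e fscale plethysm_act lam (pleth k d v)"
      unfolding weight_vector_def
    proof (intro conjI ballI allI impI len \<open>pleth k d v \<noteq> 0\<close>)
      fix g z assume g: "g \<in> GL s" and gz: "\<forall>i<N. g (e ! i) = s (z i) (e ! i)"
      have "mat_of g = mdiag N z"
        using gz by (intro ext) (auto simp: mat_of_def mdiag_def dual_scale[OF coord_dual] coord_basis)
      moreover have "act N (mdiag N z) v = (\<lambda>w. (\<Prod>i<length lam. z i ^ (lam ! i)) * v w)"
      proof
        fix w
        show "act N (mdiag N z) v w = (\<Prod>i<length lam. z i ^ (lam ! i)) * v w"
        proof (cases "v w = 0")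
          case False
          then have w: "mset w = mset (map snd (boxes N 0 lam))" "set w \<subseteq> {..<N}"
            using v(1,3) unfolding has_content_def tens_def words_def by blast+
          have "prod_list (map z w) = prod_mset (image_mset z (mset w))"
            by (simp flip: prod_mset_prod_list mset_map)
          also have "\<dots> = (\<Prod>i\<in>set_mset (mset w). z i ^ count (mset w) i)"
            by (rule image_prod_mset_multiplicity)
          also have "\<dots> = (\<Prod>i<length lam. z i ^ count (mset w) i)"
          proof (rule prod.mono_neutral_left)
            show "set_mset (mset w) \<subseteq> {..<length lam}" unfolding w(1) by (auto simp: set_boxes)
            show "\<forall>i\<in>{..<length lam} - set_mset (mset w). z i ^ count (mset w) i = 1"
              by (metis DiffD2 not_in_iff power_0)
          qed simp
          also have "\<dots> = (\<Prod>i<length lam. z i ^ (lam ! i))"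
            unfolding w(1) count_snd_boxes by (rule prod.cong) auto
          finally show ?thesis using act_mdiag[OF w(2)] by simp
        next
          case True
          show ?thesis
          proof (cases "set w \<subseteq> {..<N}")
            case False
            then have "act N (mdiag N z) v w = 0" using act_nonzero[OF mdiag_mat, of N z v w] by blast
            then show ?thesis using True by simp
          qed (simp add: True act_mdiag)
        qed
      qed
      ultimately show "plethysm_act g (pleth k d v) = fscale (\<Prod>i<length lam. z i ^ (lam ! i)) (pleth k d v)"
        using GLact[OF g, of v] by (simp add: pleth_scale)
    qed
  qed
  have "W \<subseteq> plethysm s k d" unfolding W_def using pleth_in_plethysm by blast
  with irr poly hw show ?thesis
    unfolding occurs_in_plethysm_def is_Schur_module_def by blast
qed

end

theorem theorem7p2:
  fixes scaleV :: "complex \<Rightarrow> 'v::ab_group_add \<Rightarrow> 'v"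
    and e :: "'v list"
    and d k l :: nat
    and a b :: "nat list"
  assumes "even d" and "d > 0" and "k > 0" and "l > 0"
    and "finite_dimensional_vector_space scaleV (set e)" and "distinct e"
    and "vector_space.dim scaleV UNIV \<ge> k + l"
    and "is_partition a" and "a \<noteq> []"
    and "is_partition b" and "b \<noteq> []"
    and "last a \<ge> hd b"
    and "occurs_in_plethysm scaleV e a k d"
    and "occurs_in_plethysm scaleV e b l d"
  shows "occurs_in_plethysm scaleV e (a @ b) (k + l) d"
proof -
  interpret finite_dimensional_vector_space scaleV "set e" by (fact assms)
  interpret gl_basis scaleV e by unfold_locales (fact assms)
  have "dim (UNIV :: 'v set) = card (set e)"
    using dim_eq_card[of "set e" UNIV] span_Basis independent_Basis by simp
  then have N: "k + l \<le> length e"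
    using assms(7) distinct_card[OF assms(6)] by simp
  obtain F where F: "length a \<le> length e" "F \<noteq> (\<lambda>w. 0)" "F \<in> tens (length e) (k * d)" "einv d F"
    "has_content (length e) 0 a F" "raised (length e) 0 a F"
    using hw_tensor[OF assms(13)] by blast
  obtain G where G: "length b \<le> length e" "G \<noteq> (\<lambda>w. 0)" "G \<in> tens (length e) (l * d)" "einv d G"
    "has_content (length e) 0 b G" "raised (length e) 0 b G"
    using hw_tensor[OF assms(14)] by blast
  \<comment> \<open>The degree of the tensor and its content both determine the length of a word in
    its support.\<close>
  have size: "sum_list c = n"
    if H: "H \<in> tens (length e) n" "has_content (length e) 0 c H" "H \<noteq> (\<lambda>w. 0)" for c H n
  proof -
    obtain w where "H w \<noteq> 0" using H(3) by auto
    then have "length w = n" "length w = sum_list c"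
      using H(1) content_set(2)[OF H(2)] unfolding tens_def words_def by blast+
    then show ?thesis by simp
  qed
  \<comment> \<open>Here the comparison of the last part of \<open>a\<close> with the first part of
    \<open>b\<close> enters.\<close>
  have sorted: "sorted_wrt (\<ge>) (a @ b)"
  proof -
    have a: "sorted_wrt (\<ge>) a" and b: "sorted_wrt (\<ge>) b"
      using assms(8,10) by (simp_all add: is_partition_def)
    have "last a \<le> x" if "x \<in> set a" for x
    proof -
      have "sorted_wrt (\<ge>) (butlast a @ [last a])" using a assms(9) by simp
      then show ?thesis using that assms(9) by (metis (no_types, lifting) append_butlast_last_id
            sorted_wrt_append UnE list.set_intros(1) set_append empty_iff empty_set order_refl set_ConsD)
    qed
    moreover have "y \<le> hd b" if "y \<in> set b" for y
      using b that by (cases b) auto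
    ultimately show ?thesis
      using a b assms(12) by (fastforce simp: sorted_wrt_append)
  qed
  have pos: "\<forall>x\<in>set (a @ b). 0 < x" using assms(8,10) by (auto simp: is_partition_def)
  note tc = tensor_concat[OF assms(1,2) sorted pos N F(1) G(1) size[OF F(3,5,2)] size[OF G(3,5,2)]
      F(5,6,2,4) G(5,6,2,4)]
  obtain v where "v \<in> tens (length e) ((k + l) * d)" "v \<noteq> (\<lambda>w. 0)" "has_content (length e) 0 (a @ b) v"
    "einv d v" "\<And>g. unitri (length e) g \<Longrightarrow> act (length e) g v = v"
    using tc(2) by blast
  then show ?thesis using tc(1) by (rule occurs_from_tensor)
qed

end
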